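(* Let $A$ be an $N\times D$ real matrix and $\mathbf b\in\mathbb R^N$. Suppose $P=\{\mathbf x\in\mathbb R^D : A\mathbf x\le \mathbf b\}$ is a non-empty integral polyhedron, and $\mathbf b(t)$ is a continuous function on some interval containing $0$ with $\mathbf b(0)=\mathbf b$. Suppose that for each $t\neq 0$ in the interval, $P(t)=\{\mathbf x : A\mathbf x\le \mathbf b(t)\}$ is a non-empty polyhedron with exactly $\ell$ vertices $w_{t,1},\dots,w_{t,\ell}$, and that for each $j$ with $1\le j\le \ell$ there is a fixed cone $K_j$ such that $\mathrm{fcone}(P(t),w_{t,j})=K_j$ for all $t\neq 0$ in the interval. Then for each $j$ the limit $\lim_{t\to 0}w_{t,j}$ exists, and \[ f(P,\mathbf z)=\sum_{j=1}^{\ell}\mathbf z^{\lim_{t\to 0}w_{t,j}}\, f(K_j,\mathbf z).\]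
   Context: A polyhedron is integral if all its vertices are lattice points. For a polyhedron $P$ and $v\in P$, the feasible cone is $\mathrm{fcone}(P,v)=\{u : v+\delta u\in P \text{ for all sufficiently small } \delta>0\}$. For a rational polyhedron $Q\subseteq\mathbb R^D$, $f(Q,\mathbf z)$ denotes its multivariate generating function: the unique rational function in $\mathbf z=(z_1,\dots,z_D)$ such that $Q\mapsto f(Q,\mathbf z)$ is a valuation (linear on indicator functions of polyhedra), such that if $Q$ is pointed then $f(Q,\mathbf z)=\sum_{\alpha\in Q\cap\mathbb Z^D}\mathbf z^{\alpha}$ wherever this series converges absolutely (which happens on a nonempty open set), and $f(Q,\mathbf z)=0$ if $Q$ contains a line. Here $\mathbf z^{\alpha}=\prod_i z_i^{\alpha_i}$. The identity is an identity of rational functions. *)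

theory Defs
  imports
    "HOL-Analysis.Analysis"
    "HOL-Library.Poly_Mapping"
    "HOL-Computational_Algebra.Fraction_Field"
begin

definition ineq_polyhedron :: "real^'d^'n \<Rightarrow> real^'n \<Rightarrow> (real^'d) set" where
  "ineq_polyhedron A b = {x. \<forall>i. (A *v x) $ i \<le> b $ i}"

definition rational_polyhedron :: "(real^'d) set \<Rightarrow> bool" where
  "rational_polyhedron Q \<longleftrightarrow>
     (\<exists>H :: ((real^'d) \<times> real) set.
        finite H \<and> (\<forall>(a, c)\<in>H. (\<forall>i. a $ i \<in> \<rat>) \<and> c \<in> \<rat>) \<and>
        Q = {x. \<forall>(a, c)\<in>H. a \<bullet> x \<le> c})"

definition real_vec :: "int^'d \<Rightarrow> real^'d" where
  "real_vec \<alpha> = (\<chi> i. real_of_int (\<alpha> $ i))"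

text \<open>The vertices of a polyhedron are its extreme points.\<close>

definition integral_polyhedron :: "(real^'d) set \<Rightarrow> bool" where
  "integral_polyhedron P \<longleftrightarrow> (\<forall>v. v extreme_point_of P \<longrightarrow> v \<in> range real_vec)"

definition fcone :: "(real^'d) set \<Rightarrow> real^'d \<Rightarrow> (real^'d) set" where
  "fcone P v = {u. \<forall>\<^sub>F \<delta> in at_right 0. v + \<delta> *\<^sub>R u \<in> P}"

definition contains_line :: "(real^'d) set \<Rightarrow> bool" where
  "contains_line Q \<longleftrightarrow> (\<exists>x u. u \<noteq> 0 \<and> (\<forall>c. x + c *\<^sub>R u \<in> Q))"

text \<open>
  The coordinates are indexed by a finite type \<open>'d\<close>, which also indexes the variables.
  Polynomials map exponent vectors \<open>'d \<Rightarrow>\<^sub>0 nat\<close> to complex coefficients; rational functions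
  are elements of their fraction field. The linear order on \<open>'d\<close> is only there because
  the library proves that these polynomials form an integral domain under that constraint.
\<close>

type_synonym 'd mpoly = "('d \<Rightarrow>\<^sub>0 nat) \<Rightarrow>\<^sub>0 complex"
type_synonym 'd ratfun = "'d mpoly fract"

definition rf_const :: "complex \<Rightarrow> 'd::{finite,linorder} ratfun" where
  "rf_const c = Fract (Poly_Mapping.single 0 c) 1"

definition rf_var :: "'d::{finite,linorder} \<Rightarrow> 'd::{finite,linorder} ratfun" where
  "rf_var i = Fract (Poly_Mapping.single (Poly_Mapping.single i 1) 1) 1"

definition rf_monom :: "int^'d::{finite,linorder} \<Rightarrow> 'd::{finite,linorder} ratfun" where
  "rf_monom \<alpha> = (\<Prod>i\<in>UNIV. rf_var i powi (\<alpha> $ i))"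

definition poly_eval :: "'d::{finite,linorder} mpoly \<Rightarrow> complex^'d::{finite,linorder} \<Rightarrow> complex" where
  "poly_eval p z =
     (\<Sum>m\<in>Poly_Mapping.keys p.
        Poly_Mapping.lookup p m * (\<Prod>i\<in>UNIV. (z $ i) ^ Poly_Mapping.lookup m i))"

text \<open>The rational function \<open>r\<close> is defined at \<open>z\<close> and takes the value \<open>s\<close> there.\<close>

definition rf_value :: "'d::{finite,linorder} ratfun \<Rightarrow> complex^'d::{finite,linorder} \<Rightarrow> complex \<Rightarrow> bool" where
  "rf_value r z s \<longleftrightarrow>
     (\<exists>p q. r = Fract p q \<and> poly_eval q z \<noteq> 0 \<and> s = poly_eval p z / poly_eval q z)"

definition point_monom :: "complex^'d \<Rightarrow> int^'d \<Rightarrow> complex" where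
  "point_monom z \<alpha> = (\<Prod>i\<in>UNIV. (z $ i) powi (\<alpha> $ i))"

text \<open>
  A nonempty polyhedron is pointed iff it contains no line (the empty set, whose series is
  zero, falls under the series clause). The series is considered only at points all of whose
  coordinates are nonzero, since exponents may be negative. The generating function
  concerns rational polyhedra only; the last clause fixes its value
  on all other sets, so that the characterization determines a function.
\<close>

definition is_mgf :: "((real^'d::{finite,linorder}) set \<Rightarrow> 'd::{finite,linorder} ratfun) \<Rightarrow> bool" where
  "is_mgf F \<longleftrightarrow>
     (\<forall>\<Q> c.
        finite \<Q> \<and> (\<forall>Q\<in>\<Q>. rational_polyhedron Q) \<and>
        (\<forall>x. (\<Sum>Q\<in>\<Q>. c Q * indicator Q x) = 0) \<longrightarrow>
        (\<Sum>Q\<in>\<Q>. rf_const (c Q) * F Q) = 0) \<and>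
     (\<forall>Q. rational_polyhedron Q \<and> \<not> contains_line Q \<longrightarrow>
        (\<forall>z. (\<forall>i. z $ i \<noteq> 0) \<and> (\<lambda>\<alpha>. norm (point_monom z \<alpha>)) summable_on {\<alpha>. real_vec \<alpha> \<in> Q} \<longrightarrow>
           rf_value (F Q) z (\<Sum>\<^sub>\<infinity>\<alpha>\<in>{\<alpha>. real_vec \<alpha> \<in> Q}. point_monom z \<alpha>))) \<and>
     (\<forall>Q. rational_polyhedron Q \<and> contains_line Q \<longrightarrow> F Q = 0) \<and>
     (\<forall>Q. \<not> rational_polyhedron Q \<longrightarrow> F Q = 0)"

definition mgf :: "(real^'d::{finite,linorder}) set \<Rightarrow> 'd::{finite,linorder} ratfun" where
  "mgf = (THE F. is_mgf F)"

end

theory Submission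
  imports Defs
begin

text \<open>
  A function \<open>f\<close> on the lattice that is turned into one of finite support by finitely many
  operators \<open>f \<mapsto> f - f(\<cdot> - u)\<close> with \<open>u \<noteq> 0\<close> formally represents a rational function with
  denominator \<open>\<Prod>(1 - z^u)\<close>. This assignment is well defined and linear, and it vanishes on
  functions that are periodic in some direction. Applied to the lattice points of rational
  polyhedra, it yields the generating function \<open>f(Q, z)\<close>, which is the only valuation with
  the required properties.

  For a convex set \<open>Q\<close> and a direction \<open>u\<close>, the polyhedra \<open>Q + \<real>\<^sub>+u\<close> and \<open>Q - \<real>\<^sub>+u\<close> have
  union \<open>Q + \<real>u\<close> and intersection \<open>Q\<close>, so
  \<open>f(Q, z) = f(Q + \<real>\<^sub>+u, z) + f(Q - \<real>\<^sub>+u, z)\<close>. Splitting \<open>P\<close> and all the cones \<open>K\<^sub>j\<close> in this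
  way along every generator of every \<open>K\<^sub>j\<close> and of the recession cone of \<open>P\<close> reduces the
  claim to an identity for \<open>P + C\<close> and \<open>K\<^sub>j + C\<close>, where \<open>C\<close> is spanned by all these
  generators up to sign. There each term vanishes because of a line, except that
  \<open>K\<^sub>j + C = C\<close> if \<open>K\<^sub>j \<subseteq> C\<close>. If \<open>C\<close> is pointed, then a linear functional that is negative on
  \<open>C\<close> attains its maximum on \<open>P(t)\<close> at a vertex, which shows that \<open>K\<^sub>j \<subseteq> C\<close> for exactly one
  \<open>j\<close> unless \<open>P + C\<close> contains a line; and then \<open>P + C = v\<^sub>j + C\<close> for the limit \<open>v\<^sub>j\<close> of the
  vertices, because \<open>v\<^sub>j \<in> P \<subseteq> v\<^sub>j + K\<^sub>j\<close>.
\<close>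

subsection \<open>Values of rational functions\<close>

text \<open>For nonzero t the right-hand side b(t) is an arbitrary real vector, so P(t) need not be
  rational and offers no generating function to pass to the limit with. Generating functions are
  therefore taken of P and of the cones only. A single parameter value supplies the combinatorial
  facts, namely that the apexes are distinct and that suitable functionals attain their maximum at
  one of them. The limit t to 0 serves to produce points v with P contained in v + K and v in P.
  Such a v is a vertex of P because K is pointed, and only then does integrality make z^v a Laurent
  monomial.

  Convergence of the vertices again comes from pointedness: two cluster points lie in each other's
  translated cone, so their difference lies in both K and - K. To pass inclusions to the limit,
  every point of P must be approached by points of P(t); with a fixed matrix and nonempty P(t) this
  follows from elimination of the point coordinates.\<close>

lemma poly_eval_superset:
  assumes "finite S" "Poly_Mapping.keys p \<subseteq> S"
  shows "poly_eval p z = (\<Sum>m\<in>S. Poly_Mapping.lookup p m * (\<Prod>i\<in>UNIV. (z $ i) ^ Poly_Mapping.lookup m i))"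
  unfolding poly_eval_def using assms
  by (intro sum.mono_neutral_left) (auto simp: in_keys_iff)

lemma poly_eval_zero [simp]: "poly_eval 0 z = 0"
  by (simp add: poly_eval_def)

lemma poly_eval_add: "poly_eval (p + q) z = poly_eval p z + poly_eval q z"
proof -
  let ?S = "Poly_Mapping.keys p \<union> Poly_Mapping.keys q"
  have "Poly_Mapping.keys (p + q) \<subseteq> ?S" by (rule keys_add)
  then show ?thesis
    by (simp add: poly_eval_superset[of ?S] lookup_add distrib_right sum.distrib)
qed

lemma poly_eval_single:
  "poly_eval (Poly_Mapping.single m c) z = c * (\<Prod>i\<in>UNIV. (z $ i) ^ Poly_Mapping.lookup m i)"
  by (simp add: poly_eval_superset[of "{m}"])

lemma poly_eval_one [simp]: "poly_eval 1 z = 1"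
  using poly_eval_single[of 0 1 z] by simp

lemma poly_mapping_add_single_induct:
  assumes "P 0" "\<And>f k v. P f \<Longrightarrow> P (f + Poly_Mapping.single k v)"
  shows "P (f :: 'a \<Rightarrow>\<^sub>0 'b::comm_monoid_add)"
proof (induction f rule: update_induct)
  case const
  then show ?case using assms(1) by simp
next
  case (update f a b)
  have "Poly_Mapping.update a b f = f + Poly_Mapping.single a b"
    using update(1)
    by (intro poly_mapping_eqI) (auto simp: lookup_update lookup_add lookup_single in_keys_iff when_def)
  then show ?case using assms(2)[OF update.IH] by simp
qed

lemma poly_eval_mult: "poly_eval (p * q) z = poly_eval p z * poly_eval q z"
proof (induction p rule: poly_mapping_add_single_induct)
  case 1
  then show ?case by simp
next
  case (2 f k v)
  have "poly_eval (Poly_Mapping.single k v * q) z = poly_eval (Poly_Mapping.single k v) z * poly_eval q z"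
  proof (induction q rule: poly_mapping_add_single_induct)
    case (2 g l w)
    then show ?case
      by (simp add: distrib_left poly_eval_add mult_single poly_eval_single lookup_add
          power_add prod.distrib)
  qed simp
  with 2 show ?case by (simp add: distrib_right poly_eval_add)
qed

lemma poly_eval_uminus: "poly_eval (- p) z = - poly_eval p z"
  using poly_eval_add[of p "- p" z] by (simp add: add_eq_0_iff)

lemma rf_value_unique:
  assumes "rf_value r z s" "rf_value r z s'"
  shows "s = s'"
proof -
  obtain p q p' q' where *: "r = Fract p q" "poly_eval q z \<noteq> 0" "s = poly_eval p z / poly_eval q z"
    "r = Fract p' q'" "poly_eval q' z \<noteq> 0" "s' = poly_eval p' z / poly_eval q' z"
    using assms unfolding rf_value_def by blast
  have "q \<noteq> 0" "q' \<noteq> 0" using * by auto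
  with * have "p * q' = p' * q" by (simp add: eq_fract)
  then have "poly_eval p z * poly_eval q' z = poly_eval p' z * poly_eval q z"
    by (metis poly_eval_mult)
  with * show ?thesis by (simp add: frac_eq_eq)
qed

lemma rf_value_add:
  assumes "rf_value r z s" "rf_value r' z s'"
  shows "rf_value (r + r') z (s + s')"
proof -
  obtain p q p' q' where *: "r = Fract p q" "poly_eval q z \<noteq> 0" "s = poly_eval p z / poly_eval q z"
    "r' = Fract p' q'" "poly_eval q' z \<noteq> 0" "s' = poly_eval p' z / poly_eval q' z"
    using assms unfolding rf_value_def by blast
  have "q \<noteq> 0" "q' \<noteq> 0" using * by auto
  with * show ?thesis unfolding rf_value_def
    by (intro exI[of _ "p * q' + p' * q"] exI[of _ "q * q'"])
       (simp add: poly_eval_mult poly_eval_add add_frac_eq)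
qed

lemma rf_value_mult:
  assumes "rf_value r z s" "rf_value r' z s'"
  shows "rf_value (r * r') z (s * s')"
proof -
  obtain p q p' q' where *: "r = Fract p q" "poly_eval q z \<noteq> 0" "s = poly_eval p z / poly_eval q z"
    "r' = Fract p' q'" "poly_eval q' z \<noteq> 0" "s' = poly_eval p' z / poly_eval q' z"
    using assms unfolding rf_value_def by blast
  then show ?thesis unfolding rf_value_def
    by (intro exI[of _ "p * p'"] exI[of _ "q * q'"]) (simp add: poly_eval_mult)
qed

lemma rf_value_uminus:
  assumes "rf_value r z s"
  shows "rf_value (- r) z (- s)"
proof -
  obtain p q where *: "r = Fract p q" "poly_eval q z \<noteq> 0" "s = poly_eval p z / poly_eval q z"
    using assms unfolding rf_value_def by blast
  then show ?thesis unfolding rf_value_def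
    by (intro exI[of _ "- p"] exI[of _ q]) (simp add: poly_eval_uminus)
qed

lemma rf_value_diff:
  "rf_value r z s \<Longrightarrow> rf_value r' z s' \<Longrightarrow> rf_value (r - r') z (s - s')"
  using rf_value_add[OF _ rf_value_uminus, of r z s r' s'] by simp

lemma rf_value_inverse:
  assumes "rf_value r z s" "s \<noteq> 0"
  shows "rf_value (inverse r) z (inverse s)"
proof -
  obtain p q where *: "r = Fract p q" "poly_eval q z \<noteq> 0" "s = poly_eval p z / poly_eval q z"
    using assms unfolding rf_value_def by blast
  with assms(2) show ?thesis unfolding rf_value_def
    by (intro exI[of _ q] exI[of _ p]) simp
qed

lemma rf_value_const: "rf_value (rf_const c) z c"
  unfolding rf_value_def rf_const_def
  by (intro exI[of _ "Poly_Mapping.single 0 c"] exI[of _ 1]) (simp add: poly_eval_single)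

lemma rf_value_zero: "rf_value 0 z 0" and rf_value_one: "rf_value 1 z 1"
  unfolding rf_value_def Zero_fract_def One_fract_def
  by (metis div_0 poly_eval_one poly_eval_zero zero_neq_one)
     (metis div_self poly_eval_one zero_neq_one)

lemma rf_value_var: "rf_value (rf_var i) z (z $ i)"
proof -
  have "(\<Prod>j\<in>UNIV. (z $ j) ^ (1 when i = j)) = (\<Prod>j\<in>UNIV. if j = i then z $ j else 1)"
    by (intro prod.cong) (auto simp: when_def)
  then have "(\<Prod>j\<in>UNIV. (z $ j) ^ (1 when i = j)) = z $ i" by simp
  then show ?thesis
    unfolding rf_value_def rf_var_def
    by (intro exI[of _ "Poly_Mapping.single (Poly_Mapping.single i 1) 1"] exI[of _ 1])
       (simp add: poly_eval_single lookup_single)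
qed

lemma rf_value_power: "rf_value r z s \<Longrightarrow> rf_value (r ^ n) z (s ^ n)"
  by (induction n) (auto intro: rf_value_one rf_value_mult)

lemma rf_value_power_int:
  "rf_value r z s \<Longrightarrow> s \<noteq> 0 \<Longrightarrow> rf_value (r powi n) z (s powi n)"
  by (cases "n \<ge> 0") (simp_all add: power_int_def rf_value_power rf_value_inverse)

lemma rf_value_prod:
  "(\<And>i. i \<in> S \<Longrightarrow> rf_value (f i) z (g i)) \<Longrightarrow> rf_value (prod f S) z (prod g S)"
  by (induction S rule: infinite_finite_induct) (auto intro: rf_value_one rf_value_mult)

lemma rf_value_prod_list:
  "(\<And>i. i \<in> set us \<Longrightarrow> rf_value (f i) z (g i)) \<Longrightarrow> rf_value (\<Prod>i\<leftarrow>us. f i) z (\<Prod>i\<leftarrow>us. g i)"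
  by (induction us) (auto intro: rf_value_one rf_value_mult)

lemma rf_value_sum:
  "(\<And>i. i \<in> S \<Longrightarrow> rf_value (f i) z (g i)) \<Longrightarrow> rf_value (sum f S) z (sum g S)"
  by (induction S rule: infinite_finite_induct) (auto intro: rf_value_zero rf_value_add)

lemma rf_value_monom:
  "(\<And>i. z $ i \<noteq> 0) \<Longrightarrow> rf_value (rf_monom \<alpha>) z (point_monom z \<alpha>)"
  unfolding rf_monom_def point_monom_def
  by (intro rf_value_prod rf_value_power_int rf_value_var) auto

lemma rf_var_nonzero: "rf_var i \<noteq> 0"
  using rf_value_unique[OF rf_value_var[of i "\<chi> _. 1"]] rf_value_zero by fastforce

lemma rf_monom_add: "rf_monom (\<alpha> + \<beta>) = rf_monom \<alpha> * rf_monom \<beta>"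
  by (simp add: rf_monom_def power_int_add rf_var_nonzero prod.distrib)

lemma point_monom_add:
  "(\<And>i. z $ i \<noteq> 0) \<Longrightarrow> point_monom z (\<alpha> + \<beta>) = point_monom z \<alpha> * point_monom z \<beta>"
  by (simp add: point_monom_def power_int_add prod.distrib)

lemma point_monom_nonzero: "(\<And>i. z $ i \<noteq> 0) \<Longrightarrow> point_monom z \<alpha> \<noteq> 0"
  by (simp add: point_monom_def power_int_not_zero)

text \<open>Evaluation at a point with coordinate 2 where \<open>u\<close> is nonzero and 1
  elsewhere separates the two sides. This makes every denominator factor
  \<open>1 - rf_monom u\<close> invertible.\<close>

lemma rf_monom_neq_one:
  fixes u :: "int^'d::{finite,linorder}"
  assumes "u \<noteq> 0"
  shows "rf_monom u \<noteq> 1"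
proof
  assume 1: "rf_monom u = 1"
  from assms obtain i where i: "u $ i \<noteq> 0" by (auto simp: vec_eq_iff)
  define z :: "complex^'d::{finite,linorder}" where "z = (\<chi> j. if j = i then 2 else 1)"
  have "point_monom z u = (\<Prod>j\<in>UNIV. if j = i then 2 powi (u $ i) else 1)"
    unfolding point_monom_def z_def by (intro prod.cong) auto
  also have "\<dots> = 2 powi (u $ i)" by simp
  finally have "rf_value 1 z (2 powi (u $ i))"
    using rf_value_monom[of z u] 1 by (simp add: z_def split: if_splits)
  with rf_value_unique[OF rf_value_one] have "(2::complex) powi (u $ i) = 1" by fastforce
  then have "norm ((2::complex) powi (u $ i)) = 1" by simp
  then have "(2::real) powi (u $ i) = 2 powi 0" by (simp add: norm_power_int)
  then show False using i power_int_strict_increasing[of 0 "u $ i" "2::real"]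
      power_int_strict_increasing[of "u $ i" 0 "2::real"] by (cases "u $ i < 0") auto
qed

lemma rf_const_zero [simp]: "rf_const 0 = 0"
  by (simp add: rf_const_def Zero_fract_def)

lemma rf_const_one [simp]: "rf_const 1 = 1"
  by (simp add: rf_const_def One_fract_def)

lemma rf_const_add: "rf_const (a + b) = rf_const a + rf_const b"
  by (simp add: rf_const_def single_add)

lemma rf_const_mult: "rf_const (a * b) = rf_const a * rf_const b"
  by (simp add: rf_const_def mult_single)

lemma rf_const_uminus: "rf_const (- a) = - rf_const a"
  using rf_const_add[of a "- a"] by (simp add: add_eq_0_iff)

subsection \<open>Rational functions of functions on the lattice\<close>

definition diff_op :: "int^'d \<Rightarrow> (int^'d \<Rightarrow> complex) \<Rightarrow> int^'d \<Rightarrow> complex" where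
  "diff_op u f = (\<lambda>\<alpha>. f \<alpha> - f (\<alpha> - u))"

definition diff_ops :: "(int^'d) list \<Rightarrow> (int^'d \<Rightarrow> complex) \<Rightarrow> int^'d \<Rightarrow> complex" where
  "diff_ops us f = foldr diff_op us f"

abbreviation fin_supp :: "('a \<Rightarrow> 'b::zero) \<Rightarrow> bool" where
  "fin_supp f \<equiv> finite {\<alpha>. f \<alpha> \<noteq> 0}"

lemma diff_ops_Nil [simp]: "diff_ops [] f = f"
  and diff_ops_Cons [simp]: "diff_ops (u # us) f = diff_op u (diff_ops us f)"
  by (simp_all add: diff_ops_def)

lemma diff_ops_append: "diff_ops (us @ vs) f = diff_ops us (diff_ops vs f)"
  by (simp add: diff_ops_def)

lemma diff_op_commute: "diff_op u (diff_op v f) = diff_op v (diff_op u f)"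
  by (auto simp: diff_op_def fun_eq_iff diff_diff_eq add.commute)

lemma diff_ops_diff_op: "diff_ops us (diff_op v f) = diff_op v (diff_ops us f)"
  by (induction us) (auto simp: diff_op_commute)

lemma diff_ops_commute: "diff_ops us (diff_ops vs f) = diff_ops vs (diff_ops us f)"
  by (induction us) (auto simp: diff_ops_diff_op)

lemma diff_op_add: "diff_op u (\<lambda>\<alpha>. f \<alpha> + g \<alpha>) = (\<lambda>\<alpha>. diff_op u f \<alpha> + diff_op u g \<alpha>)"
  by (auto simp: diff_op_def)

lemma diff_ops_add: "diff_ops us (\<lambda>\<alpha>. f \<alpha> + g \<alpha>) = (\<lambda>\<alpha>. diff_ops us f \<alpha> + diff_ops us g \<alpha>)"
  by (induction us) (auto simp: diff_op_add)

lemma diff_ops_scale: "diff_ops us (\<lambda>\<alpha>. c * f \<alpha>) = (\<lambda>\<alpha>. c * diff_ops us f \<alpha>)"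
  by (induction us) (auto simp: diff_op_def right_diff_distrib)

lemma diff_ops_shift: "diff_ops us (\<lambda>\<alpha>. f (\<alpha> - v)) = (\<lambda>\<alpha>. diff_ops us f (\<alpha> - v))"
  by (induction us) (auto simp: diff_op_def diff_diff_eq add.commute)

lemma fin_supp_shift: "fin_supp f \<Longrightarrow> fin_supp (\<lambda>\<alpha>. f (\<alpha> - v))" for v :: "'a::group_add"
  using finite_imageI[of "{\<alpha>. f \<alpha> \<noteq> 0}" "\<lambda>\<alpha>. \<alpha> + v"]
  by (rule finite_subset[rotated]) (auto simp: image_iff intro!: exI[of _ "_ - v"])

lemma fin_supp_add: "fin_supp f \<Longrightarrow> fin_supp g \<Longrightarrow> fin_supp (\<lambda>\<alpha>. f \<alpha> + g \<alpha>)"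
  for f g :: "'a \<Rightarrow> 'b::monoid_add"
  by (rule finite_subset[of _ "{\<alpha>. f \<alpha> \<noteq> 0} \<union> {\<alpha>. g \<alpha> \<noteq> 0}"]) auto

lemma fin_supp_diff: "fin_supp f \<Longrightarrow> fin_supp g \<Longrightarrow> fin_supp (\<lambda>\<alpha>. f \<alpha> - g \<alpha>)"
  for f g :: "'a \<Rightarrow> 'b::group_add"
  by (rule finite_subset[of _ "{\<alpha>. f \<alpha> \<noteq> 0} \<union> {\<alpha>. g \<alpha> \<noteq> 0}"]) auto

lemma fin_supp_diff_ops: "fin_supp f \<Longrightarrow> fin_supp (diff_ops us f)"
  by (induction us) (auto simp only: diff_ops_Nil diff_ops_Cons diff_op_def intro!: fin_supp_diff fin_supp_shift)

definition rf_laurent :: "(int^'d::{finite,linorder} \<Rightarrow> complex) \<Rightarrow> 'd::{finite,linorder} ratfun" where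
  "rf_laurent g = (\<Sum>\<alpha> | g \<alpha> \<noteq> 0. rf_const (g \<alpha>) * rf_monom \<alpha>)"

lemma rf_laurent_superset:
  assumes "finite S" "{\<alpha>. g \<alpha> \<noteq> 0} \<subseteq> S"
  shows "rf_laurent g = (\<Sum>\<alpha>\<in>S. rf_const (g \<alpha>) * rf_monom \<alpha>)"
  unfolding rf_laurent_def using assms by (intro sum.mono_neutral_left) auto

lemma rf_laurent_zero [simp]: "rf_laurent (\<lambda>_. 0) = 0"
  by (simp add: rf_laurent_def)

lemma rf_laurent_add:
  assumes "fin_supp f" "fin_supp g"
  shows "rf_laurent (\<lambda>\<alpha>. f \<alpha> + g \<alpha>) = rf_laurent f + rf_laurent g"
proof -
  let ?S = "{\<alpha>. f \<alpha> \<noteq> 0} \<union> {\<alpha>. g \<alpha> \<noteq> 0}"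
  have "finite ?S" using assms by simp
  then show ?thesis
    by (subst (1 2 3) rf_laurent_superset[of ?S])
       (auto simp: rf_const_add distrib_right sum.distrib)
qed

lemma rf_laurent_scale:
  assumes "fin_supp f"
  shows "rf_laurent (\<lambda>\<alpha>. c * f \<alpha>) = rf_const c * rf_laurent f"
  using assms
  by (subst (1 2) rf_laurent_superset[of "{\<alpha>. f \<alpha> \<noteq> 0}"])
     (auto simp: rf_const_mult sum_distrib_left mult.assoc)

lemma rf_laurent_shift:
  assumes "fin_supp f"
  shows "rf_laurent (\<lambda>\<alpha>. f (\<alpha> - v)) = rf_monom v * rf_laurent f"
proof -
  have "bij_betw (\<lambda>\<alpha>. \<alpha> + v) {\<alpha>. f \<alpha> \<noteq> 0} {\<alpha>. f (\<alpha> - v) \<noteq> 0}"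
    by (rule bij_betwI[where g = "\<lambda>\<alpha>. \<alpha> - v"]) auto
  then have "rf_laurent (\<lambda>\<alpha>. f (\<alpha> - v)) = (\<Sum>\<alpha> | f \<alpha> \<noteq> 0. rf_const (f \<alpha>) * rf_monom (\<alpha> + v))"
    unfolding rf_laurent_def by (subst sum.reindex_bij_betw[symmetric]) auto
  then show ?thesis
    by (simp add: rf_laurent_def rf_monom_add sum_distrib_left mult_ac)
qed

lemma rf_laurent_diff_op:
  assumes "fin_supp f"
  shows "rf_laurent (diff_op u f) = (1 - rf_monom u) * rf_laurent f"
proof -
  have shift: "fin_supp (\<lambda>\<alpha>. (-1) * f (\<alpha> - u))" using fin_supp_shift[OF assms] by simp
  have "rf_laurent (\<lambda>\<alpha>. (-1) * f (\<alpha> - u)) = rf_const (-1) * (rf_monom u * rf_laurent f)"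
    using rf_laurent_scale[OF fin_supp_shift[OF assms]] rf_laurent_shift[OF assms] by metis
  then have "rf_laurent (\<lambda>\<alpha>. f \<alpha> + (-1) * f (\<alpha> - u)) = rf_laurent f - rf_monom u * rf_laurent f"
    using rf_laurent_add[OF assms shift] by (simp add: rf_const_uminus)
  then show ?thesis by (simp add: diff_op_def algebra_simps)
qed

definition rf_denom :: "(int^'d::{finite,linorder}) list \<Rightarrow> 'd::{finite,linorder} ratfun" where
  "rf_denom us = (\<Prod>u\<leftarrow>us. 1 - rf_monom u)"

lemma rf_denom_nonzero: "0 \<notin> set us \<Longrightarrow> rf_denom us \<noteq> 0"
  using rf_monom_neq_one by (induction us) (auto simp: rf_denom_def)

lemma rf_denom_append: "rf_denom (us @ vs) = rf_denom us * rf_denom vs"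
  by (simp add: rf_denom_def)

lemma rf_laurent_diff_ops:
  assumes "fin_supp f"
  shows "rf_laurent (diff_ops us f) = rf_denom us * rf_laurent f"
  by (induction us)
     (auto simp: rf_denom_def rf_laurent_diff_op fin_supp_diff_ops assms mult.assoc)

text \<open>
  This assigns to a function on the lattice the rational function its generating series
  formally represents; series with different domains of convergence, and even nowhere
  convergent ones, are treated on the same footing.
\<close>

definition has_rf :: "(int^'d::{finite,linorder} \<Rightarrow> complex) \<Rightarrow> 'd::{finite,linorder} ratfun \<Rightarrow> bool" where
  "has_rf f r \<longleftrightarrow> (\<exists>us. 0 \<notin> set us \<and> fin_supp (diff_ops us f) \<and>
     r * rf_denom us = rf_laurent (diff_ops us f))"

lemma has_rfI:
  assumes "0 \<notin> set us" "fin_supp (diff_ops us f)"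
  shows "has_rf f (rf_laurent (diff_ops us f) / rf_denom us)"
  unfolding has_rf_def using assms rf_denom_nonzero by (intro exI[of _ us]) auto

text \<open>The two annihilating lists may differ. Since the operators commute, applying each list
  after the other gives the same function of finite support, and the nonzero denominators cancel in
  the field.\<close>

lemma has_rf_unique:
  assumes "has_rf f r" "has_rf f r'"
  shows "r = r'"
proof -
  obtain us where us: "0 \<notin> set us" "fin_supp (diff_ops us f)" "r * rf_denom us = rf_laurent (diff_ops us f)"
    using assms(1) unfolding has_rf_def by blast
  obtain vs where vs: "0 \<notin> set vs" "fin_supp (diff_ops vs f)" "r' * rf_denom vs = rf_laurent (diff_ops vs f)"
    using assms(2) unfolding has_rf_def by blast
  have "rf_denom vs * (r * rf_denom us) = rf_laurent (diff_ops vs (diff_ops us f))"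
    using us by (simp add: rf_laurent_diff_ops)
  also have "\<dots> = rf_laurent (diff_ops us (diff_ops vs f))" by (simp add: diff_ops_commute)
  also have "\<dots> = rf_denom us * (r' * rf_denom vs)"
    using vs by (simp add: rf_laurent_diff_ops)
  finally show ?thesis using rf_denom_nonzero[OF us(1)] rf_denom_nonzero[OF vs(1)] by simp
qed

lemma has_rf_zero: "has_rf (\<lambda>_. 0) 0"
  unfolding has_rf_def by (intro exI[of _ "[]"]) auto

lemma has_rf_add:
  assumes "has_rf f r" "has_rf g r'"
  shows "has_rf (\<lambda>\<alpha>. f \<alpha> + g \<alpha>) (r + r')"
proof -
  obtain us where us: "0 \<notin> set us" "fin_supp (diff_ops us f)" "r * rf_denom us = rf_laurent (diff_ops us f)"
    using assms(1) unfolding has_rf_def by blast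
  obtain vs where vs: "0 \<notin> set vs" "fin_supp (diff_ops vs g)" "r' * rf_denom vs = rf_laurent (diff_ops vs g)"
    using assms(2) unfolding has_rf_def by blast
  have eq: "diff_ops (us @ vs) (\<lambda>\<alpha>. f \<alpha> + g \<alpha>) =
      (\<lambda>\<alpha>. diff_ops vs (diff_ops us f) \<alpha> + diff_ops us (diff_ops vs g) \<alpha>)"
    by (simp add: diff_ops_append diff_ops_add diff_ops_commute)
  have "(r + r') * rf_denom (us @ vs) = rf_denom vs * (r * rf_denom us) + rf_denom us * (r' * rf_denom vs)"
    by (simp add: rf_denom_append algebra_simps)
  also have "\<dots> = rf_laurent (diff_ops (us @ vs) (\<lambda>\<alpha>. f \<alpha> + g \<alpha>))"
    unfolding eq using us vs by (simp add: rf_laurent_add fin_supp_diff_ops rf_laurent_diff_ops)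
  finally show ?thesis
    unfolding has_rf_def using us vs eq
    by (intro exI[of _ "us @ vs"]) (auto intro!: fin_supp_add fin_supp_diff_ops)
qed

lemma has_rf_scale:
  assumes "has_rf f r"
  shows "has_rf (\<lambda>\<alpha>. c * f \<alpha>) (rf_const c * r)"
proof -
  obtain us where us: "0 \<notin> set us" "fin_supp (diff_ops us f)" "r * rf_denom us = rf_laurent (diff_ops us f)"
    using assms(1) unfolding has_rf_def by blast
  then show ?thesis unfolding has_rf_def
    by (intro exI[of _ us]) (auto simp: diff_ops_scale rf_laurent_scale mult.assoc)
qed

lemma has_rf_shift:
  assumes "has_rf f r"
  shows "has_rf (\<lambda>\<alpha>. f (\<alpha> - v)) (rf_monom v * r)"
proof -
  obtain us where us: "0 \<notin> set us" "fin_supp (diff_ops us f)" "r * rf_denom us = rf_laurent (diff_ops us f)"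
    using assms(1) unfolding has_rf_def by blast
  then show ?thesis unfolding has_rf_def
    by (intro exI[of _ us]) (auto simp: diff_ops_shift rf_laurent_shift mult.assoc intro!: fin_supp_shift)
qed

lemma has_rf_sum:
  "(\<And>i. i \<in> S \<Longrightarrow> has_rf (f i) (r i)) \<Longrightarrow> has_rf (\<lambda>\<alpha>. \<Sum>i\<in>S. f i \<alpha>) (\<Sum>i\<in>S. r i)"
  by (induction S rule: infinite_finite_induct) (auto intro: has_rf_zero has_rf_add)

text \<open>The single shift by \<open>u\<close> already annihilates \<open>f\<close>.\<close>

lemma has_rf_periodic:
  assumes "u \<noteq> 0" "\<And>\<alpha>. f (\<alpha> - u) = f \<alpha>"
  shows "has_rf f 0"
  unfolding has_rf_def using assms by (intro exI[of _ "[u]"]) (auto simp: diff_op_def)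

section \<open>Values at points of convergence\<close>

lemma diff_op_has_sum:
  assumes "\<And>i. z $ i \<noteq> 0" "((\<lambda>\<alpha>. f \<alpha> * point_monom z \<alpha>) has_sum s) UNIV"
  shows "((\<lambda>\<alpha>. diff_op u f \<alpha> * point_monom z \<alpha>) has_sum ((1 - point_monom z u) * s)) UNIV"
proof -
  have bij: "bij_betw (\<lambda>\<alpha>. \<alpha> - u) UNIV UNIV"
    by (rule bij_betwI[where g = "\<lambda>\<alpha>. \<alpha> + u"]) auto
  have "((\<lambda>\<alpha>. - point_monom z u * (f (\<alpha> - u) * point_monom z (\<alpha> - u))) has_sum (- point_monom z u * s)) UNIV"
    using assms(2) by (intro has_sum_cmult_right)
      (subst has_sum_reindex_bij_betw[OF bij, where f = "\<lambda>\<alpha>. f \<alpha> * point_monom z \<alpha>"])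
  from has_sum_add[OF assms(2) this]
  have "((\<lambda>\<alpha>. f \<alpha> * point_monom z \<alpha> - f (\<alpha> - u) * (point_monom z u * point_monom z (\<alpha> - u)))
      has_sum ((1 - point_monom z u) * s)) UNIV"
    by (simp add: algebra_simps)
  then show ?thesis
    by (simp add: point_monom_add[OF assms(1), symmetric] diff_op_def left_diff_distrib)
qed

lemma diff_ops_has_sum:
  assumes "\<And>i. z $ i \<noteq> 0" "((\<lambda>\<alpha>. f \<alpha> * point_monom z \<alpha>) has_sum s) UNIV"
  shows "((\<lambda>\<alpha>. diff_ops us f \<alpha> * point_monom z \<alpha>) has_sum ((\<Prod>u\<leftarrow>us. 1 - point_monom z u) * s)) UNIV"
proof (induction us)
  case (Cons u us)
  from diff_op_has_sum[OF assms(1) this, of u] show ?case by (simp add: mult.assoc)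
qed (use assms in simp)

lemma rf_value_laurent:
  assumes "\<And>i. z $ i \<noteq> 0" "fin_supp g" "((\<lambda>\<alpha>. g \<alpha> * point_monom z \<alpha>) has_sum s) UNIV"
  shows "rf_value (rf_laurent g) z s"
proof -
  have "((\<lambda>\<alpha>. g \<alpha> * point_monom z \<alpha>) has_sum (\<Sum>\<alpha> | g \<alpha> \<noteq> 0. g \<alpha> * point_monom z \<alpha>)) UNIV"
    by (rule has_sum_finite_neutralI[OF assms(2)]) auto
  with assms(3) have "s = (\<Sum>\<alpha> | g \<alpha> \<noteq> 0. g \<alpha> * point_monom z \<alpha>)"
    by (rule has_sum_unique)
  then show ?thesis unfolding rf_laurent_def
    using assms(1) by (auto intro!: rf_value_sum rf_value_mult rf_value_const rf_value_monom)
qed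

text \<open>Ties the formal assignment to analysis: each operator multiplies a convergent sum by
  \<open>1 - point_monom z u\<close>, so the sum is recovered by division where these factors are
  nonzero.\<close>

lemma has_rf_value:
  assumes z: "\<And>i. z $ i \<noteq> 0"
    and us: "fin_supp (diff_ops us f)" "\<And>u. u \<in> set us \<Longrightarrow> point_monom z u \<noteq> 1"
    and s: "((\<lambda>\<alpha>. f \<alpha> * point_monom z \<alpha>) has_sum s) UNIV"
  shows "rf_value (rf_laurent (diff_ops us f) / rf_denom us) z s"
proof -
  let ?d = "\<Prod>u\<leftarrow>us. 1 - point_monom z u"
  have d: "?d \<noteq> 0" using us(2) by (induction us) auto
  have "rf_value (rf_laurent (diff_ops us f)) z (?d * s)"
    by (intro rf_value_laurent diff_ops_has_sum z us(1) s)
  moreover have "rf_value (inverse (rf_denom us)) z (inverse ?d)"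
    unfolding rf_denom_def using d z
    by (intro rf_value_inverse rf_value_prod_list rf_value_diff rf_value_one rf_value_monom)
  ultimately have "rf_value (rf_laurent (diff_ops us f) * inverse (rf_denom us)) z (?d * s * inverse ?d)"
    by (rule rf_value_mult)
  moreover have "?d * s * inverse ?d = s" using d by simp
  ultimately show ?thesis by (simp add: divide_inverse)
qed

text \<open>Along an orbit of translations by \<open>u\<close> the series contains a geometric series.\<close>

lemma norm_point_monom_less_1:
  assumes z: "\<And>i. z $ i \<noteq> 0" and "u \<noteq> 0" "\<alpha> \<in> S" "\<And>\<beta>. \<beta> \<in> S \<Longrightarrow> \<beta> + u \<in> S"
    and "(\<lambda>\<alpha>. norm (point_monom z \<alpha>)) summable_on S"
  shows "norm (point_monom z u) < 1"
proof -
  define h where "h = (\<lambda>k. ((+) u ^^ k) \<alpha>)"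
  have h_Suc: "h (Suc k) = h k + u" for k by (simp add: h_def add.commute)
  have hS: "h k \<in> S" for k
  proof (induction k)
    case (Suc k)
    then show ?case using assms(4) by (simp only: h_Suc)
  qed (use assms(3) in \<open>simp add: h_def\<close>)
  have pm: "norm (point_monom z (h k)) = norm (point_monom z \<alpha>) * norm (point_monom z u) ^ k" for k
  proof (induction k)
    case (Suc k)
    then show ?case using z by (simp add: h_Suc point_monom_add norm_mult)
  qed (simp add: h_def)
  obtain i where i: "u $ i \<noteq> 0" using \<open>u \<noteq> 0\<close> by (auto simp: vec_eq_iff)
  have "h k $ i = \<alpha> $ i + int k * u $ i" for k
  proof (induction k)
    case (Suc k)
    then show ?case by (simp only: h_Suc) (simp add: algebra_simps)
  qed (simp add: h_def)
  then have "k = l" if "h k = h l" for k l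
    using arg_cong[OF that, of "\<lambda>x. x $ i"] i by simp
  then have "inj h" by (auto intro: injI)
  have "(\<lambda>\<alpha>. norm (point_monom z \<alpha>)) summable_on range h"
    using assms(5) by (rule summable_on_subset_banach) (use hS in auto)
  then have "((\<lambda>\<alpha>. norm (point_monom z \<alpha>)) \<circ> h) summable_on UNIV"
    using summable_on_reindex[OF \<open>inj h\<close>] by blast
  then have "summable (\<lambda>k. norm (point_monom z \<alpha>) * norm (point_monom z u) ^ k)"
    by (intro summable_on_imp_summable) (simp add: o_def pm)
  then have "summable (\<lambda>k. norm (point_monom z u) ^ k)"
    using point_monom_nonzero[OF z] by (simp add: summable_cmult_iff)
  then show ?thesis by simp
qed

section \<open>Rational functions determined by their values on a domain of convergence\<close>

definition idot :: "int^'d \<Rightarrow> int^'d \<Rightarrow> int" where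
  "idot a u = (\<Sum>i\<in>UNIV. a $ i * u $ i)"

lemma idot_add: "idot a (u + v) = idot a u + idot a v"
  by (simp add: idot_def distrib_left sum.distrib)

lemma idot_diff: "idot a (u - v) = idot a u - idot a v"
  by (simp add: idot_def right_diff_distrib sum_subtractf)

lemma idot_zero [simp]: "idot a 0 = 0" "idot 0 a = 0"
  by (simp_all add: idot_def)

text \<open>Subtracting \<open>x m\<close> times one power sum from the next removes the term of
  \<open>m\<close> and multiplies every other coefficient by the nonzero number
  \<open>x n - x m\<close>. Exponents start at 1: for exponent 0 the evaluation point used below is
  the all-ones vector, where the series may diverge.\<close>

lemma vandermonde_zero:
  fixes c x :: "'a \<Rightarrow> 'b::field"
  assumes "finite M" "inj_on x M" "\<And>m. m \<in> M \<Longrightarrow> x m \<noteq> 0"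
    and "\<And>k. k \<ge> 1 \<Longrightarrow> (\<Sum>m\<in>M. c m * x m ^ k) = 0"
  shows "\<forall>m\<in>M. c m = 0"
  using assms
proof (induction M arbitrary: c rule: finite_induct)
  case (insert m M)
  have "\<forall>n\<in>M. c n * (x n - x m) = 0"
  proof (rule insert.IH)
    fix k :: nat assume "k \<ge> 1"
    have "(\<Sum>n\<in>insert m M. c n * x n ^ Suc k) - x m * (\<Sum>n\<in>insert m M. c n * x n ^ k) = 0"
      using insert.prems(3)[of k] insert.prems(3)[of "Suc k"] \<open>k \<ge> 1\<close> by simp
    then show "(\<Sum>n\<in>M. c n * (x n - x m) * x n ^ k) = 0"
      using insert.hyps by (simp add: algebra_simps sum_distrib_left sum_subtractf)
  qed (use insert.prems in auto)
  then have *: "\<forall>n\<in>M. c n = 0"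
    using insert.prems(1) insert.hyps(2)
    by (metis eq_iff_diff_eq_0 inj_on_def insertCI mult_eq_0_iff)
  moreover have "c m = 0"
    using insert.prems(3)[of 1] insert.prems(2)[of m] insert.hyps * by simp
  ultimately show ?case by simp
qed simp

text \<open>With the powers of a number e as weights, each \<open>d\<close> yields a nonzero
  polynomial in e, so all but finitely many e in (0, 1] serve.\<close>

lemma exists_generic_weights:
  fixes a :: "nat \<Rightarrow> int^'d" and n :: nat
  assumes "finite D" "\<And>d. d \<in> D \<Longrightarrow> \<exists>i\<le>n. idot (a i) d \<noteq> 0"
  obtains y :: "nat \<Rightarrow> real" where "\<And>i. y i > 0" "\<And>d. d \<in> D \<Longrightarrow> (\<Sum>i\<le>n. y i * of_int (idot (a i) d)) \<noteq> 0"
proof -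
  have "finite {e::real. (\<Sum>i\<le>n. of_int (idot (a i) d) * e ^ i) = 0}" if "d \<in> D" for d
    using assms(2)[OF that] polyfun_finite_roots[of "\<lambda>i. of_int (idot (a i) d) :: real" n] by auto
  moreover define R where "R = (\<Union>d\<in>D. {e::real. (\<Sum>i\<le>n. of_int (idot (a i) d) * e ^ i) = 0})"
  ultimately have "finite R" using assms(1) by blast
  moreover have "infinite {0<..(1::real)}" by (simp add: infinite_Ioc)
  ultimately obtain e where "e \<in> {0<..1}" "e \<notin> R" by (meson finite_subset subsetI)
  then have "0 < e" "\<And>d. d \<in> D \<Longrightarrow> (\<Sum>i\<le>n. of_int (idot (a i) d) * e ^ i) \<noteq> 0" by (auto simp: R_def)
  then show thesis by (intro that[of "\<lambda>i. e ^ i"]) (simp_all add: mult.commute)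
qed

text \<open>A point of \<open>S\<close> is determined by its slacks
  \<open>c i - idot (a i) \<alpha>\<close>, which are natural numbers, so the series is dominated by
  a product of geometric series with ratios \<open>exp (- y i)\<close>.\<close>

lemma exp_linear_summable:
  fixes a :: "nat \<Rightarrow> int^'d" and n :: nat and y :: "nat \<Rightarrow> real"
  assumes S: "\<And>\<alpha> i. \<alpha> \<in> S \<Longrightarrow> i \<le> n \<Longrightarrow> idot (a i) \<alpha> \<le> c i"
    and y: "\<And>i. y i > 0"
    and ker: "\<And>u. u \<noteq> 0 \<Longrightarrow> \<exists>i\<le>n. idot (a i) u \<noteq> 0"
  shows "(\<lambda>\<alpha>. exp (\<Sum>i\<le>n. y i * of_int (idot (a i) \<alpha>))) summable_on S"
proof (rule nonneg_bdd_above_summable_on)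
  define \<phi> where "\<phi> \<alpha> = (\<lambda>i\<in>{..n}. nat (c i - idot (a i) \<alpha>))" for \<alpha>
  define C where "C = exp (\<Sum>i\<le>n. y i * of_int (c i))"
  define r where "r i = exp (- y i)" for i
  have r: "0 < r i" "r i < 1" for i using y[of i] by (auto simp: r_def)
  have inj: "inj_on \<phi> S"
  proof (rule inj_onI, rule ccontr)
    fix \<alpha> \<beta> assume *: "\<alpha> \<in> S" "\<beta> \<in> S" "\<phi> \<alpha> = \<phi> \<beta>" "\<alpha> \<noteq> \<beta>"
    obtain i where i: "i \<le> n" "idot (a i) (\<alpha> - \<beta>) \<noteq> 0" using ker[of "\<alpha> - \<beta>"] * by auto
    have "nat (c i - idot (a i) \<alpha>) = nat (c i - idot (a i) \<beta>)"
      using fun_cong[OF *(3), of i] i by (simp add: \<phi>_def)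
    then show False using i S[OF *(1) i(1)] S[OF *(2) i(1)] by (simp add: idot_diff)
  qed
  have eq: "exp (\<Sum>i\<le>n. y i * of_int (idot (a i) \<alpha>)) = C * (\<Prod>i\<le>n. r i ^ \<phi> \<alpha> i)" if "\<alpha> \<in> S" for \<alpha>
  proof -
    have "r i ^ \<phi> \<alpha> i = exp (y i * of_int (idot (a i) \<alpha>) - y i * of_int (c i))" if "i \<le> n" for i
      using S[OF \<open>\<alpha> \<in> S\<close> that] that
      by (simp add: r_def \<phi>_def exp_of_nat_mult[symmetric] algebra_simps)
    then have "(\<Prod>i\<le>n. r i ^ \<phi> \<alpha> i) = exp (\<Sum>i\<le>n. y i * of_int (idot (a i) \<alpha>) - y i * of_int (c i))"
      by (simp add: exp_sum)
    then show ?thesis by (simp add: C_def exp_add[symmetric] sum_subtractf)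
  qed
  show "bdd_above (sum (\<lambda>\<alpha>. exp (\<Sum>i\<le>n. y i * of_int (idot (a i) \<alpha>))) ` {F. F \<subseteq> S \<and> finite F})"
  proof (rule bdd_aboveI2[where M = "C * (\<Prod>i\<le>n. 1 / (1 - r i))"])
    fix F assume "F \<in> {F. F \<subseteq> S \<and> finite F}"
    then have F: "F \<subseteq> S" "finite F" by auto
    define N where "N = Max (insert 0 ((\<lambda>(\<alpha>, i). \<phi> \<alpha> i) ` (F \<times> {..n})))"
    have N: "\<phi> \<alpha> i \<le> N" if "\<alpha> \<in> F" "i \<le> n" for \<alpha> i
      unfolding N_def using that F(2) by (intro Max_ge) auto
    have "sum (\<lambda>\<alpha>. exp (\<Sum>i\<le>n. y i * of_int (idot (a i) \<alpha>))) F = C * (\<Sum>\<alpha>\<in>F. \<Prod>i\<le>n. r i ^ \<phi> \<alpha> i)"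
      using F eq by (auto simp: sum_distrib_left intro!: sum.cong)
    also have "(\<Sum>\<alpha>\<in>F. \<Prod>i\<le>n. r i ^ \<phi> \<alpha> i) = (\<Sum>g\<in>\<phi> ` F. \<Prod>i\<le>n. r i ^ g i)"
      using inj_on_subset[OF inj F(1)] by (simp add: sum.reindex)
    also have "\<dots> \<le> (\<Sum>g\<in>PiE {..n} (\<lambda>_. {..N}). \<Prod>i\<le>n. r i ^ g i)"
    proof (rule sum_mono2)
      show "\<phi> ` F \<subseteq> PiE {..n} (\<lambda>_. {..N})" using N
        by (intro image_subsetI PiE_I) (auto, simp add: \<phi>_def)
    qed (auto intro!: finite_PiE prod_nonneg simp: less_imp_le[OF r(1)])
    also have "\<dots> = (\<Prod>i\<le>n. \<Sum>k\<le>N. r i ^ k)"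
      by (subst prod_sum_PiE) auto
    also have "\<dots> \<le> (\<Prod>i\<le>n. 1 / (1 - r i))"
    proof (rule prod_mono, rule conjI)
      fix i
      show "0 \<le> (\<Sum>k\<le>N. r i ^ k)" using r[of i] by (intro sum_nonneg) auto
      have "(\<Sum>k\<le>N. r i ^ k) \<le> suminf (\<lambda>k. r i ^ k)"
        using r[of i] by (intro sum_le_suminf summable_geometric) auto
      then show "(\<Sum>k\<le>N. r i ^ k) \<le> 1 / (1 - r i)"
        using r[of i] by (subst (asm) suminf_geometric) auto
    qed
    finally show "sum (\<lambda>\<alpha>. exp (\<Sum>i\<le>n. y i * of_int (idot (a i) \<alpha>))) F \<le> C * (\<Prod>i\<le>n. 1 / (1 - r i))"
      by (simp add: C_def)
  qed
qed simp

text \<open>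
  Evaluation at the points \<open>exp (k \<xi>)\<close>, where \<open>\<xi>\<close> is a generic vector in the open cone spanned
  by the constraint normals, reduces the uniqueness of the rational function to the linear
  independence of geometric progressions.
\<close>

lemma rf_determined_by_values:
  fixes a :: "nat \<Rightarrow> int^'d::{finite,linorder}" and n :: nat
  assumes S: "\<And>\<alpha> i. \<alpha> \<in> S \<Longrightarrow> i \<le> n \<Longrightarrow> idot (a i) \<alpha> \<le> c i"
    and ker: "\<And>u. u \<noteq> 0 \<Longrightarrow> \<exists>i\<le>n. idot (a i) u \<noteq> 0"
    and val: "\<And>z. (\<And>i. z $ i \<noteq> 0) \<Longrightarrow> (\<lambda>\<alpha>. norm (point_monom z \<alpha>)) summable_on S \<Longrightarrow>
      rf_value r z (s z) \<and> rf_value r' z (s z)"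
  shows "r = r'"
proof -
  obtain p q where pq: "r - r' = Fract p q" "q \<noteq> 0" by (meson Fract_cases)
  define M where "M = Poly_Mapping.keys p"
  define iv :: "('d \<Rightarrow>\<^sub>0 nat) \<Rightarrow> int^'d::{finite,linorder}" where "iv m = (\<chi> i. int (Poly_Mapping.lookup m i))" for m
  \<comment> \<open>Weights that do not vanish on these differences take distinct values on the
    exponents of \<open>p\<close>, so that the monomials of \<open>p\<close> yield distinct
    geometric progressions.\<close>
  define D where "D = (\<lambda>(m, m'). iv m - iv m') ` (M \<times> M) - {0}"
  have "finite D" by (simp add: D_def M_def)
  moreover have "\<exists>i\<le>n. idot (a i) d \<noteq> 0" if "d \<in> D" for d
    using ker that by (simp add: D_def)
  ultimately obtain y :: "nat \<Rightarrow> real" where y: "\<And>i. y i > 0" "\<And>d. d \<in> D \<Longrightarrow> (\<Sum>i\<le>n. y i * of_int (idot (a i) d)) \<noteq> 0"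
    using exists_generic_weights[of D n a] by blast
  define \<xi> where "\<xi> j = (\<Sum>i\<le>n. y i * of_int (a i $ j))" for j
  define L where "L \<alpha> = (\<Sum>i\<le>n. y i * of_int (idot (a i) \<alpha>))" for \<alpha>
  have L: "L \<alpha> = (\<Sum>j\<in>UNIV. \<xi> j * of_int (\<alpha> $ j))" for \<alpha>
    unfolding L_def \<xi>_def idot_def
    by (simp add: sum_distrib_left sum_distrib_right mult.assoc sum.swap[of _ _ UNIV])
  define z where "z k = (\<chi> j. (exp (of_real (real k * \<xi> j)) :: complex))" for k :: nat
  have z_nz: "z k $ i \<noteq> 0" for k i by (simp add: z_def)
  have pm: "point_monom (z k) \<alpha> = exp (of_real (real k * L \<alpha>))" for k \<alpha>
  proof -
    have "point_monom (z k) \<alpha> = (\<Prod>j\<in>UNIV. exp (of_real (real k * \<xi> j) * of_int (\<alpha> $ j)))"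
      by (simp add: point_monom_def z_def exp_power_int mult.commute)
    also have "\<dots> = exp (of_real (real k * L \<alpha>))"
      unfolding L by (simp add: exp_sum[symmetric] sum_distrib_left mult.assoc)
    finally show ?thesis .
  qed
  have zero: "poly_eval p (z k) = 0" if "k \<ge> 1" for k
  proof -
    have "(\<lambda>\<alpha>. exp (\<Sum>i\<le>n. (real k * y i) * of_int (idot (a i) \<alpha>))) summable_on S"
      using exp_linear_summable[of S n a c "\<lambda>i. real k * y i"] S ker y that by simp
    then have "(\<lambda>\<alpha>. norm (point_monom (z k) \<alpha>)) summable_on S"
      by (simp add: pm L_def norm_exp_eq_Re sum_distrib_left mult.assoc)
    then have "rf_value (r - r') (z k) (s (z k) - s (z k))"
      using val[of "z k"] z_nz by (intro rf_value_diff) auto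
    \<comment> \<open>\<open>q\<close> itself may vanish at \<open>z k\<close>. The value is
      witnessed by some fraction with nonvanishing denominator, and cross-multiplication carries the
      zero of \<open>p'\<close> over to \<open>p\<close>.\<close>
    then obtain p' q' where "Fract p q = Fract p' q'" "poly_eval q' (z k) \<noteq> 0" "poly_eval p' (z k) = 0"
      using pq by (auto simp: rf_value_def)
    moreover then have "q' \<noteq> 0" by auto
    ultimately have "p * q' = p' * q" using pq(2) by (simp add: eq_fract)
    then have "poly_eval p (z k) * poly_eval q' (z k) = 0"
      using \<open>poly_eval p' (z k) = 0\<close> by (metis mult_zero_left poly_eval_mult)
    then show ?thesis using \<open>poly_eval q' (z k) \<noteq> 0\<close> by simp
  qed
  define x where "x m = (exp (of_real (L (iv m))) :: complex)" for m
  have pe: "poly_eval p (z k) = (\<Sum>m\<in>M. Poly_Mapping.lookup p m * x m ^ k)" for k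
  proof -
    have "(\<Prod>i\<in>UNIV. z k $ i ^ Poly_Mapping.lookup m i) = point_monom (z k) (iv m)" for m
      by (simp add: point_monom_def iv_def)
    then show ?thesis
      by (simp add: poly_eval_def M_def pm x_def exp_of_nat_mult[symmetric])
  qed
  have "inj_on x M"
  proof (rule inj_onI, rule ccontr)
    fix m m' assume *: "m \<in> M" "m' \<in> M" "x m = x m'" "m \<noteq> m'"
    obtain i where "Poly_Mapping.lookup m i \<noteq> Poly_Mapping.lookup m' i"
      using *(4) unfolding poly_mapping_eq_iff fun_eq_iff by auto
    then have "iv m \<noteq> iv m'" by (auto simp: iv_def vec_eq_iff)
    then have "iv m - iv m' \<in> D" using * by (auto simp: D_def)
    then have "L (iv m - iv m') \<noteq> 0" using y(2) by (simp add: L_def)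
    then have "L (iv m) \<noteq> L (iv m')"
      by (simp add: L_def idot_diff right_diff_distrib sum_subtractf)
    moreover have "exp (L (iv m)) = exp (L (iv m'))"
      using *(3) unfolding x_def exp_of_real of_real_eq_iff .
    ultimately show False by simp
  qed
  have "\<forall>m\<in>M. Poly_Mapping.lookup p m = 0"
  proof (rule vandermonde_zero)
    show "finite M" by (simp add: M_def)
    show "inj_on x M" by fact
    show "x m \<noteq> 0" for m by (simp add: x_def)
    show "(\<Sum>m\<in>M. Poly_Mapping.lookup p m * x m ^ k) = 0" if "k \<ge> 1" for k
      using zero[OF that] unfolding pe .
  qed
  then have "Poly_Mapping.lookup p m = 0" for m
    unfolding M_def by (cases "m \<in> Poly_Mapping.keys p") (auto simp: in_keys_iff)
  then have "p = 0" by (simp add: poly_mapping_eqI)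
  then have "r - r' = 0" using pq by (simp add: Zero_fract_def eq_fract)
  then show ?thesis by simp
qed

subsection \<open>Lattice vectors and rational cones\<close>

lemma inner_real_vec: "real_vec a \<bullet> real_vec u = of_int (idot a u)"
  by (simp add: real_vec_def idot_def inner_vec_def)

lemma real_vec_diff: "real_vec (a - b) = real_vec a - real_vec b"
  and real_vec_uminus: "real_vec (- a) = - real_vec a"
  and real_vec_zero [simp]: "real_vec 0 = 0"
  by (simp_all add: real_vec_def vec_eq_iff)

lemma real_vec_eq_iff [simp]: "real_vec a = real_vec b \<longleftrightarrow> a = b"
  by (simp add: real_vec_def vec_eq_iff)

lemma real_vec_eq_0_iff [simp]: "real_vec a = 0 \<longleftrightarrow> a = 0"
  using real_vec_eq_iff[of a 0] by (simp del: real_vec_eq_iff)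

lemma finite_bounded_lattice_points:
  assumes "bounded (real_vec ` S)"
  shows "finite S"
proof -
  obtain B where B: "norm (real_vec \<alpha>) \<le> B" if "\<alpha> \<in> S" for \<alpha>
    using assms by (auto simp: bounded_iff)
  have "vec_nth ` S \<subseteq> {f. \<forall>i. (i \<in> UNIV \<longrightarrow> f i \<in> {- \<lceil>B\<rceil>..\<lceil>B\<rceil>}) \<and> (i \<notin> UNIV \<longrightarrow> f i = 0)}"
  proof clarsimp
    fix \<alpha> i assume "\<alpha> \<in> S"
    have "\<bar>real_of_int (\<alpha> $ i)\<bar> \<le> B"
      using component_le_norm_cart[of "real_vec \<alpha>" i] B[OF \<open>\<alpha> \<in> S\<close>] by (simp add: real_vec_def)
    then show "- \<lceil>B\<rceil> \<le> \<alpha> $ i \<and> \<alpha> $ i \<le> \<lceil>B\<rceil>" by linarith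
  qed
  then have "finite (vec_nth ` S)"
    by (rule finite_subset) (rule finite_set_of_finite_funs, auto)
  then show ?thesis by (rule finite_imageD) (auto simp: inj_on_def vec_eq_iff)
qed

section \<open>Recession directions and generators of rational cones\<close>

text \<open>Normalized points of norm tending to infinity accumulate at a unit vector; dividing the
  constraints by the norms sends the right-hand sides to 0.\<close>

lemma unbounded_polyhedron_recession:
  fixes H :: "('a::euclidean_space \<times> real) set"
  assumes "\<not> bounded {x. \<forall>(a, c)\<in>H. a \<bullet> x \<le> c}"
  obtains u where "u \<noteq> 0" "\<And>a c. (a, c) \<in> H \<Longrightarrow> a \<bullet> u \<le> 0"
proof -
  define P where "P = {x. \<forall>(a, c)\<in>H. a \<bullet> x \<le> c}"
  have "\<exists>x\<in>P. norm x > real n + 1" for n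
    using assms unfolding bounded_iff P_def[symmetric] by (meson not_le)
  then obtain x where x: "x n \<in> P" "norm (x n) > real n + 1" for n by metis
  define y where "y n = x n /\<^sub>R norm (x n)" for n
  have nx: "norm (x n) > 0" for n using x(2)[of n] by linarith
  then have "y n \<in> sphere 0 1" for n by (simp add: y_def)
  then obtain u r where u: "u \<in> sphere 0 1" "strict_mono r" "(y \<circ> r) \<longlonglongrightarrow> u"
    using compact_sphere[of 0 1] unfolding compact_def by metis
  have "a \<bullet> u \<le> 0" if "(a, c) \<in> H" for a c
  proof (rule LIMSEQ_le)
    show "(\<lambda>n. a \<bullet> y (r n)) \<longlonglongrightarrow> a \<bullet> u"
      using u(3) by (auto simp: o_def intro!: tendsto_intros)
    have "real n \<le> norm (x n)" for n using x(2)[of n] by simp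
    then have "filterlim (\<lambda>n. norm (x n)) at_top sequentially"
      by (intro filterlim_at_top_mono[OF filterlim_real_sequentially] always_eventually allI)
    then have "(\<lambda>n. c / norm (x n)) \<longlonglongrightarrow> 0"
      by (intro tendsto_divide_0[OF tendsto_const] filterlim_at_top_imp_at_infinity)
    then show "(\<lambda>n. c / norm (x (r n))) \<longlonglongrightarrow> 0"
      using LIMSEQ_subseq_LIMSEQ[OF _ u(2)] by (auto simp: o_def)
    have "a \<bullet> y n \<le> c / norm (x n)" for n
      using x(1)[of n] that nx[of n] by (auto simp: y_def P_def field_simps)
    then show "\<exists>N. \<forall>n\<ge>N. a \<bullet> y (r n) \<le> c / norm (x (r n))" by blast
  qed
  moreover have "u \<noteq> 0" using u(1) by auto
  ultimately show thesis by (rule that[rotated])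
qed

lemma convex_cone_sum:
  "convex_cone C \<Longrightarrow> (\<And>i. i \<in> S \<Longrightarrow> f i \<in> C) \<Longrightarrow> sum f S \<in> C"
  by (induction S rule: infinite_finite_induct) (auto intro: convex_cone_add convex_cone_contains_0)

lemma convex_cone_hull_finite_sums:
  assumes "finite G" "x \<in> convex_cone hull (f ` G)"
  obtains c where "\<And>g. c g \<ge> (0::real)" "x = (\<Sum>g\<in>G. c g *\<^sub>R f g)"
proof -
  let ?C = "{x. \<exists>c. (\<forall>g. c g \<ge> (0::real)) \<and> x = (\<Sum>g\<in>G. c g *\<^sub>R f g)}"
  have "convex_cone hull (f ` G) \<subseteq> ?C"
  proof (rule hull_minimal)
    have "f g \<in> ?C" if "g \<in> G" for g
      using that assms(1) by (intro CollectI exI[of _ "\<lambda>h. if h = g then 1 else 0"]) (auto simp: if_distrib[of "\<lambda>c. c *\<^sub>R _"] cong: if_cong)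
    then show "f ` G \<subseteq> ?C" by blast
    have "x + y \<in> ?C" if "x \<in> ?C" "y \<in> ?C" for x y
    proof -
      from that obtain c d where "\<forall>g. c g \<ge> (0::real)" "\<forall>g. d g \<ge> (0::real)"
        "x = (\<Sum>g\<in>G. c g *\<^sub>R f g)" "y = (\<Sum>g\<in>G. d g *\<^sub>R f g)" by blast
      then show ?thesis
        by (intro CollectI exI[of _ "\<lambda>g. c g + d g"]) (auto simp: scaleR_add_left sum.distrib)
    qed
    moreover have "s *\<^sub>R x \<in> ?C" if "x \<in> ?C" "s \<ge> 0" for x s
    proof -
      from that obtain c where "\<forall>g. c g \<ge> (0::real)" "x = (\<Sum>g\<in>G. c g *\<^sub>R f g)" by blast
      then show ?thesis using \<open>s \<ge> 0\<close>
        by (intro CollectI exI[of _ "\<lambda>g. s * c g"]) (auto simp: scaleR_sum_right)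
    qed
    moreover have "0 \<in> ?C" by (intro CollectI exI[of _ "\<lambda>_. 0"]) auto
    ultimately show "convex_cone ?C" unfolding convex_cone_iff by blast
  qed
  then show thesis using that assms(2) by blast
qed

text \<open>One step of the double description method. Because
  \<open>real_vec a \<bullet> x \<le> 0\<close>, the weight \<open>n\<close> of the negative
  generators in \<open>x\<close> is at least the weight \<open>p\<close> of the positive ones, so
  the positive part can be balanced completely against a share of the negative part, using vectors
  on which \<open>a\<close> vanishes.\<close>

lemma rational_cone_generators_step:
  fixes G :: "(int^'d) set" and a :: "int^'d"
  assumes "finite G"
  defines "G' \<equiv> {g \<in> G. idot a g \<le> 0} \<union>
    (\<lambda>(g, h). idot a g *s h - idot a h *s g) ` ({g \<in> G. idot a g > 0} \<times> {h \<in> G. idot a h < 0})"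
  assumes x: "x \<in> convex_cone hull (real_vec ` G)" and ax: "real_vec a \<bullet> x \<le> 0"
  shows "x \<in> convex_cone hull (real_vec ` G')"
proof -
  let ?C = "convex_cone hull (real_vec ` G')"
  have C: "convex_cone ?C" by (rule convex_cone_convex_cone_hull)
  have GC: "real_vec g \<in> ?C" if "g \<in> G'" for g using that by (intro hull_inc) auto
  obtain c where c: "\<And>g. c g \<ge> 0" "x = (\<Sum>g\<in>G. c g *\<^sub>R real_vec g)"
    using convex_cone_hull_finite_sums[OF assms(1) x] by metis
  define Pos where "Pos = {g \<in> G. idot a g > 0}"
  define Neg where "Neg = {g \<in> G. idot a g < 0}"
  define Z where "Z = {g \<in> G. idot a g = 0}"
  define p where "p = (\<Sum>g\<in>Pos. c g * idot a g)"
  define n where "n = (\<Sum>g\<in>Neg. c g * - idot a g)"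
  have fin: "finite Pos" "finite Neg" "finite Z" using assms(1) by (auto simp: Pos_def Neg_def Z_def)
  have split: "sum f G = sum f Pos + sum f Neg + sum f Z" for f :: "int^'d \<Rightarrow> 'z::ab_group_add"
  proof -
    have "G = Pos \<union> Neg \<union> Z" by (auto simp: Pos_def Neg_def Z_def)
    moreover have "sum f (Pos \<union> Neg \<union> Z) = sum f Pos + sum f Neg + sum f Z"
      using fin by (subst sum.union_disjoint; auto simp: Pos_def Neg_def Z_def)+
    ultimately show ?thesis by simp
  qed
  have "real_vec a \<bullet> x = (\<Sum>g\<in>G. c g * idot a g)"
    by (simp add: c(2) inner_sum_right inner_real_vec)
  also have "\<dots> = p - n"
    by (subst split) (simp add: p_def n_def sum_negf Z_def)
  finally have pn: "p \<le> n" using ax by simp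
  have p0: "p \<ge> 0" unfolding p_def using c(1) by (intro sum_nonneg) (auto simp: Pos_def)
  have xZ: "(\<Sum>g\<in>Z. c g *\<^sub>R real_vec g) \<in> ?C" and xN: "(\<Sum>g\<in>Neg. c g *\<^sub>R real_vec g) \<in> ?C"
    by (intro convex_cone_sum[OF C] convex_cone_scaleR[OF C] GC c(1); simp add: Z_def Neg_def G'_def)+
  show ?thesis
  proof (cases "p = 0")
    case True
    then have "\<forall>g\<in>Pos. c g * idot a g = 0"
      unfolding p_def using c(1) fin by (subst (asm) sum_nonneg_eq_0_iff) (auto simp: Pos_def)
    then have "(\<Sum>g\<in>Pos. c g *\<^sub>R real_vec g) = 0" by (intro sum.neutral) (auto simp: Pos_def)
    then have "x = (\<Sum>g\<in>Neg. c g *\<^sub>R real_vec g) + (\<Sum>g\<in>Z. c g *\<^sub>R real_vec g)"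
      by (simp add: c(2) split)
    then show ?thesis using xZ xN convex_cone_add[OF C] by simp
  next
    case False
    then have n0: "n > 0" using p0 pn by simp
    let ?v = "\<lambda>g h. real_vec (idot a g *s h - idot a h *s g)"
    have v: "?v g h = of_int (idot a g) *\<^sub>R real_vec h - of_int (idot a h) *\<^sub>R real_vec g" for g h
      by (simp add: real_vec_def vec_eq_iff)
    \<comment> \<open>The coefficients spread each positive generator over the negative ones in
      proportion to their weights, so that \<open>y\<close> is the whole positive part plus the
      fraction \<open>p / n\<close> of the negative part.\<close>
    define y where "y = (\<Sum>g\<in>Pos. \<Sum>h\<in>Neg. (c g * c h / n) *\<^sub>R ?v g h)"
    have yC: "y \<in> ?C" unfolding y_def using c(1) n0
      by (intro convex_cone_sum[OF C] convex_cone_scaleR[OF C] GC) (auto simp: G'_def Pos_def Neg_def)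
    have "y = (\<Sum>g\<in>Pos. \<Sum>h\<in>Neg. ((c g * idot a g) * c h / n) *\<^sub>R real_vec h)
        + (\<Sum>g\<in>Pos. \<Sum>h\<in>Neg. (c g * (c h * - idot a h) / n) *\<^sub>R real_vec g)"
      unfolding y_def v by (simp add: scaleR_right_diff_distrib sum_subtractf sum_negf algebra_simps)
    also have "(\<Sum>g\<in>Pos. \<Sum>h\<in>Neg. ((c g * idot a g) * c h / n) *\<^sub>R real_vec h)
        = (\<Sum>h\<in>Neg. (p * c h / n) *\<^sub>R real_vec h)"
      by (subst sum.swap) (simp add: p_def scaleR_sum_left[symmetric] sum_distrib_right sum_divide_distrib)
    also have "\<dots> = (p / n) *\<^sub>R (\<Sum>h\<in>Neg. c h *\<^sub>R real_vec h)"
      by (simp add: scaleR_sum_right)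
    also have "(\<Sum>g\<in>Pos. \<Sum>h\<in>Neg. (c g * (c h * - idot a h) / n) *\<^sub>R real_vec g)
        = (\<Sum>g\<in>Pos. (c g * n / n) *\<^sub>R real_vec g)"
      unfolding n_def scaleR_sum_left[symmetric] sum_distrib_left sum_divide_distrib ..
    finally have y: "y = (p / n) *\<^sub>R (\<Sum>h\<in>Neg. c h *\<^sub>R real_vec h) + (\<Sum>g\<in>Pos. c g *\<^sub>R real_vec g)"
      using n0 by simp
    have "x = y + (1 - p / n) *\<^sub>R (\<Sum>h\<in>Neg. c h *\<^sub>R real_vec h) + (\<Sum>g\<in>Z. c g *\<^sub>R real_vec g)"
      by (simp add: c(2) split y scaleR_left_diff_distrib)
    moreover have "1 - p / n \<ge> 0" using pn n0 by simp
    ultimately show ?thesis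
      using yC xN xZ by (auto intro!: convex_cone_add[OF C] convex_cone_scaleR[OF C])
  qed
qed

text \<open>Minkowski-Weyl with lattice generators: the constraints are added one at a time to the
  whole space, which plus and minus the unit vectors generate.\<close>

lemma rational_cone_generators:
  obtains G :: "(int^'d) set"
  where "finite G" "\<And>g a. g \<in> G \<Longrightarrow> a \<in> set as \<Longrightarrow> idot a g \<le> 0"
    "\<And>x. (\<And>a. a \<in> set as \<Longrightarrow> real_vec a \<bullet> x \<le> 0) \<Longrightarrow> x \<in> convex_cone hull (real_vec ` G)"
proof (induction as arbitrary: thesis)
  case Nil
  define G where "G = range (\<lambda>i::'d. axis i (1::int)) \<union> range (\<lambda>i. - axis i 1)"
  let ?C = "convex_cone hull (real_vec ` G)"
  have C: "convex_cone ?C" by (rule convex_cone_convex_cone_hull)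
  have "x \<in> ?C" for x
  proof -
    have ax: "real_vec (axis i 1) = axis i 1" for i :: 'd
      by (simp add: real_vec_def axis_def vec_eq_iff)
    have "x $ i *\<^sub>R axis i 1 \<in> ?C" for i
    proof -
      have "\<bar>x $ i\<bar> *\<^sub>R real_vec (axis i 1) \<in> ?C" "\<bar>x $ i\<bar> *\<^sub>R real_vec (- axis i 1) \<in> ?C"
        by (intro convex_cone_scaleR[OF C] hull_inc; simp add: G_def)+
      then show ?thesis by (cases "x $ i \<ge> 0") (auto simp: ax real_vec_uminus)
    qed
    then have "(\<Sum>i\<in>UNIV. x $ i *\<^sub>R axis i 1) \<in> ?C" by (intro convex_cone_sum[OF C])
    then show ?thesis using basis_expansion[of x] by (simp add: scalar_mult_eq_scaleR)
  qed
  then show ?case by (intro Nil[of G]) (auto simp: G_def)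
next
  case (Cons a as)
  obtain G where G: "finite G" "\<And>g a. g \<in> G \<Longrightarrow> a \<in> set as \<Longrightarrow> idot a g \<le> 0"
    "\<And>x. (\<And>a. a \<in> set as \<Longrightarrow> real_vec a \<bullet> x \<le> 0) \<Longrightarrow> x \<in> convex_cone hull (real_vec ` G)"
    using Cons.IH by blast
  let ?G' = "{g \<in> G. idot a g \<le> 0} \<union>
    (\<lambda>(g, h). idot a g *s h - idot a h *s g) ` ({g \<in> G. idot a g > 0} \<times> {h \<in> G. idot a h < 0})"
  have scale: "idot b (k *s g) = k * idot b g" for b k and g :: "int^'d"
    by (simp add: idot_def sum_distrib_left mult.left_commute)
  show ?case
  proof (rule Cons.prems[of ?G'])
    show "finite ?G'" using G(1) by simp
    fix g b assume g: "g \<in> ?G'" and b: "b \<in> set (a # as)"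
    show "idot b g \<le> 0"
    proof (cases "g \<in> {g \<in> G. idot a g \<le> 0}")
      case True
      then show ?thesis using b G(2) by auto
    next
      case False
      with g obtain h k where hk: "g = idot a h *s k - idot a k *s h"
        "h \<in> G" "k \<in> G" "idot a h > 0" "idot a k < 0" by auto
      show ?thesis
      proof (cases "b = a")
        case False
        then have "idot b h \<le> 0" "idot b k \<le> 0" using b G(2) hk by auto
        then have "idot a h * idot b k \<le> 0" "idot a k * idot b h \<ge> 0"
          using hk by (auto intro: mult_nonneg_nonpos mult_nonpos_nonpos)
        then show ?thesis by (simp add: hk(1) idot_diff scale)
      qed (simp add: hk(1) idot_diff scale)
    qed
  next
    fix x assume "\<And>b. b \<in> set (a # as) \<Longrightarrow> real_vec b \<bullet> x \<le> 0"
    then show "x \<in> convex_cone hull (real_vec ` ?G')"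
      using G(3)[of x] by (intro rational_cone_generators_step[OF G(1)]) auto
  qed
qed

subsection \<open>Fourier-Motzkin elimination\<close>

text \<open>Kept general in the space and with real data, since elimination is later also carried
  out in the product of points, right-hand sides and radii.\<close>

definition hpoly :: "('a::real_inner \<times> real) set \<Rightarrow> 'a set" where
  "hpoly H = {x. \<forall>(a, c)\<in>H. a \<bullet> x \<le> c}"

definition ray :: "'a::real_vector \<Rightarrow> 'a set" where
  "ray u = {s *\<^sub>R u | s. s \<ge> 0}"

text \<open>A point x lies in the sum with the ray iff x - s u satisfies \<open>H\<close> for some s
  \<ge> 0. Constraints with \<open>a \<bullet> u > 0\<close> bound s from below, those with
  \<open>a \<bullet> u < 0\<close> from above, and the pairs compare the two kinds. The lower bound
  0, compared with the upper bounds, returns the original constraints with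
  \<open>a \<bullet> u < 0\<close>.\<close>

definition fm_constraints :: "('a::real_inner \<times> real) set \<Rightarrow> 'a \<Rightarrow> ('a \<times> real) set" where
  "fm_constraints H u = {(a, c) \<in> H. a \<bullet> u \<le> 0} \<union>
     (\<lambda>((a, c), (a', c')). ((a \<bullet> u) *\<^sub>R a' - (a' \<bullet> u) *\<^sub>R a, (a \<bullet> u) * c' - (a' \<bullet> u) * c)) `
       ({(a, c) \<in> H. a \<bullet> u > 0} \<times> {(a, c) \<in> H. a \<bullet> u < 0})"

lemma finite_fm_constraints: "finite H \<Longrightarrow> finite (fm_constraints H u)"
  unfolding fm_constraints_def
  by (intro finite_UnI finite_imageI finite_cartesian_product) (auto elim: rev_finite_subset)

lemma mem_plus_ray: "x \<in> P + ray u \<longleftrightarrow> (\<exists>s\<ge>0. x - s *\<^sub>R u \<in> P)"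
proof
  assume "x \<in> P + ray u"
  then obtain p s where "x = p + s *\<^sub>R u" "p \<in> P" "s \<ge> 0"
    by (auto simp: set_plus_def ray_def)
  then show "\<exists>s\<ge>0. x - s *\<^sub>R u \<in> P" by auto
next
  assume "\<exists>s\<ge>0. x - s *\<^sub>R u \<in> P"
  then obtain s where s: "s \<ge> 0" "x - s *\<^sub>R u \<in> P" by blast
  have "(x - s *\<^sub>R u) + s *\<^sub>R u \<in> P + ray u"
    using s by (intro set_plus_intro) (auto simp: ray_def)
  then show "x \<in> P + ray u" by simp
qed

lemma fourier_motzkin:
  assumes "finite H"
  shows "hpoly H + ray u = hpoly (fm_constraints H u)"
proof (intro equalityI subsetI)
  fix x assume "x \<in> hpoly H + ray u"
  then obtain s where s: "s \<ge> 0" "x - s *\<^sub>R u \<in> hpoly H" unfolding mem_plus_ray by blast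
  then have *: "a \<bullet> x - s * (a \<bullet> u) \<le> c" if "(a, c) \<in> H" for a c
    using that by (auto simp: hpoly_def inner_diff_right)
  show "x \<in> hpoly (fm_constraints H u)"
    unfolding hpoly_def
  proof (clarify)
    fix a c assume "(a, c) \<in> fm_constraints H u"
    then consider "(a, c) \<in> H" "a \<bullet> u \<le> 0" |
      b d b' d' where "(b, d) \<in> H" "b \<bullet> u > 0" "(b', d') \<in> H" "b' \<bullet> u < 0"
        "a = (b \<bullet> u) *\<^sub>R b' - (b' \<bullet> u) *\<^sub>R b" "c = (b \<bullet> u) * d' - (b' \<bullet> u) * d"
      unfolding fm_constraints_def by auto
    then show "a \<bullet> x \<le> c"
    proof cases
      case 1
      then show ?thesis using *[OF 1(1)] mult_nonneg_nonpos[OF s(1) 1(2)] by simp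
    next
      case 2
      have "(b \<bullet> u) * (b' \<bullet> x - s * (b' \<bullet> u)) \<le> (b \<bullet> u) * d'"
        "(- (b' \<bullet> u)) * (b \<bullet> x - s * (b \<bullet> u)) \<le> (- (b' \<bullet> u)) * d"
        using 2 * by (auto intro!: mult_left_mono simp del: mult_minus_left)
      then show ?thesis by (simp add: 2 inner_diff_left algebra_simps)
    qed
  qed
next
  fix x assume x: "x \<in> hpoly (fm_constraints H u)"
  \<comment> \<open>The lower bounds on \<open>s\<close>, with 0 for the condition s \<ge> 0; the
    largest of them respects all upper bounds.\<close>
  define B where "B = insert 0 ((\<lambda>(a, c). (a \<bullet> x - c) / (a \<bullet> u)) ` {(a, c) \<in> H. a \<bullet> u > 0})"
  have finB: "finite B" unfolding B_def using assms
    by (intro finite.insertI finite_imageI) (auto elim: rev_finite_subset)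
  define s where "s = Max B"
  have "s \<ge> 0" unfolding s_def using finB by (intro Max_ge) (auto simp: B_def)
  moreover have "a \<bullet> (x - s *\<^sub>R u) \<le> c" if ac: "(a, c) \<in> H" for a c
  proof -
    consider "a \<bullet> u > 0" | "a \<bullet> u = 0" | "a \<bullet> u < 0" by linarith
    then have "a \<bullet> x - s * (a \<bullet> u) \<le> c"
    proof cases
      case 1
      then have "(a \<bullet> x - c) / (a \<bullet> u) \<in> B" using ac by (force simp: B_def)
      then have "(a \<bullet> x - c) / (a \<bullet> u) \<le> s" unfolding s_def using finB by (intro Max_ge)
      then show ?thesis using 1 by (simp add: field_simps)
    next
      case 2
      then show ?thesis using x ac by (auto simp: hpoly_def fm_constraints_def)
    next
      case 3
      have "s \<in> B" unfolding s_def using finB by (intro Max_in) (auto simp: B_def)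
      then consider "s = 0" | b d where "(b, d) \<in> H" "b \<bullet> u > 0" "s = (b \<bullet> x - d) / (b \<bullet> u)"
        by (auto simp: B_def)
      then show ?thesis
      proof cases
        case 1
        then show ?thesis using x ac 3 by (auto simp: hpoly_def fm_constraints_def)
      next
        case 2
        have "((b \<bullet> u) *\<^sub>R a - (a \<bullet> u) *\<^sub>R b, (b \<bullet> u) * c - (a \<bullet> u) * d) \<in> fm_constraints H u"
          unfolding fm_constraints_def using 2 ac 3 by (intro UnI2 image_eqI[of _ _ "((b, d), (a, c))"]) auto
        then have "(b \<bullet> u) * (a \<bullet> x) - (a \<bullet> u) * (b \<bullet> x) \<le> (b \<bullet> u) * c - (a \<bullet> u) * d"
          using x by (fastforce simp: hpoly_def inner_diff_left)
        moreover have sb: "s * (b \<bullet> u) = b \<bullet> x - d" using 2 by simp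
        have "(b \<bullet> u) * (a \<bullet> x - s * (a \<bullet> u)) = (b \<bullet> u) * (a \<bullet> x) - (a \<bullet> u) * (s * (b \<bullet> u))"
          by (simp add: algebra_simps)
        ultimately have "(b \<bullet> u) * (a \<bullet> x - s * (a \<bullet> u)) \<le> (b \<bullet> u) * c"
          unfolding sb by (simp add: right_diff_distrib)
        then show ?thesis using 2 by simp
      qed
    qed
    then show ?thesis by (simp add: inner_diff_right)
  qed
  ultimately show "x \<in> hpoly H + ray u" unfolding mem_plus_ray hpoly_def by blast
qed

lemma rational_polyhedron_hpoly:
  "rational_polyhedron Q \<longleftrightarrow>
    (\<exists>H. finite H \<and> (\<forall>(a, c)\<in>H. (\<forall>i. a $ i \<in> \<rat>) \<and> c \<in> \<rat>) \<and> Q = hpoly H)"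
  by (simp add: rational_polyhedron_def hpoly_def)

lemma rational_polyhedron_plus_ray:
  assumes "rational_polyhedron Q"
  shows "rational_polyhedron (Q + ray (real_vec u))"
proof -
  obtain H where H: "finite H" "\<forall>(a, c)\<in>H. (\<forall>i. a $ i \<in> \<rat>) \<and> c \<in> \<rat>" "Q = hpoly H"
    using assms unfolding rational_polyhedron_hpoly by blast
  have dot: "a \<bullet> real_vec u \<in> \<rat>" if "(a, c) \<in> H" for a c
    using H(2) that unfolding inner_vec_def by (intro Rats_sum) (auto simp: real_vec_def)
  have "\<forall>(a, c)\<in>fm_constraints H (real_vec u). (\<forall>i. a $ i \<in> \<rat>) \<and> c \<in> \<rat>"
  proof clarify
    fix a c assume "(a, c) \<in> fm_constraints H (real_vec u)"
    then consider "(a, c) \<in> H" | b d b' d' where "(b, d) \<in> H" "(b', d') \<in> H"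
        "a = (b \<bullet> real_vec u) *\<^sub>R b' - (b' \<bullet> real_vec u) *\<^sub>R b"
        "c = (b \<bullet> real_vec u) * d' - (b' \<bullet> real_vec u) * d"
      unfolding fm_constraints_def by auto
    then show "(\<forall>i. a $ i \<in> \<rat>) \<and> c \<in> \<rat>"
    proof cases
      case 2
      then show ?thesis using H(2) dot[OF 2(1)] dot[OF 2(2)]
        by (auto intro!: Rats_diff Rats_mult)
    qed (use H(2) in auto)
  qed
  then show ?thesis
    unfolding rational_polyhedron_hpoly using fourier_motzkin[OF H(1)] finite_fm_constraints[OF H(1)] H(3)
    by (intro exI[of _ "fm_constraints H (real_vec u)"]) simp
qed

lemma rational_polyhedron_translate:
  assumes "rational_polyhedron Q"
  shows "rational_polyhedron ({real_vec v} + Q)"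
proof -
  obtain H where H: "finite H" "\<forall>(a, c)\<in>H. (\<forall>i. a $ i \<in> \<rat>) \<and> c \<in> \<rat>" "Q = hpoly H"
    using assms unfolding rational_polyhedron_hpoly by blast
  have dot: "a \<bullet> real_vec v \<in> \<rat>" if "(a, c) \<in> H" for a c
    using H(2) that unfolding inner_vec_def by (intro Rats_sum) (auto simp: real_vec_def)
  let ?H = "(\<lambda>(a, c). (a, c + a \<bullet> real_vec v)) ` H"
  have "x \<in> {real_vec v} + Q \<longleftrightarrow> x - real_vec v \<in> Q" for x
    by (force simp: set_plus_def algebra_simps)
  moreover have "x - real_vec v \<in> Q \<longleftrightarrow> x \<in> hpoly ?H" for x
    unfolding H(3) hpoly_def by (simp add: inner_diff_right diff_le_eq case_prod_beta)
  ultimately have "{real_vec v} + Q = hpoly ?H" by blast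
  moreover have "finite ?H" using H(1) by simp
  moreover have "\<forall>(a, c)\<in>?H. (\<forall>i. a $ i \<in> \<rat>) \<and> c \<in> \<rat>"
    using H(2) dot by (auto intro!: Rats_add)
  ultimately show ?thesis unfolding rational_polyhedron_hpoly by blast
qed

lemma Rats_common_denominator:
  assumes "finite S" "S \<subseteq> \<rat>"
  obtains N :: nat where "N > 0" "\<And>x. x \<in> S \<Longrightarrow> real N * x \<in> \<int>"
  using assms
proof (induction S arbitrary: thesis rule: finite_induct)
  case (insert x S)
  obtain N where N: "N > 0" "\<And>x. x \<in> S \<Longrightarrow> real N * x \<in> \<int>" using insert.IH insert.prems by blast
  obtain p q where pq: "x = real_of_int p / real_of_int q" "q > 0"
    using insert.prems(2) by (auto elim: Rats_cases')
  show ?case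
  proof (rule insert.prems(1)[of "N * nat q"])
    show "N * nat q > 0" using N pq by simp
    fix y assume "y \<in> insert x S"
    then show "real (N * nat q) * y \<in> \<int>"
    proof
      assume "y = x"
      then have "real (N * nat q) * y = real N * of_int p" using pq by simp
      then show ?thesis by (metis Ints_mult Ints_of_int Ints_of_nat)
    next
      assume "y \<in> S"
      have "real (N * nat q) * y = of_int q * (real N * y)" using pq by simp
      then show ?thesis using N(2)[OF \<open>y \<in> S\<close>] by (metis Ints_mult Ints_of_int)
    qed
  qed
qed auto

lemma rational_polyhedron_int_constraints:
  fixes Q :: "(real^'d) set"
  assumes "rational_polyhedron Q"
  obtains cs :: "((int^'d) \<times> int) list"
  where "Q = {x. \<forall>(a, c)\<in>set cs. real_vec a \<bullet> x \<le> of_int c}"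
proof -
  obtain H where H: "finite H" "\<forall>(a, c)\<in>H. (\<forall>i. a $ i \<in> \<rat>) \<and> c \<in> \<rat>" "Q = hpoly H"
    using assms unfolding rational_polyhedron_hpoly by blast
  define S where "S = (\<lambda>((a, c), i). a $ i) ` (H \<times> UNIV) \<union> snd ` H"
  have "finite S" "S \<subseteq> \<rat>" unfolding S_def using H(1,2) by fastforce+
  then obtain N where N: "N > 0" "\<And>x. x \<in> S \<Longrightarrow> real N * x \<in> \<int>"
    using Rats_common_denominator by metis
  have Na: "real N * a $ i \<in> \<int>" if "(a, c) \<in> H" for a c i
    by (rule N(2)) (unfold S_def, rule UnI1, rule image_eqI[of _ _ "((a, c), i)"], use that in auto)
  have Nc: "real N * c \<in> \<int>" if "(a, c) \<in> H" for a c
    by (rule N(2)) (unfold S_def, rule UnI2, rule image_eqI[of _ _ "(a, c)"], use that in auto)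
  \<comment> \<open>After multiplication by the common denominator the floors are exact.\<close>
  define f where "f = (\<lambda>(a::real^'d, c). ((\<chi> i. \<lfloor>real N * a $ i\<rfloor>) :: int^'d, \<lfloor>real N * c\<rfloor>))"
  have f: "(real_vec (fst (f (a, c))) \<bullet> x \<le> of_int (snd (f (a, c)))) \<longleftrightarrow> a \<bullet> x \<le> c" if "(a, c) \<in> H" for a c x
  proof -
    have "real_vec (fst (f (a, c))) = real N *\<^sub>R a"
      using Na[OF that] by (auto simp: f_def real_vec_def vec_eq_iff elim!: Ints_cases)
    moreover have "of_int (snd (f (a, c))) = real N * c"
      using Nc[OF that] by (auto simp: f_def elim!: Ints_cases)
    ultimately show ?thesis using N(1) by simp
  qed
  obtain cs where cs: "set cs = f ` H" using H(1) finite_list by (metis finite_imageI)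
  have "(real_vec (fst (f p)) \<bullet> x \<le> of_int (snd (f p))) \<longleftrightarrow> fst p \<bullet> x \<le> snd p" if "p \<in> H" for p x
    using f[of "fst p" "snd p" x] that by simp
  then have "Q = {x. \<forall>(a, c)\<in>set cs. real_vec a \<bullet> x \<le> of_int c}"
    unfolding H(3) hpoly_def cs by (simp add: case_prod_beta)
  then show thesis by (rule that)
qed

subsection \<open>The generating function of a rational polyhedron\<close>

text \<open>Equations are kept apart from inequalities because cutting into slices turns an
  inequality into an equation; the number of inequalities is the induction measure of
  \<open>annihilated_lat\<close>.\<close>

definition lat :: "((int^'d) \<times> int) list \<Rightarrow> ((int^'d) \<times> int) list \<Rightarrow> (int^'d) set" where
  "lat E L = {\<alpha>. (\<forall>(a, c)\<in>set E. idot a \<alpha> = c) \<and> (\<forall>(a, c)\<in>set L. idot a \<alpha> \<le> c)}"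

definition lat_rec :: "((int^'d) \<times> int) list \<Rightarrow> ((int^'d) \<times> int) list \<Rightarrow> (int^'d) set" where
  "lat_rec E L = {u. (\<forall>(a, c)\<in>set E. idot a u = 0) \<and> (\<forall>(a, c)\<in>set L. idot a u \<le> 0)}"

text \<open>\<open>R\<close> records where the shifts come from: for a polyhedron they are recession
  directions, so that they map its lattice points into themselves.\<close>

definition annihilated :: "(int^'d) set \<Rightarrow> (int^'d \<Rightarrow> complex) \<Rightarrow> bool" where
  "annihilated R f \<longleftrightarrow> (\<exists>us. set us \<subseteq> R - {0} \<and> fin_supp (diff_ops us f))"

lemma annihilated_mono: "annihilated R f \<Longrightarrow> R \<subseteq> R' \<Longrightarrow> annihilated R' f"
  unfolding annihilated_def by blast

lemma annihilated_fin_supp: "fin_supp f \<Longrightarrow> annihilated R f"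
  unfolding annihilated_def by (intro exI[of _ "[]"]) auto

lemma annihilated_add:
  assumes "annihilated R f" "annihilated R g"
  shows "annihilated R (\<lambda>\<alpha>. f \<alpha> + g \<alpha>)"
proof -
  obtain us where us: "set us \<subseteq> R - {0}" "fin_supp (diff_ops us f)"
    using assms(1) unfolding annihilated_def by blast
  obtain vs where vs: "set vs \<subseteq> R - {0}" "fin_supp (diff_ops vs g)"
    using assms(2) unfolding annihilated_def by blast
  have "diff_ops (us @ vs) (\<lambda>\<alpha>. f \<alpha> + g \<alpha>) =
      (\<lambda>\<alpha>. diff_ops vs (diff_ops us f) \<alpha> + diff_ops us (diff_ops vs g) \<alpha>)"
    by (simp add: diff_ops_append diff_ops_add diff_ops_commute)
  then have "fin_supp (diff_ops (us @ vs) (\<lambda>\<alpha>. f \<alpha> + g \<alpha>))"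
    using fin_supp_add[OF fin_supp_diff_ops[OF us(2)] fin_supp_diff_ops[OF vs(2)]] by simp
  then show ?thesis unfolding annihilated_def using us vs by (intro exI[of _ "us @ vs"]) auto
qed

lemma annihilated_sum:
  "(\<And>i. i \<in> S \<Longrightarrow> annihilated R (f i)) \<Longrightarrow> annihilated R (\<lambda>\<alpha>. \<Sum>i\<in>S. f i \<alpha>)"
  by (induction S rule: infinite_finite_induct) (auto intro: annihilated_fin_supp annihilated_add)

lemma annihilated_diff_op:
  assumes "annihilated R (diff_op u f)" "u \<in> R" "u \<noteq> 0"
  shows "annihilated R f"
proof -
  obtain us where us: "set us \<subseteq> R - {0}" "fin_supp (diff_ops us (diff_op u f))"
    using assms(1) unfolding annihilated_def by blast
  then show ?thesis unfolding annihilated_def using assms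
    by (intro exI[of _ "us @ [u]"]) (simp add: diff_ops_append)
qed

text \<open>Infinitely many lattice points give a real recession direction. The recession cone has
  lattice generators, so one of these is a nonzero element of \<open>lat_rec E L\<close>.\<close>

lemma finite_lat:
  assumes "lat_rec E L \<subseteq> {0}"
  shows "finite (lat E L)"
proof (rule finite_bounded_lattice_points, rule ccontr)
  assume unb: "\<not> bounded (real_vec ` lat E L)"
  define H where "H = (\<lambda>(a, c). (real_vec a, real_of_int c)) ` (set L \<union> set E)
    \<union> (\<lambda>(a, c). (- real_vec a, - real_of_int c)) ` set E"
  have "real_vec ` lat E L \<subseteq> {x. \<forall>(a, c)\<in>H. a \<bullet> x \<le> c}"
  proof clarify
    fix \<alpha> a c assume "\<alpha> \<in> lat E L" "(a, c) \<in> H"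
    then show "a \<bullet> real_vec \<alpha> \<le> c"
      unfolding H_def lat_def by (auto simp: inner_real_vec)
  qed
  with unb have "\<not> bounded {x. \<forall>(a, c)\<in>H. a \<bullet> x \<le> c}" using bounded_subset by blast
  then obtain u where u: "u \<noteq> 0" "\<And>a c. (a, c) \<in> H \<Longrightarrow> a \<bullet> u \<le> 0"
    using unbounded_polyhedron_recession by blast
  obtain G where G: "finite G"
      "\<And>g a. g \<in> G \<Longrightarrow> a \<in> set (map fst L @ map fst E @ map (uminus \<circ> fst) E) \<Longrightarrow> idot a g \<le> 0"
      "\<And>x. (\<And>a. a \<in> set (map fst L @ map fst E @ map (uminus \<circ> fst) E) \<Longrightarrow> real_vec a \<bullet> x \<le> 0)
        \<Longrightarrow> x \<in> convex_cone hull (real_vec ` G)"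
    using rational_cone_generators[of "map fst L @ map fst E @ map (uminus \<circ> fst) E"] by metis
  have "u \<in> convex_cone hull (real_vec ` G)"
  proof (rule G(3))
    fix a assume "a \<in> set (map fst L @ map fst E @ map (uminus \<circ> fst) E)"
    then obtain c where "(real_vec a, c) \<in> H" unfolding H_def by (force simp: real_vec_uminus)
    then show "real_vec a \<bullet> u \<le> 0" by (rule u(2))
  qed
  moreover have "g = 0" if "g \<in> G" for g
  proof -
    have "idot a g = 0" if "(a, c) \<in> set E" for a c
    proof -
      have "idot a g \<le> 0" "idot (- a) g \<le> 0" using \<open>g \<in> G\<close> that by (auto intro!: G(2) simp: image_iff Bex_def)
      then show ?thesis by (simp add: idot_def sum_negf)
    qed
    moreover have "idot a g \<le> 0" if "(a, c) \<in> set L" for a c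
      using G(2)[OF \<open>g \<in> G\<close>, of a] that by force
    ultimately have "g \<in> lat_rec E L" by (auto simp: lat_rec_def)
    then show ?thesis using assms by blast
  qed
  then have "convex_cone hull (real_vec ` G) \<subseteq> {0}"
    by (intro hull_minimal) (auto simp: convex_cone_iff)
  ultimately show False using u(1) by blast
qed

text \<open>\<open>idot a\<close> takes integer values, so lowering the bound from \<open>c\<close>
  to \<open>c + d\<close> removes finitely many hyperplane sections.\<close>

lemma lat_slice:
  assumes "d \<le> 0"
  shows "indicator (lat E (L1 @ (a, c) # L2)) \<alpha> = (indicator (lat E (L1 @ (a, c + d) # L2)) \<alpha> :: complex)
    + (\<Sum>k\<in>{c + d<..c}. indicator (lat ((a, k) # E) (L1 @ L2)) \<alpha>)"
proof -
  have 1: "\<alpha> \<in> lat E (L1 @ (a, k) # L2) \<longleftrightarrow> \<alpha> \<in> lat E (L1 @ L2) \<and> idot a \<alpha> \<le> k"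
    "\<alpha> \<in> lat ((a, k) # E) (L1 @ L2) \<longleftrightarrow> \<alpha> \<in> lat E (L1 @ L2) \<and> idot a \<alpha> = k" for k
    by (auto simp: lat_def)
  have "(\<Sum>k\<in>{c + d<..c}. indicator (lat ((a, k) # E) (L1 @ L2)) \<alpha>) =
      (if \<alpha> \<in> lat E (L1 @ L2) then \<Sum>k\<in>{c + d<..c}. if idot a \<alpha> = k then 1 else 0 else (0::complex))"
    by (auto simp: indicator_def 1 intro!: sum.cong)
  also have "\<dots> = (if \<alpha> \<in> lat E (L1 @ L2) \<and> c + d < idot a \<alpha> \<and> idot a \<alpha> \<le> c then 1 else 0)"
    by simp
  finally show ?thesis using assms by (auto simp: indicator_def 1)
qed

text \<open>
  Multiplication by \<open>1 - z^u\<close> for a recession direction \<open>u\<close> leaves the difference of a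
  polyhedron and its translate; it is cut into slices on which one more of the constraints
  is an equation.
\<close>

lemma annihilated_lat: "annihilated (lat_rec E L) (indicator (lat E L))"
proof (induction "length L" arbitrary: E L rule: less_induct)
  case less
  show ?case
  proof (cases "lat_rec E L \<subseteq> {0}")
    case True
    have "{\<alpha>. indicator (lat E L) \<alpha> \<noteq> (0::complex)} = lat E L" by (auto simp: indicator_def)
    then show ?thesis using finite_lat[OF True] by (intro annihilated_fin_supp) simp
  next
    case False
    then obtain u where u: "u \<in> lat_rec E L" "u \<noteq> 0" by blast
    \<comment> \<open>\<open>lat E (sh L)\<close> is the translate of \<open>lat E L\<close> by
      \<open>u\<close>. The bounds are lowered one at a time: in \<open>step\<close>, those of
      \<open>L1\<close> are already lowered and those of \<open>L2\<close> are not.\<close>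
    define sh where "sh = map (\<lambda>(a, c). (a, c + idot a u))"
    have step: "annihilated (lat_rec E L)
        (\<lambda>\<alpha>. indicator (lat E (sh L1 @ L2)) \<alpha> - indicator (lat E (sh (L1 @ L2))) \<alpha>)"
      if "L = L1 @ L2" for L1 L2
      using that
    proof (induction L2 arbitrary: L1)
      case Nil
      then show ?case by (auto intro: annihilated_fin_supp)
    next
      case (Cons ac L2)
      obtain a c where ac: "ac = (a, c)" by force
      have "idot a u \<le> 0" using u(1) Cons.prems by (auto simp: lat_rec_def ac)
      note slice = lat_slice[OF this, of E "sh L1" a c L2]
      have "annihilated (lat_rec ((a, k) # E) (sh L1 @ L2)) (indicator (lat ((a, k) # E) (sh L1 @ L2)))" for k
        using Cons.prems by (intro less.hyps) (simp add: sh_def)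
      \<comment> \<open>The equation on a slice implies the homogeneous inequality that it replaced,
        so the slice has no new recession directions.\<close>
      moreover have "lat_rec ((a, k) # E) (sh L1 @ L2) \<subseteq> lat_rec E L" for k
        using Cons.prems by (intro subsetI) (simp add: lat_rec_def sh_def ac case_prod_beta ball_Un)
      ultimately have "annihilated (lat_rec E L)
          (\<lambda>\<alpha>. \<Sum>k\<in>{c + idot a u<..c}. indicator (lat ((a, k) # E) (sh L1 @ L2)) \<alpha>)"
        by (intro annihilated_sum) (rule annihilated_mono)
      moreover have "annihilated (lat_rec E L)
          (\<lambda>\<alpha>. indicator (lat E (sh (L1 @ [ac]) @ L2)) \<alpha> - indicator (lat E (sh ((L1 @ [ac]) @ L2))) \<alpha>)"
        using Cons.prems by (intro Cons.IH) simp
      ultimately have "annihilated (lat_rec E L) (\<lambda>\<alpha>.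
          (\<Sum>k\<in>{c + idot a u<..c}. indicator (lat ((a, k) # E) (sh L1 @ L2)) \<alpha>) +
          (indicator (lat E (sh (L1 @ [ac]) @ L2)) \<alpha> - indicator (lat E (sh ((L1 @ [ac]) @ L2))) \<alpha>))"
        by (rule annihilated_add)
      moreover have "sh (L1 @ [ac]) @ L2 = sh L1 @ (a, c + idot a u) # L2"
        by (simp add: sh_def ac)
      ultimately show ?case unfolding ac slice by (simp add: algebra_simps)
    qed
    have "\<alpha> - u \<in> lat E L \<longleftrightarrow> \<alpha> \<in> lat E (sh L)" for \<alpha>
      using u(1) by (simp add: lat_rec_def lat_def idot_diff sh_def case_prod_beta diff_le_eq)
    then have "diff_op u (indicator (lat E L)) =
        (\<lambda>\<alpha>. indicator (lat E L) \<alpha> - (indicator (lat E (sh L)) \<alpha> :: complex))"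
      by (auto simp: diff_op_def indicator_def)
    moreover have "sh [] = []" by (simp add: sh_def)
    ultimately have "annihilated (lat_rec E L) (diff_op u (indicator (lat E L)))"
      using step[of "[]" L] by simp
    then show ?thesis using u by (rule annihilated_diff_op)
  qed
qed

section \<open>Existence and uniqueness of the generating function\<close>

definition lattice_ind :: "(real^'d) set \<Rightarrow> int^'d \<Rightarrow> complex" where
  "lattice_ind Q \<alpha> = indicator Q (real_vec \<alpha>)"

lemma rational_polyhedron_annihilator:
  fixes Q :: "(real^'d) set"
  assumes "rational_polyhedron Q"
  obtains us where "0 \<notin> set us" "fin_supp (diff_ops us (lattice_ind Q))"
    "\<And>u \<alpha>. u \<in> set us \<Longrightarrow> real_vec \<alpha> \<in> Q \<Longrightarrow> real_vec (\<alpha> + u) \<in> Q"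
proof -
  obtain cs where cs: "Q = {x. \<forall>(a, c)\<in>set cs. real_vec a \<bullet> x \<le> of_int c}"
    using rational_polyhedron_int_constraints[OF assms] .
  have mem: "real_vec \<alpha> \<in> Q \<longleftrightarrow> \<alpha> \<in> lat [] cs" for \<alpha>
    unfolding cs lat_def by (simp add: inner_real_vec)
  then have "lattice_ind Q = indicator (lat [] cs)"
    by (auto simp: lattice_ind_def indicator_def)
  then obtain us where us: "set us \<subseteq> lat_rec [] cs - {0}" "fin_supp (diff_ops us (lattice_ind Q))"
    using annihilated_lat[of "[]" cs] unfolding annihilated_def by metis
  show thesis
  proof (rule that[of us])
    fix u \<alpha> assume "u \<in> set us" "real_vec \<alpha> \<in> Q"
    then have "u \<in> lat_rec [] cs" "\<alpha> \<in> lat [] cs" using us(1) mem by auto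
    then have "\<alpha> + u \<in> lat [] cs"
      unfolding lat_def lat_rec_def by (fastforce simp: idot_add)
    then show "real_vec (\<alpha> + u) \<in> Q" by (simp add: mem)
  qed (use us in auto)
qed

definition gen_fun :: "(real^'d::{finite,linorder}) set \<Rightarrow> 'd::{finite,linorder} ratfun" where
  "gen_fun Q = (if rational_polyhedron Q then THE r. has_rf (lattice_ind Q) r else 0)"

lemma gen_fun_eqI: "rational_polyhedron Q \<Longrightarrow> has_rf (lattice_ind Q) r \<Longrightarrow> gen_fun Q = r"
  unfolding gen_fun_def using has_rf_unique by (auto intro!: the_equality)

lemma has_rf_gen_fun:
  assumes "rational_polyhedron Q"
  shows "has_rf (lattice_ind Q) (gen_fun Q)"
proof -
  obtain us where "0 \<notin> set us" "fin_supp (diff_ops us (lattice_ind Q))"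
    using rational_polyhedron_annihilator[OF assms] by metis
  from has_rfI[OF this] show ?thesis using gen_fun_eqI[OF assms] by simp
qed

lemma inner_bounded_above_on_line:
  fixes a u :: "'a::real_inner"
  assumes "\<And>c. a \<bullet> (x + c *\<^sub>R u) \<le> b"
  shows "a \<bullet> u = 0"
proof (rule ccontr)
  assume "a \<bullet> u \<noteq> 0"
  then have "a \<bullet> (x + ((b + 1 - a \<bullet> x) / (a \<bullet> u)) *\<^sub>R u) = b + 1"
    by (simp add: inner_add_right)
  then show False using assms[of "(b + 1 - a \<bullet> x) / (a \<bullet> u)"] by simp
qed

text \<open>The line may have an irrational direction, but the lineality space is cut out by
  integral equations and hence generated by lattice vectors. A nonzero generator is a period of the
  indicator.\<close>

lemma gen_fun_contains_line:
  fixes Q :: "(real^'d::{finite,linorder}) set"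
  assumes "rational_polyhedron Q" "contains_line Q"
  shows "gen_fun Q = 0"
proof -
  obtain cs where cs: "Q = {x. \<forall>(a, c)\<in>set cs. real_vec a \<bullet> x \<le> of_int c}"
    using rational_polyhedron_int_constraints[OF assms(1)] .
  obtain x u where u: "u \<noteq> 0" "\<And>c. x + c *\<^sub>R u \<in> Q"
    using assms(2) unfolding contains_line_def by blast
  have au: "real_vec a \<bullet> u = 0" if "(a, c) \<in> set cs" for a c
    using u(2) that by (intro inner_bounded_above_on_line[of _ x _ "of_int c"]) (auto simp: cs)
  obtain G where G: "finite G"
      "\<And>g a. g \<in> G \<Longrightarrow> a \<in> set (map fst cs @ map (uminus \<circ> fst) cs) \<Longrightarrow> idot a g \<le> 0"
      "\<And>x. (\<And>a. a \<in> set (map fst cs @ map (uminus \<circ> fst) cs) \<Longrightarrow> real_vec a \<bullet> x \<le> 0)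
        \<Longrightarrow> x \<in> convex_cone hull (real_vec ` G)"
    using rational_cone_generators[of "map fst cs @ map (uminus \<circ> fst) cs"] by metis
  have "u \<in> convex_cone hull (real_vec ` G)"
    using au by (intro G(3)) (auto simp: real_vec_uminus)
  moreover have "convex_cone hull (real_vec ` G) \<subseteq> {0}" if "G \<subseteq> {0}"
    using that by (intro hull_minimal) (auto simp: convex_cone_iff)
  ultimately obtain g where g: "g \<in> G" "g \<noteq> 0" using u(1) by blast
  have "idot a g = 0" if "(a, c) \<in> set cs" for a c
  proof -
    have "a \<in> set (map fst cs @ map (uminus \<circ> fst) cs)" "- a \<in> set (map fst cs @ map (uminus \<circ> fst) cs)"
      using that by force+
    then have "idot a g \<le> 0" "idot (- a) g \<le> 0" using G(2) g(1) by blast+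
    then show ?thesis by (simp add: idot_def sum_negf)
  qed
  then have "real_vec (\<alpha> - g) \<in> Q \<longleftrightarrow> real_vec \<alpha> \<in> Q" for \<alpha>
    unfolding cs by (auto simp: inner_real_vec idot_diff split: prod.splits)
  then show ?thesis
    using g(2) by (intro gen_fun_eqI[OF assms(1)] has_rf_periodic[of g])
      (auto simp: lattice_ind_def indicator_def)
qed

lemma gen_fun_valuation:
  assumes "finite \<Q>" "\<And>Q. Q \<in> \<Q> \<Longrightarrow> rational_polyhedron Q"
    and "\<And>x. (\<Sum>Q\<in>\<Q>. c Q * indicator Q x) = 0"
  shows "(\<Sum>Q\<in>\<Q>. rf_const (c Q) * gen_fun Q) = 0"
proof (rule has_rf_unique)
  show "has_rf (\<lambda>\<alpha>. \<Sum>Q\<in>\<Q>. c Q * lattice_ind Q \<alpha>) (\<Sum>Q\<in>\<Q>. rf_const (c Q) * gen_fun Q)"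
    using assms(2) by (intro has_rf_sum has_rf_scale has_rf_gen_fun)
  show "has_rf (\<lambda>\<alpha>. \<Sum>Q\<in>\<Q>. c Q * lattice_ind Q \<alpha>) 0"
    using assms(3) has_rf_zero by (simp add: lattice_ind_def)
qed

lemma gen_fun_series:
  assumes Q: "rational_polyhedron Q" and z: "\<And>i. z $ i \<noteq> 0"
    and sum: "(\<lambda>\<alpha>. norm (point_monom z \<alpha>)) summable_on {\<alpha>. real_vec \<alpha> \<in> Q}"
  shows "rf_value (gen_fun Q) z (\<Sum>\<^sub>\<infinity>\<alpha>\<in>{\<alpha>. real_vec \<alpha> \<in> Q}. point_monom z \<alpha>)"
proof (cases "{\<alpha>. real_vec \<alpha> \<in> Q} = {}")
  case True
  then have "lattice_ind Q = (\<lambda>_. 0)" by (auto simp: lattice_ind_def)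
  then have "gen_fun Q = 0" using gen_fun_eqI[OF Q] has_rf_zero by simp
  then show ?thesis using True rf_value_zero by simp
next
  case False
  then obtain \<beta> where \<beta>: "real_vec \<beta> \<in> Q" by blast
  obtain us where us: "0 \<notin> set us" "fin_supp (diff_ops us (lattice_ind Q))"
      "\<And>u \<alpha>. u \<in> set us \<Longrightarrow> real_vec \<alpha> \<in> Q \<Longrightarrow> real_vec (\<alpha> + u) \<in> Q"
    using rational_polyhedron_annihilator[OF Q] by metis
  \<comment> \<open>The shifts map the lattice points of \<open>Q\<close> into themselves, so
    absolute convergence forces geometric decay along them, and no denominator factor vanishes at
    \<open>z\<close>.\<close>
  have "norm (point_monom z u) < 1" if "u \<in> set us" for u
  proof (rule norm_point_monom_less_1[OF z _ _ _ sum])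
    show "u \<noteq> 0" using that us(1) by blast
    show "\<beta> \<in> {\<alpha>. real_vec \<alpha> \<in> Q}" using \<beta> by simp
    show "\<gamma> + u \<in> {\<alpha>. real_vec \<alpha> \<in> Q}" if "\<gamma> \<in> {\<alpha>. real_vec \<alpha> \<in> Q}" for \<gamma>
      using us(3)[OF \<open>u \<in> set us\<close>] that by simp
  qed
  then have neq: "point_monom z u \<noteq> 1" if "u \<in> set us" for u using that by fastforce
  have "(point_monom z has_sum (\<Sum>\<^sub>\<infinity>\<alpha>\<in>{\<alpha>. real_vec \<alpha> \<in> Q}. point_monom z \<alpha>)) {\<alpha>. real_vec \<alpha> \<in> Q}"
    using abs_summable_summable[OF sum] by (rule has_sum_infsum)
  then have "((\<lambda>\<alpha>. lattice_ind Q \<alpha> * point_monom z \<alpha>) has_sum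
      (\<Sum>\<^sub>\<infinity>\<alpha>\<in>{\<alpha>. real_vec \<alpha> \<in> Q}. point_monom z \<alpha>)) UNIV"
    by (rule has_sum_cong_neutral[THEN iffD1, rotated -1]) (auto simp: lattice_ind_def)
  from has_rf_value[OF z us(2) neq this] show ?thesis
    using gen_fun_eqI[OF Q has_rfI[OF us(1,2)]] by simp
qed

lemma is_mgf_gen_fun: "is_mgf (gen_fun :: (real^'d::{finite,linorder}) set \<Rightarrow> _)"
  unfolding is_mgf_def
proof (intro conjI allI impI)
  show "gen_fun Q = 0" if "\<not> rational_polyhedron Q" for Q :: "(real^'d::{finite,linorder}) set"
    using that by (simp add: gen_fun_def)
qed (use gen_fun_valuation gen_fun_series gen_fun_contains_line in blast)+

lemma is_mgf_unique:
  fixes F :: "(real^'d::{finite,linorder}) set \<Rightarrow> 'd::{finite,linorder} ratfun"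
  assumes "is_mgf F"
  shows "F = gen_fun"
proof
  fix Q :: "(real^'d::{finite,linorder}) set"
  have F_val: "(\<Sum>Q\<in>\<Q>. rf_const (c Q) * F Q) = 0"
    if "finite \<Q>" "\<forall>Q\<in>\<Q>. rational_polyhedron Q" "\<forall>x. (\<Sum>Q\<in>\<Q>. c Q * indicator Q x) = 0" for \<Q> c
    using assms that unfolding is_mgf_def by blast
  have F_series: "rf_value (F Q) z (\<Sum>\<^sub>\<infinity>\<alpha>\<in>{\<alpha>. real_vec \<alpha> \<in> Q}. point_monom z \<alpha>)"
    if "rational_polyhedron Q" "\<not> contains_line Q" "\<And>i. z $ i \<noteq> 0"
      "(\<lambda>\<alpha>. norm (point_monom z \<alpha>)) summable_on {\<alpha>. real_vec \<alpha> \<in> Q}" for z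
    using assms that unfolding is_mgf_def by blast
  have F_line: "rational_polyhedron Q \<Longrightarrow> contains_line Q \<Longrightarrow> F Q = 0"
    and F_nonrat: "\<not> rational_polyhedron Q \<Longrightarrow> F Q = 0"
    using assms unfolding is_mgf_def by blast+
  consider "\<not> rational_polyhedron Q" | "rational_polyhedron Q" "contains_line Q"
    | "rational_polyhedron Q" "Q = {}" | "rational_polyhedron Q" "\<not> contains_line Q" "Q \<noteq> {}" by blast
  then show "F Q = gen_fun Q"
  proof cases
    case 1
    then show ?thesis using F_nonrat by (simp add: gen_fun_def)
  next
    case 2
    then show ?thesis using F_line gen_fun_contains_line by simp
  next
    case 3
    \<comment> \<open>The indicator of the empty set is zero, so the valuation clause for the family
      \<open>{Q}\<close> applies.\<close>
    then have "F Q = 0" using F_val[of "{Q}" "\<lambda>_. 1"] by simp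
    moreover have "gen_fun Q = 0" using gen_fun_valuation[of "{Q}" "\<lambda>_. 1"] 3 by simp
    ultimately show ?thesis by simp
  next
    case 4
    obtain cs where cs: "Q = {x. \<forall>(a, c)\<in>set cs. real_vec a \<bullet> x \<le> of_int c}"
      using rational_polyhedron_int_constraints[OF 4(1)] .
    obtain x where x: "x \<in> Q" using 4(3) by blast
    \<comment> \<open>The constraints of \<open>rf_determined_by_values\<close> run over all indices
      up to and including n; the index \<open>length cs\<close> carries the trivial constraint 0
      \<le> 0.\<close>
    define a where "a i = (if i < length cs then fst (cs ! i) else 0)" for i
    define c where "c i = (if i < length cs then snd (cs ! i) else 0)" for i
    show ?thesis
    proof (rule rf_determined_by_values)
      show "rf_value (F Q) z (\<Sum>\<^sub>\<infinity>\<alpha>\<in>{\<alpha>. real_vec \<alpha> \<in> Q}. point_monom z \<alpha>) \<and>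
          rf_value (gen_fun Q) z (\<Sum>\<^sub>\<infinity>\<alpha>\<in>{\<alpha>. real_vec \<alpha> \<in> Q}. point_monom z \<alpha>)"
        if "\<And>i. z $ i \<noteq> 0" "(\<lambda>\<alpha>. norm (point_monom z \<alpha>)) summable_on {\<alpha>. real_vec \<alpha> \<in> Q}" for z
        using F_series[OF 4(1,2) that] gen_fun_series[OF 4(1) that] by blast
      show "idot (a i) \<alpha> \<le> c i" if "\<alpha> \<in> {\<alpha>. real_vec \<alpha> \<in> Q}" "i \<le> length cs" for \<alpha> i
        using that unfolding cs a_def c_def
        by (auto simp: inner_real_vec case_prod_beta)
      show "\<exists>i\<le>length cs. idot (a i) u \<noteq> 0" if "u \<noteq> 0" for u
      proof (rule ccontr)
        assume *: "\<not> (\<exists>i\<le>length cs. idot (a i) u \<noteq> 0)"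
        have "x + k *\<^sub>R real_vec u \<in> Q" for k
        proof -
          have "real_vec b \<bullet> real_vec u = 0" if bd: "(b, d) \<in> set cs" for b d
          proof -
            obtain i where "i < length cs" "cs ! i = (b, d)" using bd by (meson in_set_conv_nth)
            moreover from this(1) have "idot (a i) u = 0" using * by auto
            ultimately show ?thesis by (simp add: a_def inner_real_vec)
          qed
          then show ?thesis using x unfolding cs by (fastforce simp: inner_add_right)
        qed
        then show False using 4(2) that unfolding contains_line_def by (metis real_vec_eq_0_iff)
      qed
    qed
  qed
qed

lemma mgf_eq_gen_fun: "mgf = gen_fun"
  unfolding mgf_def using is_mgf_gen_fun is_mgf_unique by (rule the_equality)

subsection \<open>Splitting along a direction\<close>

abbreviation span_cone :: "(int^'d) set \<Rightarrow> (real^'d) set" where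
  "span_cone S \<equiv> convex_cone hull (real_vec ` S)"

lemma mem_translate: "x \<in> {v} + Q \<longleftrightarrow> x - v \<in> Q" for x v :: "'a::ab_group_add"
  by (force simp: set_plus_def algebra_simps)

lemma convex_cone_hull_singleton: "convex_cone hull {u} = ray u"
proof
  have "convex_cone (ray u)"
    unfolding convex_cone_iff ray_def
    by (auto simp: scaleR_add_left[symmetric] intro: exI[of _ 0] add_nonneg_nonneg mult_nonneg_nonneg)
  moreover have "u \<in> ray u" by (auto simp: ray_def intro: exI[of _ 1])
  ultimately show "convex_cone hull {u} \<subseteq> ray u" by (intro hull_minimal) auto
  show "ray u \<subseteq> convex_cone hull {u}"
  proof
    fix x assume "x \<in> ray u"
    then show "x \<in> convex_cone hull {u}"
      unfolding ray_def by (auto intro: convex_cone_hull_mul[OF hull_inc])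
  qed
qed

lemma span_cone_insert: "span_cone (insert u S) = span_cone S + ray (real_vec u)"
proof -
  have "span_cone (insert u S) = convex_cone hull (real_vec ` S \<union> {real_vec u})" by simp
  also have "\<dots> = span_cone S + ray (real_vec u)"
    unfolding convex_cone_hull_Un convex_cone_hull_singleton by (auto simp: set_plus_def)
  finally show ?thesis .
qed

lemma plus_span_cone_empty: "Q + span_cone {} = Q"
  by (simp add: set_plus_def)

lemma plus_span_cone_insert: "Q + span_cone (insert u S) = (Q + span_cone S) + ray (real_vec u)"
  by (simp only: span_cone_insert add.assoc)

lemma rational_polyhedron_plus_span_cone:
  "finite S \<Longrightarrow> rational_polyhedron Q \<Longrightarrow> rational_polyhedron (Q + span_cone S)"
  by (induction S rule: finite_induct)
     (auto simp: plus_span_cone_empty plus_span_cone_insert simp del: image_insert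
       intro: rational_polyhedron_plus_ray)

lemma hpoly_convex: "convex (hpoly H)"
proof -
  have "hpoly H = (\<Inter>(a, c)\<in>H. {x. a \<bullet> x \<le> c})" by (auto simp: hpoly_def)
  then show ?thesis by (auto intro!: convex_INT convex_halfspace_le)
qed

lemma hpoly_closed: "closed (hpoly H)"
proof -
  have "hpoly H = (\<Inter>(a, c)\<in>H. {x. a \<bullet> x \<le> c})" by (auto simp: hpoly_def)
  then show ?thesis by (auto intro!: closed_INT closed_halfspace_le)
qed

lemma rational_polyhedron_convex: "rational_polyhedron Q \<Longrightarrow> convex Q"
  and rational_polyhedron_closed: "rational_polyhedron Q \<Longrightarrow> closed Q"
  unfolding rational_polyhedron_hpoly using hpoly_convex hpoly_closed by blast+

lemma plus_ray_both: "x \<in> Q + ray u + ray (- u) \<longleftrightarrow> x \<in> Q + ray u \<or> x \<in> Q + ray (- u)"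
proof
  assume "x \<in> Q + ray u + ray (- u)"
  then obtain r s where rs: "r \<ge> 0" "s \<ge> 0" "x + r *\<^sub>R u - s *\<^sub>R u \<in> Q"
    by (auto simp: mem_plus_ray)
  then have "x - (s - r) *\<^sub>R u \<in> Q" "x - (r - s) *\<^sub>R (- u) \<in> Q" by (simp_all add: algebra_simps)
  then show "x \<in> Q + ray u \<or> x \<in> Q + ray (- u)"
    unfolding mem_plus_ray by (metis diff_ge_0_iff_ge nle_le)
next
  assume "x \<in> Q + ray u \<or> x \<in> Q + ray (- u)"
  then obtain s where "s \<ge> 0" "x - s *\<^sub>R u \<in> Q \<or> x + s *\<^sub>R u \<in> Q" by (auto simp: mem_plus_ray)
  then have "(\<exists>s\<ge>0. x - 0 *\<^sub>R (- u) - s *\<^sub>R u \<in> Q) \<or> (\<exists>r\<ge>0. x - r *\<^sub>R (- u) - 0 *\<^sub>R u \<in> Q)" by auto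
  then show "x \<in> Q + ray u + ray (- u)" unfolding mem_plus_ray by blast
qed

lemma plus_rays_Int:
  assumes "convex Q" "x \<in> Q + ray u" "x \<in> Q + ray (- u)"
  shows "x \<in> Q"
proof -
  obtain r s where rs: "r \<ge> 0" "s \<ge> 0" "x - r *\<^sub>R u \<in> Q" "x + s *\<^sub>R u \<in> Q"
    using assms(2,3) by (auto simp: mem_plus_ray)
  show ?thesis
  proof (cases "r + s = 0")
    case True
    then have "r = 0" using rs by linarith
    then show ?thesis using rs by simp
  next
    case False
    then have pos: "r + s > 0" using rs by linarith
    have "(s / (r + s)) *\<^sub>R (x - r *\<^sub>R u) + (r / (r + s)) *\<^sub>R (x + s *\<^sub>R u) \<in> Q"
      using rs pos by (intro convexD[OF assms(1)]) (auto simp: add_divide_distrib[symmetric])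
    moreover have "(s / (r + s)) *\<^sub>R (x - r *\<^sub>R u) + (r / (r + s)) *\<^sub>R (x + s *\<^sub>R u)
        = ((s + r) / (r + s)) *\<^sub>R x"
      by (simp add: scaleR_right_diff_distrib scaleR_right_distrib scaleR_left_distrib
          add_divide_distrib mult.commute)
    ultimately show ?thesis using pos by (simp add: add.commute)
  qed
qed

lemma contains_line_plus_cone:
  assumes "convex_cone C" "u \<in> C" "- u \<in> C" "u \<noteq> 0" "Q \<noteq> {}"
  shows "contains_line (Q + C)"
proof -
  obtain x where x: "x \<in> Q" using assms(5) by blast
  have "c *\<^sub>R u \<in> C" for c
    using convex_cone_scaleR[OF assms(1) _ assms(2), of c] convex_cone_scaleR[OF assms(1) _ assms(3), of "- c"]
    by (cases "c \<ge> 0") auto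
  then have "x + c *\<^sub>R u \<in> Q + C" for c using x by (rule set_plus_intro[rotated])
  then show ?thesis unfolding contains_line_def using assms(4) by blast
qed

text \<open>
  For convex \<open>Q\<close> the indicator functions satisfy
  \<open>[Q] + [Q + \<real>u] = [Q + \<real>\<^sub>+u] + [Q - \<real>\<^sub>+u]\<close>, and \<open>Q + \<real>u\<close> contains a line.
\<close>

lemma gen_fun_split:
  assumes Q: "rational_polyhedron Q" and "u \<noteq> 0"
  shows "gen_fun Q = gen_fun (Q + ray (real_vec u)) + gen_fun (Q + ray (real_vec (- u)))"
proof -
  let ?u = "real_vec u"
  let ?R = "Q + ray ?u + ray (- ?u)"
  have rat: "rational_polyhedron (Q + ray ?u)" "rational_polyhedron (Q + ray (- ?u))" "rational_polyhedron ?R"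
    using rational_polyhedron_plus_ray[of _ u] rational_polyhedron_plus_ray[of _ "- u"] Q
    by (simp_all add: real_vec_uminus)
  have line: "gen_fun ?R = 0"
  proof (cases "Q = {}")
    case True
    then have "lattice_ind ?R = (\<lambda>_. 0)" by (auto simp: lattice_ind_def mem_plus_ray indicator_def)
    then show ?thesis using gen_fun_eqI[OF rat(3)] has_rf_zero by simp
  next
    case False
    have "contains_line (Q + convex_cone hull {?u, - ?u})"
      using False \<open>u \<noteq> 0\<close>
      by (intro contains_line_plus_cone[OF convex_cone_convex_cone_hull, of ?u] hull_inc) auto
    also have "convex_cone hull {?u, - ?u} = ray ?u + ray (- ?u)"
      using convex_cone_hull_Un[of "{?u}" "{- ?u}"]
      unfolding convex_cone_hull_singleton by (auto simp: set_plus_def insert_commute)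
    finally show ?thesis using gen_fun_contains_line[OF rat(3)] by (simp add: add.assoc)
  qed
  have "lattice_ind Q \<alpha> + lattice_ind ?R \<alpha> = lattice_ind (Q + ray ?u) \<alpha> + lattice_ind (Q + ray (- ?u)) \<alpha>" for \<alpha>
  proof -
    have "real_vec \<alpha> \<in> Q \<Longrightarrow> real_vec \<alpha> \<in> Q + ray ?u \<and> real_vec \<alpha> \<in> Q + ray (- ?u)"
      unfolding mem_plus_ray by (auto intro: exI[of _ 0])
    then show ?thesis
      using plus_rays_Int[OF rational_polyhedron_convex[OF Q], of "real_vec \<alpha>" ?u]
      unfolding lattice_ind_def indicator_def plus_ray_both by auto
  qed
  then have "gen_fun Q + gen_fun ?R = gen_fun (Q + ray ?u) + gen_fun (Q + ray (- ?u))"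
    using has_rf_unique[OF has_rf_add[OF has_rf_gen_fun[OF Q] has_rf_gen_fun[OF rat(3)]]]
      has_rf_add[OF has_rf_gen_fun[OF rat(1)] has_rf_gen_fun[OF rat(2)]] by presburger
  then show ?thesis using line by (simp add: real_vec_uminus)
qed

lemma gen_fun_translate:
  assumes "rational_polyhedron Q"
  shows "gen_fun ({real_vec v} + Q) = rf_monom v * gen_fun Q"
proof (rule gen_fun_eqI)
  show "rational_polyhedron ({real_vec v} + Q)" using assms by (rule rational_polyhedron_translate)
  have "lattice_ind ({real_vec v} + Q) = (\<lambda>\<alpha>. lattice_ind Q (\<alpha> - v))"
    by (simp add: lattice_ind_def indicator_def mem_translate real_vec_diff fun_eq_iff)
  then show "has_rf (lattice_ind ({real_vec v} + Q)) (rf_monom v * gen_fun Q)"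
    using has_rf_shift[OF has_rf_gen_fun[OF assms]] by simp
qed

text \<open>Both sides split in the same way, so the identity after adding either sign of a
  direction gives the identity before. The induction runs over the directions \<open>D\<close> whose
  sign is still open. As \<open>E\<close> may contain both u and - u, the set \<open>S\<close> of
  chosen directions may contain opposite vectors as well.\<close>

lemma gen_fun_sign_induct:
  fixes P :: "(real^'d::{finite,linorder}) set" and v :: "'j \<Rightarrow> int^'d::{finite,linorder}"
  assumes "finite E" "0 \<notin> E" "rational_polyhedron P" "\<And>j. j \<in> J \<Longrightarrow> rational_polyhedron (K j)"
    and base: "\<And>S. finite S \<Longrightarrow> (\<And>u. u \<in> E \<Longrightarrow> u \<in> S \<or> - u \<in> S) \<Longrightarrow>
      gen_fun (P + span_cone S) = (\<Sum>j\<in>J. rf_monom (v j) * gen_fun (K j + span_cone S))"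
  shows "gen_fun P = (\<Sum>j\<in>J. rf_monom (v j) * gen_fun (K j))"
proof -
  have "gen_fun (P + span_cone S) = (\<Sum>j\<in>J. rf_monom (v j) * gen_fun (K j + span_cone S))"
    if "finite D" "D \<subseteq> E" "finite S" "\<And>u. u \<in> E - D \<Longrightarrow> u \<in> S \<or> - u \<in> S" for D S
    using that
  proof (induction D arbitrary: S rule: finite_induct)
    case empty
    then show ?case by (intro base) auto
  next
    case (insert u D)
    have "u \<noteq> 0" using insert.prems \<open>0 \<notin> E\<close> by auto
    have IH: "gen_fun (P + span_cone (insert w S)) = (\<Sum>j\<in>J. rf_monom (v j) * gen_fun (K j + span_cone (insert w S)))"
      if "w = u \<or> w = - u" for w
      using insert.prems that by (intro insert.IH) fastforce+
    have split: "gen_fun (Q + span_cone S) = gen_fun (Q + span_cone (insert u S)) + gen_fun (Q + span_cone (insert (- u) S))"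
      if "rational_polyhedron Q" for Q
      using gen_fun_split[OF rational_polyhedron_plus_span_cone[OF insert.prems(2) that] \<open>u \<noteq> 0\<close>]
      unfolding plus_span_cone_insert .
    have "gen_fun (P + span_cone S) = (\<Sum>j\<in>J. rf_monom (v j) * gen_fun (K j + span_cone (insert u S)))
        + (\<Sum>j\<in>J. rf_monom (v j) * gen_fun (K j + span_cone (insert (- u) S)))"
      unfolding split[OF assms(3)] using IH[of u] IH[of "- u"] by simp
    also have "\<dots> = (\<Sum>j\<in>J. rf_monom (v j) * gen_fun (K j + span_cone S))"
      using split[OF assms(4)] by (simp add: sum.distrib[symmetric] distrib_left)
    finally show ?case .
  qed
  from this[of E "{}"] show ?thesis using assms(1) by (simp add: plus_span_cone_empty del: image_empty)
qed

section \<open>Maxima at vertices, pointed cones and the fully split identity\<close>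

text \<open>A recession direction of the superlevel set at a point \<open>p\<close> would be one
  along which the functional does not decrease, so that set is compact. The maximizers form a
  compact face, and its extreme points are extreme in the polyhedron.\<close>

lemma maximum_at_extreme_point:
  fixes H :: "('a::euclidean_space \<times> real) set"
  assumes "hpoly H \<noteq> {}" and neg: "\<And>u. u \<noteq> 0 \<Longrightarrow> (\<And>a c. (a, c) \<in> H \<Longrightarrow> a \<bullet> u \<le> 0) \<Longrightarrow> \<xi> \<bullet> u < 0"
  obtains e where "e extreme_point_of hpoly H" "\<And>x. x \<in> hpoly H \<Longrightarrow> \<xi> \<bullet> x \<le> \<xi> \<bullet> e"
proof -
  obtain p where p: "p \<in> hpoly H" using assms(1) by blast
  define B where "B = hpoly (insert (- \<xi>, - (\<xi> \<bullet> p)) H)"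
  have B: "x \<in> B \<longleftrightarrow> x \<in> hpoly H \<and> \<xi> \<bullet> p \<le> \<xi> \<bullet> x" for x by (auto simp: B_def hpoly_def)
  have "bounded B"
  proof (rule ccontr)
    assume "\<not> bounded B"
    then obtain u where u: "u \<noteq> 0" "\<And>a c. (a, c) \<in> insert (- \<xi>, - (\<xi> \<bullet> p)) H \<Longrightarrow> a \<bullet> u \<le> 0"
      using unbounded_polyhedron_recession[of "insert (- \<xi>, - (\<xi> \<bullet> p)) H"] unfolding B_def hpoly_def by metis
    have "\<xi> \<bullet> u \<ge> 0" using u(2)[of "- \<xi>"] by auto
    moreover have "\<xi> \<bullet> u < 0" using u by (intro neg) auto
    ultimately show False by simp
  qed
  then have compB: "compact B" using hpoly_closed compact_eq_bounded_closed unfolding B_def by blast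
  have "B \<noteq> {}" using p B by blast
  then obtain y where y: "y \<in> B" "\<And>x. x \<in> B \<Longrightarrow> \<xi> \<bullet> x \<le> \<xi> \<bullet> y"
    using continuous_attains_sup[OF compB _ continuous_on_inner[OF continuous_on_const continuous_on_id]]
    by metis
  have max: "\<xi> \<bullet> x \<le> \<xi> \<bullet> y" if "x \<in> hpoly H" for x
  proof (cases "\<xi> \<bullet> p \<le> \<xi> \<bullet> x")
    case True
    then show ?thesis using y(2) B that by blast
  next
    case False
    then show ?thesis using y(1) B by force
  qed
  define F where "F = hpoly H \<inter> {x. \<xi> \<bullet> x = \<xi> \<bullet> y}"
  have F_face: "F face_of hpoly H"
    unfolding F_def using max by (intro face_of_Int_supporting_hyperplane_le hpoly_convex)
  have "x \<in> F \<longleftrightarrow> x \<in> B \<inter> {x. \<xi> \<bullet> x = \<xi> \<bullet> y}" for x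
    using B[of x] B[of y] y(1) by (auto simp: F_def)
  then have "F = B \<inter> {x. \<xi> \<bullet> x = \<xi> \<bullet> y}" by blast
  then have "compact F" using compB closed_hyperplane by (metis compact_Int_closed)
  moreover have "convex F" using F_face by (rule face_of_imp_convex)
  moreover have "F \<noteq> {}" using y(1) B by (auto simp: F_def)
  ultimately obtain e where e: "e extreme_point_of F" by (rule extreme_point_exists_convex)
  then have "e \<in> F" by (simp add: extreme_point_of_def)
  then show thesis
    using e extreme_point_of_face[OF F_face] max by (intro that[of e]) (auto simp: F_def)
qed

lemma convex_cone_set_plus: "convex_cone C \<Longrightarrow> convex_cone D \<Longrightarrow> convex_cone (C + D)"
  using convex_cone_sums[of C D] by (simp add: set_plus_def UNION_eq Bex_def)

lemma rational_polyhedron_singleton_0: "rational_polyhedron {0 :: real^'d}"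
proof -
  let ?H = "(\<lambda>i. (axis i 1 :: real^'d, 0::real)) ` UNIV \<union> (\<lambda>i. (- axis i 1, 0)) ` UNIV"
  have "x \<in> hpoly ?H \<longleftrightarrow> (\<forall>i. x $ i \<le> 0 \<and> 0 \<le> x $ i)" for x
    by (auto simp: hpoly_def inner_axis' ball_Un)
  moreover have "r \<le> 0 \<and> 0 \<le> r \<longleftrightarrow> r = 0" for r :: real by auto
  ultimately have eq: "{0} = hpoly ?H" by (simp add: set_eq_iff vec_eq_iff)
  show ?thesis unfolding rational_polyhedron_hpoly
  proof (intro exI conjI)
    show "finite ?H" by simp
    show "\<forall>(a, c)\<in>?H. (\<forall>i. a $ i \<in> \<rat>) \<and> c \<in> \<rat>" by (auto simp: axis_def)
  qed (rule eq)
qed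

text \<open>The constraints come from Fourier-Motzkin elimination, starting with the origin and
  adding one generator at a time.\<close>

lemma rational_polyhedron_span_cone: "finite S \<Longrightarrow> rational_polyhedron (span_cone S)"
proof -
  have "{0} + span_cone S = span_cone S" by (auto simp: set_plus_def)
  then show "finite S \<Longrightarrow> rational_polyhedron (span_cone S)"
    using rational_polyhedron_plus_span_cone[OF _ rational_polyhedron_singleton_0, of S] by simp
qed

lemma hpolyD: "x \<in> hpoly H \<Longrightarrow> (a, c) \<in> H \<Longrightarrow> a \<bullet> x \<le> c"
  by (auto simp: hpoly_def)

lemma hpoly_cone_nonpos:
  assumes "convex_cone (hpoly H)" "x \<in> hpoly H" "(a, c) \<in> H"
  shows "a \<bullet> x \<le> 0" and "c \<ge> 0"
proof -
  have "0 \<in> hpoly H" using assms(1) by (rule convex_cone_contains_0)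
  then show c: "c \<ge> 0" using assms(3) by (auto simp: hpoly_def)
  show "a \<bullet> x \<le> 0"
  proof (rule ccontr)
    assume pos: "\<not> a \<bullet> x \<le> 0"
    then have "((c + 1) / (a \<bullet> x)) *\<^sub>R x \<in> hpoly H"
      using c by (intro convex_cone_scaleR[OF assms(1) _ assms(2)]) auto
    then have "a \<bullet> (((c + 1) / (a \<bullet> x)) *\<^sub>R x) \<le> c" using assms(3) by (rule hpolyD)
    then show False using pos by simp
  qed
qed

text \<open>The sum of all constraint normals works: where it vanishes on the cone, every single
  normal vanishes, and the opposite vector lies in the cone too.\<close>

lemma pointed_cone_functional:
  assumes "rational_polyhedron C" "convex_cone C" and pointed: "\<And>u. u \<in> C \<Longrightarrow> - u \<in> C \<Longrightarrow> u = 0"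
  obtains \<xi> where "\<And>u. u \<in> C \<Longrightarrow> u \<noteq> 0 \<Longrightarrow> \<xi> \<bullet> u < 0"
proof -
  obtain H where H: "finite H" "C = hpoly H" using assms(1) unfolding rational_polyhedron_hpoly by blast
  have "(\<Sum>p\<in>H. fst p) \<bullet> u < 0" if u: "u \<in> C" "u \<noteq> 0" for u
  proof -
    have nonpos: "fst p \<bullet> u \<le> 0" if "p \<in> H" for p
      using hpoly_cone_nonpos(1)[of H u "fst p" "snd p"] assms(2) u(1) that unfolding H(2) by simp
    have "(\<Sum>p\<in>H. fst p \<bullet> u) \<noteq> 0"
    proof
      assume "(\<Sum>p\<in>H. fst p \<bullet> u) = 0"
      then have "\<forall>p\<in>H. fst p \<bullet> u = 0"
        using sum_nonneg_eq_0_iff[OF H(1), of "\<lambda>p. - (fst p \<bullet> u)"] nonpos by (simp add: sum_negf)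
      then have "- u \<in> C"
        using hpoly_cone_nonpos(2)[of H u] assms(2) u(1) unfolding H(2) by (force simp: hpoly_def)
      then show False using pointed[OF u(1)] u(2) by simp
    qed
    moreover have "(\<Sum>p\<in>H. fst p \<bullet> u) \<le> 0" using nonpos by (rule sum_nonpos)
    ultimately show ?thesis by (simp add: inner_sum_left)
  qed
  then show thesis by (rule that)
qed

text \<open>
  If \<open>C\<close> is pointed, then either all generators of \<open>K j\<close> lie in \<open>C\<close> and \<open>K j + C = C\<close>, or the
  negative of one of them does and \<open>K j + C\<close> contains a line. The former happens for at most
  one \<open>j\<close>, since then \<open>w j\<close> is the apex of the polyhedron \<open>P' + C\<close>.
\<close>

lemma gen_fun_plus_signed_cone:
  fixes P P' R :: "(real^'d::{finite,linorder}) set" and v :: "'j \<Rightarrow> int^'d::{finite,linorder}"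
  assumes "finite J" and P: "rational_polyhedron P" "P \<noteq> {}"
    and K: "\<And>j. j \<in> J \<Longrightarrow> rational_polyhedron (K j)" "\<And>j. j \<in> J \<Longrightarrow> convex_cone (K j)"
    and v: "\<And>j. j \<in> J \<Longrightarrow> real_vec (v j) \<in> P" "\<And>j. j \<in> J \<Longrightarrow> P \<subseteq> {real_vec (v j)} + K j"
    and w: "\<And>j. j \<in> J \<Longrightarrow> w j \<in> P'" "\<And>j. j \<in> J \<Longrightarrow> P' \<subseteq> {w j} + K j" "inj_on w J"
    and R: "convex_cone R" "\<And>x u. x \<in> P \<Longrightarrow> u \<in> R \<Longrightarrow> x + u \<in> P"
    and max: "\<And>\<xi>. (\<And>u. u \<in> R \<Longrightarrow> u \<noteq> 0 \<Longrightarrow> \<xi> \<bullet> u < 0) \<Longrightarrow> \<exists>j\<in>J. \<forall>x\<in>K j. \<xi> \<bullet> x \<le> 0"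
    and GR: "real_vec ` GR \<subseteq> R" "R \<subseteq> span_cone GR"
    and GK: "\<And>j. j \<in> J \<Longrightarrow> real_vec ` GK j \<subseteq> K j" "\<And>j. j \<in> J \<Longrightarrow> K j \<subseteq> span_cone (GK j)"
    and S: "finite S" "\<And>u. u \<in> GR \<union> (\<Union>j\<in>J. GK j) \<Longrightarrow> u \<noteq> 0 \<Longrightarrow> u \<in> S \<or> - u \<in> S"
  shows "gen_fun (P + span_cone S) = (\<Sum>j\<in>J. rf_monom (v j) * gen_fun (K j + span_cone S))"
proof -
  define C where "C = span_cone S"
  have C: "convex_cone C" "rational_polyhedron C"
    unfolding C_def using S(1) by (simp_all add: convex_cone_convex_cone_hull rational_polyhedron_span_cone)
  have rat: "rational_polyhedron (Q + C)" if "rational_polyhedron Q" for Q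
    unfolding C_def using rational_polyhedron_plus_span_cone[OF S(1) that] .
  have SC: "real_vec u \<in> C" if "u \<in> S" for u unfolding C_def using that by (intro hull_inc) auto
  have PR: "P + R = P"
  proof
    show "P + R \<subseteq> P" using R(2) by (auto elim!: set_plus_elim)
    show "P \<subseteq> P + R" using convex_cone_contains_0[OF R(1)] set_plus_intro[of _ P 0 R] by fastforce
  qed
  \<comment> \<open>The form in which all vanishing arguments below are used: \<open>T\<close>
    consists of recession directions of \<open>Q\<close>, and opposite vectors in
    \<open>T + C\<close> give a line in \<open>Q + C\<close>.\<close>
  have line: "gen_fun (Q + C) = 0" if "rational_polyhedron Q" "Q + T = Q" "convex_cone T" "Q \<noteq> {}"
    "u \<in> T + C" "- u \<in> T + C" "u \<noteq> 0" for Q T u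
  proof -
    have "contains_line (Q + (T + C))"
      using convex_cone_set_plus[OF that(3) C(1)] that by (intro contains_line_plus_cone[of _ u]) auto
    then show ?thesis using gen_fun_contains_line[OF rat[OF that(1)]] that(2) by (simp add: add.assoc[symmetric])
  qed
  have KK: "K j + K j = K j" if "j \<in> J" for j
  proof
    show "K j + K j \<subseteq> K j" using convex_cone_add[OF K(2)[OF that]] by (auto elim!: set_plus_elim)
    show "K j \<subseteq> K j + K j"
      using convex_cone_contains_0[OF K(2)[OF that]] set_plus_intro[of _ "K j" 0 "K j"] by fastforce
  qed
  have in_sum: "x \<in> T + C" if "x \<in> T \<or> x \<in> C" "convex_cone T" for x T
    using that set_plus_intro[of x T 0 C] set_plus_intro[of 0 T x C]
      convex_cone_contains_0[OF C(1)] convex_cone_contains_0[OF that(2)] by auto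
  show ?thesis
  proof (cases "\<forall>u. u \<in> C \<longrightarrow> - u \<in> C \<longrightarrow> u = 0")
    case False
    then obtain u where u: "u \<in> C" "- u \<in> C" "u \<noteq> 0" by blast
    have "gen_fun (P + C) = 0"
      using u P PR R(1) in_sum by (intro line[of P R u]) auto
    moreover have "gen_fun (K j + C) = 0" if "j \<in> J" for j
      using u K[OF that] KK[OF that] in_sum convex_cone_nonempty
      by (intro line[of "K j" "K j" u]) auto
    ultimately show ?thesis unfolding C_def by simp
  next
    case True
    define J' where "J' = {j \<in> J. K j \<subseteq> C}"
    have K_line: "gen_fun (K j + C) = 0" if j: "j \<in> J - J'" for j
    proof -
      have "\<not> real_vec ` GK j \<subseteq> C"
        using j GK(2)[of j] hull_minimal[of "real_vec ` GK j" C convex_cone] C(1) by (auto simp: J'_def)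
      then obtain g where g: "g \<in> GK j" "real_vec g \<notin> C" by blast
      then have "g \<noteq> 0" using convex_cone_contains_0[OF C(1)] by auto
      then have "- real_vec g \<in> C" using S(2)[of g] g j SC by (auto simp: real_vec_uminus[symmetric])
      then show ?thesis
        using g j GK(1)[of j] \<open>g \<noteq> 0\<close> K[of j] KK[of j] in_sum convex_cone_nonempty
        by (intro line[of "K j" "K j" "real_vec g"]) auto
    qed
    have K_absorb: "K j + C = C" if "j \<in> J'" for j
    proof
      show "K j + C \<subseteq> C" using that convex_cone_add[OF C(1)] by (auto simp: J'_def elim!: set_plus_elim)
      show "C \<subseteq> K j + C" using in_sum K(2) that by (auto simp: J'_def)
    qed
    have sum: "(\<Sum>j\<in>J. rf_monom (v j) * gen_fun (K j + C)) = (\<Sum>j\<in>J'. rf_monom (v j) * gen_fun C)"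
      using K_line K_absorb \<open>finite J\<close>
      by (intro sum.mono_neutral_cong_right) (auto simp: J'_def)
    have "gen_fun (P + C) = (\<Sum>j\<in>J'. rf_monom (v j) * gen_fun C)"
    proof (cases "J' = {}")
      case J': True
      \<comment> \<open>Otherwise a functional negative on \<open>C\<close> would be negative on
        \<open>R\<close> and hence nonpositive on some \<open>K j\<close>. For each generator g of
        this cone, g or - g lies in \<open>C\<close>; the latter alone would make the functional
        positive at g. So \<open>K j \<subseteq> C\<close>, although \<open>J'\<close> is
        empty.\<close>
      have "\<not> real_vec ` GR \<subseteq> C"
      proof
        assume "real_vec ` GR \<subseteq> C"
        then have RC: "R \<subseteq> C"
          using GR(2) hull_minimal[of "real_vec ` GR" C convex_cone] C(1) by blast
        obtain \<xi> where \<xi>: "\<And>u. u \<in> C \<Longrightarrow> u \<noteq> 0 \<Longrightarrow> \<xi> \<bullet> u < 0"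
          using pointed_cone_functional[OF C(2,1)] True by metis
        obtain j where j: "j \<in> J" "\<forall>x\<in>K j. \<xi> \<bullet> x \<le> 0" using max[of \<xi>] \<xi> RC by blast
        have "real_vec g \<in> C" if g: "g \<in> GK j" for g
        proof (rule ccontr)
          assume notin: "real_vec g \<notin> C"
          then have "g \<noteq> 0" using convex_cone_contains_0[OF C(1)] by auto
          then have "- real_vec g \<in> C" using notin S(2)[of g] g j SC by (auto simp: real_vec_uminus[symmetric])
          then have "\<xi> \<bullet> (- real_vec g) < 0" using \<open>g \<noteq> 0\<close> by (intro \<xi>) auto
          moreover have "real_vec g \<in> K j" using GK(1)[OF j(1)] g by blast
          ultimately show False using j(2) by force
        qed
        then have "K j \<subseteq> C"
          using GK(2)[OF j(1)] hull_minimal[of "real_vec ` GK j" C convex_cone] C(1) by blast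
        then show False using J' j(1) by (auto simp: J'_def)
      qed
      then obtain g where g: "g \<in> GR" "real_vec g \<notin> C" by blast
      then have "g \<noteq> 0" using convex_cone_contains_0[OF C(1)] by auto
      then have "- real_vec g \<in> C" using S(2)[of g] g SC by (auto simp: real_vec_uminus[symmetric])
      then have "gen_fun (P + C) = 0"
        using g GR(1) \<open>g \<noteq> 0\<close> P PR R(1) in_sum by (intro line[of P R "real_vec g"]) auto
      then show ?thesis using J' by simp
    next
      case False
      then obtain j where j: "j \<in> J'" by blast
      have "i = j" if i: "i \<in> J'" for i
      proof -
        have "w i \<in> {w j} + K j" "w j \<in> {w i} + K i"
          using w(1)[of i] w(1)[of j] w(2)[of i] w(2)[of j] i j by (auto simp: J'_def)
        then have "w i - w j \<in> C" "w j - w i \<in> C"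
          using i j unfolding J'_def mem_translate by auto
        then have "w i - w j = 0" using True by (metis minus_diff_eq)
        then show ?thesis using w(3) i j by (auto simp: J'_def inj_on_def)
      qed
      then have "J' = {j}" using j by blast
      moreover have "P + C = {real_vec (v j)} + C"
      proof
        show "P + C \<subseteq> {real_vec (v j)} + C"
        proof
          fix x assume "x \<in> P + C"
          then obtain p c where x: "x = p + c" "p \<in> P" "c \<in> C" by (rule set_plus_elim)
          have "p \<in> {real_vec (v j)} + K j" using x(2) v(2)[of j] j by (auto simp: J'_def)
          then have "p - real_vec (v j) \<in> C" using j unfolding J'_def mem_translate by auto
          then have "(p - real_vec (v j)) + c \<in> C" using x(3) by (rule convex_cone_add[OF C(1)])
          then show "x \<in> {real_vec (v j)} + C" by (simp add: mem_translate x(1) diff_add_eq)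
        qed
        show "{real_vec (v j)} + C \<subseteq> P + C"
          using v(1)[of j] j by (intro set_plus_mono2) (auto simp: J'_def)
      qed
      ultimately show ?thesis using gen_fun_translate[OF C(2)] by simp
    qed
    then show ?thesis using sum unfolding C_def by simp
  qed
qed

subsection \<open>Limits of the vertices\<close>

text \<open>The parameter runs along a filter, so a cluster point is reached along a finer filter in
  place of a subsequence.\<close>

lemma compact_convergent_subfilter:
  fixes f :: "'b \<Rightarrow> 'a::topological_space"
  assumes "compact C" "F \<noteq> bot" "eventually (\<lambda>t. f t \<in> C) F"
  obtains x G where "x \<in> C" "G \<le> F" "G \<noteq> bot" "(f \<longlongrightarrow> x) G"
proof -
  have "filtermap f F \<noteq> bot" "eventually (\<lambda>y. y \<in> C) (filtermap f F)"
    using assms by (auto simp: filtermap_bot_iff eventually_filtermap)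
  then obtain x where x: "x \<in> C" "inf (nhds x) (filtermap f F) \<noteq> bot"
    using assms(1) unfolding compact_filter by blast
  define G where "G = inf (filtercomap f (nhds x)) F"
  have "G \<noteq> bot"
  proof
    assume "G = bot"
    then have "eventually (\<lambda>_. False) G" by simp
    then obtain P Q where PQ: "eventually P (filtercomap f (nhds x))" "eventually Q F" "\<And>t. P t \<Longrightarrow> Q t \<Longrightarrow> False"
      unfolding G_def eventually_inf by blast
    then obtain P' where P': "eventually P' (nhds x)" "\<And>t. P' (f t) \<Longrightarrow> P t"
      unfolding eventually_filtercomap by blast
    have "eventually (\<lambda>y. \<not> P' y) (filtermap f F)"
      unfolding eventually_filtermap by (rule eventually_mono[OF PQ(2)]) (use P'(2) PQ(3) in blast)
    with P'(1) have "eventually (\<lambda>_. False) (inf (nhds x) (filtermap f F))"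
      unfolding eventually_inf by blast
    then show False using x(2) by (simp add: trivial_limit_def)
  qed
  moreover have "G \<le> F" by (simp add: G_def)
  moreover have "(f \<longlongrightarrow> x) G"
    unfolding G_def by (rule tendsto_mono[OF inf_le1]) (rule filterlim_filtercomap)
  ultimately show thesis using x(1) that by blast
qed

text \<open>With the signed unit vectors of one factor as \<open>U\<close>, this describes a
  projection along that factor.\<close>

lemma fourier_motzkin_cone:
  fixes H :: "('a::real_inner \<times> real) set"
  assumes "finite U" "finite H"
  obtains H' where "finite H'" "hpoly H + convex_cone hull U = hpoly H'"
  using assms
proof (induction U arbitrary: thesis rule: finite_induct)
  case empty
  then show ?case by (auto simp: set_plus_def intro: empty(1)[of H])
next
  case (insert u U)
  obtain H' where H': "finite H'" "hpoly H + convex_cone hull U = hpoly H'"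
    using insert.IH insert.prems(2) by blast
  have "convex_cone hull (insert u U) = convex_cone hull U + ray u"
    using convex_cone_hull_Un[of U "{u}"] unfolding convex_cone_hull_singleton
    by (auto simp: set_plus_def)
  then have "hpoly H + convex_cone hull (insert u U) = hpoly (fm_constraints H' u)"
    by (simp only: add.assoc[symmetric] H'(2) fourier_motzkin[OF H'(1)])
  then show ?case using finite_fm_constraints[OF H'(1)] by (rule insert.prems(1)[rotated])
qed

section \<open>Perturbation of the right-hand side\<close>

definition row_constraints :: "real^'d^'n \<Rightarrow> real^'n \<Rightarrow> ((real^'d) \<times> real) set" where
  "row_constraints A b = range (\<lambda>i. (A $ i, b $ i))"

lemma ineq_polyhedron_hpoly: "ineq_polyhedron A b = hpoly (row_constraints A b)"
  by (simp add: ineq_polyhedron_def hpoly_def row_constraints_def matrix_vector_mul_component)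

text \<open>
  By Fourier-Motzkin elimination, the set of all \<open>(b, r)\<close> such that some point of the
  polyhedron for the right-hand side \<open>b\<close> has distance at most \<open>r\<close> from \<open>x\<close> in the maximum
  norm is itself given by finitely many linear inequalities.
\<close>

lemma ineq_polyhedron_lower_semicontinuous:
  fixes A :: "real^'d^'n"
  assumes lim: "(b \<longlongrightarrow> b\<^sub>0) F" and ne: "eventually (\<lambda>t. ineq_polyhedron A (b t) \<noteq> {}) F"
    and x: "x \<in> ineq_polyhedron A b\<^sub>0" and "e > 0"
  shows "eventually (\<lambda>t. \<exists>y\<in>ineq_polyhedron A (b t). \<forall>i. \<bar>y $ i - x $ i\<bar> \<le> e) F"
proof -
  define H :: "(((real^'d) \<times> (real^'n) \<times> real) \<times> real) set" where "H =
    (\<lambda>i. ((A $ i, - axis i 1, 0), 0)) ` UNIV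
    \<union> (\<lambda>k. ((axis k 1, 0, -1), x $ k)) ` UNIV \<union> (\<lambda>k. ((- axis k 1, 0, -1), - x $ k)) ` UNIV"
  define U :: "((real^'d) \<times> (real^'n) \<times> real) set" where
    \<comment> \<open>The cone of \<open>U\<close> is the whole space of the first component, so
      adding it and then fixing that component at 0 expresses the existence of
      \<open>y\<close>.\<close>
    "U = (\<lambda>k. (axis k 1, 0, 0)) ` UNIV \<union> (\<lambda>k. (- axis k 1, 0, 0)) ` UNIV"
  have H: "(y, c, r) \<in> hpoly H \<longleftrightarrow> y \<in> ineq_polyhedron A c \<and> (\<forall>i. \<bar>y $ i - x $ i\<bar> \<le> r)" for y c r
  proof -
    have "(y, c, r) \<in> hpoly H \<longleftrightarrow> (\<forall>i. (A *v y) $ i \<le> c $ i) \<and> (\<forall>k. y $ k - r \<le> x $ k) \<and> (\<forall>k. - y $ k - r \<le> - x $ k)"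
      by (simp add: hpoly_def H_def ball_Un inner_prod_def inner_axis' matrix_vector_mul_component)
    also have "\<dots> \<longleftrightarrow> y \<in> ineq_polyhedron A c \<and> (\<forall>i. \<bar>y $ i - x $ i\<bar> \<le> r)"
      by (force simp: ineq_polyhedron_def abs_le_iff algebra_simps)
    finally show ?thesis .
  qed
  have U_sub: "convex_cone hull U \<subseteq> {(y, c, r). c = 0 \<and> r = 0}"
    by (rule hull_minimal) (auto simp: U_def convex_cone_iff zero_prod_def)
  have U_sup: "(y, 0, 0) \<in> convex_cone hull U" for y
  proof -
    let ?C = "convex_cone hull U"
    have C: "convex_cone ?C" by (rule convex_cone_convex_cone_hull)
    have "(y $ k *\<^sub>R axis k 1, 0, 0) \<in> ?C" for k
    proof -
      have "\<bar>y $ k\<bar> *\<^sub>R (axis k 1, 0, 0) \<in> ?C" "\<bar>y $ k\<bar> *\<^sub>R (- axis k 1, 0, 0) \<in> ?C"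
        by (intro convex_cone_scaleR[OF C] hull_inc; simp add: U_def)+
      then show ?thesis by (cases "y $ k \<ge> 0") auto
    qed
    then have "(\<Sum>k\<in>UNIV. (y $ k *\<^sub>R axis k 1, 0, 0)) \<in> ?C" by (intro convex_cone_sum[OF C])
    then show ?thesis
      using basis_expansion[of y] by (simp add: scalar_mult_eq_scaleR sum_prod)
  qed
  obtain H' where H': "finite H'" "hpoly H + convex_cone hull U = hpoly H'"
    by (rule fourier_motzkin_cone[of U H]) (simp_all add: U_def H_def)
  have proj: "(0, c, r) \<in> hpoly H' \<longleftrightarrow> (\<exists>y\<in>ineq_polyhedron A c. \<forall>i. \<bar>y $ i - x $ i\<bar> \<le> r)" for c r
  proof
    assume "(0, c, r) \<in> hpoly H'"
    then obtain p q where pq: "(0, c, r) = p + q" "p \<in> hpoly H" "q \<in> convex_cone hull U"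
      unfolding H'(2)[symmetric] by (rule set_plus_elim)
    then have "p = (fst p, c, r)" using U_sub by (cases p; cases q) auto
    then have "(fst p, c, r) \<in> hpoly H" using pq(2) by metis
    then show "\<exists>y\<in>ineq_polyhedron A c. \<forall>i. \<bar>y $ i - x $ i\<bar> \<le> r" unfolding H by blast
  next
    assume "\<exists>y\<in>ineq_polyhedron A c. \<forall>i. \<bar>y $ i - x $ i\<bar> \<le> r"
    then obtain y where "(y, c, r) \<in> hpoly H" unfolding H by blast
    from set_plus_intro[OF this U_sup[of "- y"]] show "(0, c, r) \<in> hpoly H'" unfolding H'(2) by simp
  qed
  have "eventually (\<lambda>t. \<forall>p\<in>H'. fst p \<bullet> (0, b t, e) \<le> snd p) F"
    unfolding eventually_ball_finite_distrib[OF H'(1)]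
  proof
    fix p assume p: "p \<in> H'"
    obtain \<alpha> \<beta> \<gamma> c where p_def: "p = ((\<alpha>, \<beta>, \<gamma>), c)" by (metis surj_pair)
    have con: "\<beta> \<bullet> d + \<gamma> * r \<le> c" if "(0, d, r) \<in> hpoly H'" for d r
      using hpolyD[OF that, of "(\<alpha>, \<beta>, \<gamma>)" c] p by (simp add: p_def inner_prod_def)
    have ev_feasible: "eventually (\<lambda>t. \<exists>r. \<forall>s\<ge>r. \<beta> \<bullet> b t + \<gamma> * s \<le> c) F"
      using ne
    proof (rule eventually_mono)
      fix t assume "ineq_polyhedron A (b t) \<noteq> {}"
      then obtain y where y: "y \<in> ineq_polyhedron A (b t)" by blast
      have "\<bar>y $ i - x $ i\<bar> \<le> (\<Sum>i\<in>UNIV. \<bar>y $ i - x $ i\<bar>)" for i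
        by (intro member_le_sum) auto
      then have "(0, b t, s) \<in> hpoly H'" if "s \<ge> (\<Sum>i\<in>UNIV. \<bar>y $ i - x $ i\<bar>)" for s
        unfolding proj using y that by (meson order_trans)
      then show "\<exists>r. \<forall>s\<ge>r. \<beta> \<bullet> b t + \<gamma> * s \<le> c" using con by blast
    qed
    \<comment> \<open>For \<gamma> \<ge> 0 the constraint holds at large radii because the perturbed
      polyhedron is nonempty, hence also at \<open>e\<close>. For \<gamma> < 0 it holds at radius 0
      for \<open>b\<^sub>0\<close>, so it is strict at radius \<open>e\<close>, and strictness
      survives a small perturbation.\<close>
    consider "\<gamma> \<ge> 0" | "\<gamma> < 0" by linarith
    then have "eventually (\<lambda>t. \<beta> \<bullet> b t + \<gamma> * e \<le> c) F"
    proof cases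
      case 1
      from ev_feasible show ?thesis
      proof (rule eventually_mono)
        fix t assume "\<exists>r. \<forall>s\<ge>r. \<beta> \<bullet> b t + \<gamma> * s \<le> c"
        then obtain r where "\<beta> \<bullet> b t + \<gamma> * max r e \<le> c" by (meson max.cobounded1)
        moreover have "\<gamma> * e \<le> \<gamma> * max r e" using 1 by (intro mult_left_mono) auto
        ultimately show "\<beta> \<bullet> b t + \<gamma> * e \<le> c" by linarith
      qed
    next
      case 2
      have "(0, b\<^sub>0, 0) \<in> hpoly H'" unfolding proj using x by auto
      then have "\<beta> \<bullet> b\<^sub>0 + \<gamma> * e < c" using con[of b\<^sub>0 0] mult_neg_pos[OF 2 \<open>e > 0\<close>] by simp
      moreover have "((\<lambda>t. \<beta> \<bullet> b t + \<gamma> * e) \<longlongrightarrow> \<beta> \<bullet> b\<^sub>0 + \<gamma> * e) F" by (intro tendsto_intros lim)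
      ultimately have "eventually (\<lambda>t. \<beta> \<bullet> b t + \<gamma> * e < c) F" by (rule order_tendstoD(2)[rotated])
      then show ?thesis by (rule eventually_mono) simp
    qed
    then show "eventually (\<lambda>t. fst p \<bullet> (0, b t, e) \<le> snd p) F" by (simp add: p_def inner_prod_def)
  qed
  then show ?thesis
  proof (rule eventually_mono)
    fix t assume "\<forall>p\<in>H'. fst p \<bullet> (0, b t, e) \<le> snd p"
    then have "(0, b t, e) \<in> hpoly H'" by (auto simp: hpoly_def)
    then show "\<exists>y\<in>ineq_polyhedron A (b t). \<forall>i. \<bar>y $ i - x $ i\<bar> \<le> e" unfolding proj .
  qed
qed

lemma closest_point_tendsto:
  fixes A :: "real^'d^'n"
  assumes lim: "(b \<longlongrightarrow> b\<^sub>0) F" and ne: "eventually (\<lambda>t. ineq_polyhedron A (b t) \<noteq> {}) F"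
    and x: "x \<in> ineq_polyhedron A b\<^sub>0"
  shows "((\<lambda>t. closest_point (ineq_polyhedron A (b t)) x) \<longlongrightarrow> x) F"
proof (rule tendstoI)
  fix e :: real assume "e > 0"
  \<comment> \<open>The norm is at most the sum of \<open>CARD('d)\<close> coordinate differences;
    the factor 2 leaves room for the strict inequality.\<close>
  define d where "d = e / (2 * CARD('d))"
  have "d > 0" using \<open>e > 0\<close> by (simp add: d_def)
  from ineq_polyhedron_lower_semicontinuous[OF lim ne x this]
  show "eventually (\<lambda>t. dist (closest_point (ineq_polyhedron A (b t)) x) x < e) F"
  proof (rule eventually_mono)
    fix t assume "\<exists>y\<in>ineq_polyhedron A (b t). \<forall>i. \<bar>y $ i - x $ i\<bar> \<le> d"
    then obtain y where y: "y \<in> ineq_polyhedron A (b t)" "\<And>i. \<bar>y $ i - x $ i\<bar> \<le> d" by blast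
    have "dist x (closest_point (ineq_polyhedron A (b t)) x) \<le> dist x y"
      using y(1) hpoly_closed unfolding ineq_polyhedron_hpoly by (intro closest_point_le)
    also have "\<dots> \<le> (\<Sum>i\<in>UNIV. \<bar>(y - x) $ i\<bar>)"
      using norm_le_l1_cart[of "y - x"] by (simp add: dist_norm norm_minus_commute)
    also have "\<dots> \<le> (\<Sum>i\<in>(UNIV :: 'd set). d)" by (intro sum_mono) (simp add: y(2))
    also have "\<dots> = e / 2" by (simp add: d_def)
    also have "\<dots> < e" using \<open>e > 0\<close> by simp
    finally show "dist (closest_point (ineq_polyhedron A (b t)) x) x < e" by (simp add: dist_commute)
  qed
qed

text \<open>Also applied to right-hand sides rescaled so that they tend to 0, where it yields
  recession directions.\<close>

lemma ineq_polyhedron_limit: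
  assumes "(b \<longlongrightarrow> b\<^sub>0) G" "(y \<longlongrightarrow> v) G" "G \<noteq> bot"
    and "eventually (\<lambda>t. y t \<in> ineq_polyhedron A (b t)) G"
  shows "v \<in> ineq_polyhedron A b\<^sub>0"
  unfolding ineq_polyhedron_def
proof (intro CollectI allI)
  fix i
  have Ay: "((\<lambda>t. (A *v y t) $ i) \<longlongrightarrow> (A *v v) $ i) G"
    unfolding matrix_vector_mul_component by (intro tendsto_intros assms(2))
  have bt: "((\<lambda>t. b t $ i) \<longlongrightarrow> b\<^sub>0 $ i) G" by (intro tendsto_intros assms(1))
  have "eventually (\<lambda>t. (A *v y t) $ i \<le> b t $ i) G"
    using assms(4) by eventually_elim (simp add: ineq_polyhedron_def)
  then show "(A *v v) $ i \<le> b\<^sub>0 $ i" by (rule tendsto_le[OF assms(3) bt Ay])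
qed

text \<open>
  If \<open>w t\<close> escaped to infinity, a limit direction \<open>u\<close> would be a recession direction of the
  polyhedra, so \<open>u\<close> would lie in \<open>K\<close>; but \<open>- u\<close> is a limit of directions from \<open>w t\<close> to points
  staying bounded, so it would lie in \<open>K\<close> as well.
\<close>

lemma apex_bounded:
  fixes A :: "real^'d^'n"
  assumes F: "F \<noteq> bot" and lim: "(b \<longlongrightarrow> b\<^sub>0) F" and x: "x \<in> ineq_polyhedron A b\<^sub>0"
    and w: "eventually (\<lambda>t. w t \<in> ineq_polyhedron A (b t) \<and> ineq_polyhedron A (b t) \<subseteq> {w t} + K) F"
    and K: "closed K" "convex_cone K" "\<And>u. u \<in> K \<Longrightarrow> - u \<in> K \<Longrightarrow> u = 0"
  shows "\<exists>M. eventually (\<lambda>t. norm (w t) \<le> M) F"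
proof (rule ccontr)
  assume unb: "\<nexists>M. eventually (\<lambda>t. norm (w t) \<le> M) F"
  \<comment> \<open>No bound on \<open>norm (w t)\<close> holds eventually, so the norms tend to
    infinity along a nontrivial finer filter.\<close>
  define G\<^sub>0 where "G\<^sub>0 = inf (filtercomap (\<lambda>t. norm (w t)) at_top) F"
  have "G\<^sub>0 \<noteq> bot"
  proof
    assume "G\<^sub>0 = bot"
    then have "eventually (\<lambda>_. False) G\<^sub>0" by simp
    then obtain P Q where PQ: "eventually P (filtercomap (\<lambda>t. norm (w t)) at_top)" "eventually Q F"
      "\<And>t. P t \<Longrightarrow> Q t \<Longrightarrow> False"
      unfolding G\<^sub>0_def eventually_inf by blast
    then obtain N where N: "\<And>t. norm (w t) \<ge> N \<Longrightarrow> P t"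
      unfolding eventually_filtercomap_at_top_linorder by blast
    have "eventually (\<lambda>t. norm (w t) \<le> N) F"
      by (rule eventually_mono[OF PQ(2)]) (use N PQ(3) in \<open>meson linorder_le_cases\<close>)
    then show False using unb by blast
  qed
  moreover define y where "y t = w t /\<^sub>R norm (w t)" for t
  have inf: "filterlim (\<lambda>t. norm (w t)) at_top G\<^sub>0"
    unfolding G\<^sub>0_def by (rule filterlim_mono[OF _ order_refl inf_le1]) (rule filterlim_filtercomap)
  then have pos: "eventually (\<lambda>t. norm (w t) > 0) G\<^sub>0" unfolding filterlim_at_top_dense by blast
  then have "eventually (\<lambda>t. y t \<in> sphere 0 1) G\<^sub>0"
    by (rule eventually_mono) (simp add: y_def)
  ultimately obtain u G where u: "u \<in> sphere 0 1" "G \<le> G\<^sub>0" "G \<noteq> bot" "(y \<longlongrightarrow> u) G"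
    using compact_convergent_subfilter[OF compact_sphere] by metis
  have GF: "G \<le> F" using u(2) by (simp add: G\<^sub>0_def)
  have pos: "eventually (\<lambda>t. norm (w t) > 0) G" using pos u(2) by (simp add: filter_leD)
  have inv0: "((\<lambda>t. inverse (norm (w t))) \<longlongrightarrow> 0) G"
    using filterlim_mono[OF inf order_refl u(2)]
    by (intro filterlim_compose[OF tendsto_inverse_0] filterlim_at_top_imp_at_infinity)
  have wG: "eventually (\<lambda>t. w t \<in> ineq_polyhedron A (b t) \<and> ineq_polyhedron A (b t) \<subseteq> {w t} + K) G"
    using w GF by (simp add: filter_leD)
  \<comment> \<open>After division by \<open>norm (w t)\<close> the right-hand sides tend to 0,
    which makes \<open>u\<close> a recession direction.\<close>
  have "((\<lambda>t. inverse (norm (w t)) *\<^sub>R b t) \<longlongrightarrow> 0 *\<^sub>R b\<^sub>0) G"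
    by (intro tendsto_scaleR inv0 tendsto_mono[OF GF lim])
  then have "u \<in> ineq_polyhedron A (0 *\<^sub>R b\<^sub>0)"
    using u(4,3)
  proof (rule ineq_polyhedron_limit)
    show "eventually (\<lambda>t. y t \<in> ineq_polyhedron A (inverse (norm (w t)) *\<^sub>R b t)) G"
      using wG pos
      by eventually_elim
        (auto simp: ineq_polyhedron_def y_def matrix_vector_mult_scaleR intro!: mult_left_mono)
  qed
  then have Au: "(A *v u) $ i \<le> 0" for i by (simp add: ineq_polyhedron_def)
  obtain t where t: "w t \<in> ineq_polyhedron A (b t)" "ineq_polyhedron A (b t) \<subseteq> {w t} + K"
    using eventually_happens[OF wG] u(3) by auto
  have "(A *v (w t + u)) $ i \<le> b t $ i" for i
  proof -
    have "(A *v w t) $ i \<le> b t $ i" using t(1) by (simp add: ineq_polyhedron_def)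
    then show ?thesis
      using Au[of i] unfolding matrix_vector_right_distrib vector_add_component by linarith
  qed
  then have "w t + u \<in> ineq_polyhedron A (b t)" by (simp add: ineq_polyhedron_def)
  then have uK: "u \<in> K" using t(2) mem_translate[of "w t + u" "w t" K] by auto
  define c where "c t = closest_point (ineq_polyhedron A (b t)) x" for t
  have ne: "eventually (\<lambda>t. ineq_polyhedron A (b t) \<noteq> {}) F" using w by eventually_elim auto
  have c_in: "eventually (\<lambda>t. c t \<in> ineq_polyhedron A (b t)) F"
    using ne by eventually_elim (auto simp: c_def ineq_polyhedron_hpoly intro: closest_point_in_set hpoly_closed)
  have "(c \<longlongrightarrow> x) G" unfolding c_def using closest_point_tendsto[OF lim ne x] GF by (rule tendsto_mono[rotated])
  then have conv: "((\<lambda>t. inverse (norm (w t)) *\<^sub>R c t - y t) \<longlongrightarrow> 0 *\<^sub>R x - u) G"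
    by (intro tendsto_diff tendsto_scaleR inv0 u(4))
  have "eventually (\<lambda>t. inverse (norm (w t)) *\<^sub>R c t - y t \<in> K) G"
    using wG filter_leD[OF GF c_in]
  proof eventually_elim
    case (elim t)
    then have "c t - w t \<in> K" using mem_translate[of "c t" "w t" K] by auto
    then have "inverse (norm (w t)) *\<^sub>R (c t - w t) \<in> K" by (intro convex_cone_scaleR[OF K(2)]) auto
    then show ?case by (simp add: y_def scaleR_right_diff_distrib)
  qed
  then have "0 *\<^sub>R x - u \<in> K" by (rule Lim_in_closed_set[OF K(1) _ u(3) conv])
  then have "u = 0" using K(3) uK by simp
  then show False using u(1) by simp
qed

text \<open>Every cluster point v of \<open>w\<close> satisfies the two conclusions about the limit
  polyhedron. Two cluster points therefore differ by a vector that lies in \<open>K\<close> together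
  with its negative, so they agree; a bounded family with a single cluster point converges.\<close>

lemma apex_converges:
  fixes A :: "real^'d^'n"
  assumes F: "F \<noteq> bot" and lim: "(b \<longlongrightarrow> b\<^sub>0) F" and ne0: "ineq_polyhedron A b\<^sub>0 \<noteq> {}"
    and w: "eventually (\<lambda>t. w t \<in> ineq_polyhedron A (b t) \<and> ineq_polyhedron A (b t) \<subseteq> {w t} + K) F"
    and K: "closed K" "convex_cone K" "\<And>u. u \<in> K \<Longrightarrow> - u \<in> K \<Longrightarrow> u = 0"
  obtains v where "(w \<longlongrightarrow> v) F" "v \<in> ineq_polyhedron A b\<^sub>0" "ineq_polyhedron A b\<^sub>0 \<subseteq> {v} + K"
proof -
  obtain x where x: "x \<in> ineq_polyhedron A b\<^sub>0" using ne0 by blast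
  obtain M where M: "eventually (\<lambda>t. norm (w t) \<le> M) F"
    using apex_bounded[OF F lim x w K] by blast
  have ne: "eventually (\<lambda>t. ineq_polyhedron A (b t) \<noteq> {}) F" using w by eventually_elim auto
  have limit: "v \<in> ineq_polyhedron A b\<^sub>0 \<and> ineq_polyhedron A b\<^sub>0 \<subseteq> {v} + K"
    if G: "G \<le> F" "G \<noteq> bot" "(w \<longlongrightarrow> v) G" for v G
  proof
    have wG: "eventually (\<lambda>t. w t \<in> ineq_polyhedron A (b t) \<and> ineq_polyhedron A (b t) \<subseteq> {w t} + K) G"
      using w G(1) by (simp add: filter_leD)
    show "v \<in> ineq_polyhedron A b\<^sub>0"
      using tendsto_mono[OF G(1) lim] G(3,2)
      by (rule ineq_polyhedron_limit) (use wG in \<open>auto elim: eventually_mono\<close>)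
    show "ineq_polyhedron A b\<^sub>0 \<subseteq> {v} + K"
    proof
      fix p assume p: "p \<in> ineq_polyhedron A b\<^sub>0"
      define c where "c t = closest_point (ineq_polyhedron A (b t)) p" for t
      have "(c \<longlongrightarrow> p) G" unfolding c_def using closest_point_tendsto[OF lim ne p] G(1) by (rule tendsto_mono[rotated])
      then have conv: "((\<lambda>t. c t - w t) \<longlongrightarrow> p - v) G" by (intro tendsto_diff G(3))
      have "eventually (\<lambda>t. c t - w t \<in> K) G"
        using wG
      proof eventually_elim
        case (elim t)
        then have "c t \<in> ineq_polyhedron A (b t)"
          by (auto simp: c_def ineq_polyhedron_hpoly intro: closest_point_in_set hpoly_closed)
        then show ?case using elim mem_translate[of "c t" "w t" K] by auto
      qed
      then have "p - v \<in> K" by (rule Lim_in_closed_set[OF K(1) _ G(2) conv])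
      then show "p \<in> {v} + K" by (simp add: mem_translate)
    qed
  qed
  have "eventually (\<lambda>t. w t \<in> cball 0 M) F" using M by (simp add: dist_norm)
  then obtain v G where v: "G \<le> F" "G \<noteq> bot" "(w \<longlongrightarrow> v) G"
    using compact_convergent_subfilter[OF compact_cball F] by metis
  have "(w \<longlongrightarrow> v) F"
  proof (rule ccontr)
    assume "\<not> (w \<longlongrightarrow> v) F"
    then obtain e where e: "e > 0" "\<not> eventually (\<lambda>t. dist (w t) v < e) F" unfolding tendsto_iff by blast
    \<comment> \<open>Along \<open>F'\<close> the apex keeps distance at least \<open>e\<close> from
      \<open>v\<close>, so compactness would give a second cluster point.\<close>
    define F' where "F' = inf F (principal {t. dist (w t) v \<ge> e})"
    have "F' \<noteq> bot"
    proof
      assume "F' = bot"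
      then have "eventually (\<lambda>_. False) F'" by simp
      then have "eventually (\<lambda>t. dist (w t) v < e) F"
        unfolding F'_def eventually_inf_principal by (auto simp: not_le elim: eventually_mono)
      then show False using e(2) by blast
    qed
    moreover have F': "F' \<le> F" by (simp add: F'_def)
    moreover have "eventually (\<lambda>t. w t \<in> cball 0 M) F'"
      using filter_leD[OF F' M] by (simp add: dist_norm)
    ultimately obtain v' G' where v': "G' \<le> F'" "G' \<noteq> bot" "(w \<longlongrightarrow> v') G'"
      using compact_convergent_subfilter[OF compact_cball] by metis
    have "v' \<in> {v} + K" "v \<in> {v'} + K"
      using limit[OF v] limit[OF order_trans[OF v'(1) F'] v'(2,3)] by blast+
    then have "v' - v \<in> K" "v - v' \<in> K" by (simp_all add: mem_translate)
    then have "v' = v" using K(3)[of "v' - v"] by simp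
    have "eventually (\<lambda>t. dist (w t) v \<ge> e) F'"
      unfolding F'_def eventually_inf_principal by simp
    then have "eventually (\<lambda>t. dist (w t) v \<ge> e) G'" using v'(1) by (simp add: filter_leD)
    moreover have "eventually (\<lambda>t. dist (w t) v < e) G'" using v'(3) e(1) \<open>v' = v\<close> by (auto simp: tendsto_iff)
    ultimately have "eventually (\<lambda>t. False) G'" by eventually_elim simp
    then show False using v'(2) by (simp add: trivial_limit_def)
  qed
  then show thesis using limit[OF v] that by blast
qed

section \<open>Feasible cones and apexes\<close>

lemma fcone_convex_cone:
  assumes "convex P" "v \<in> P"
  shows "convex_cone (fcone P v)"
  unfolding convex_cone_iff
proof (intro conjI ballI allI impI)
  show "0 \<in> fcone P v" using assms by (simp add: fcone_def)
  fix x assume x: "x \<in> fcone P v"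
  {
    fix y assume y: "y \<in> fcone P v"
    \<comment> \<open>A step \<delta> along \<open>x + y\<close> is the midpoint of the steps 2
      \<delta> along \<open>x\<close> and along \<open>y\<close>.\<close>
    have double: "eventually (\<lambda>\<delta>. v + (2 * \<delta>) *\<^sub>R z \<in> P) (at_right 0)" if "z \<in> fcone P v" for z
    proof -
      have "filterlim (\<lambda>\<delta>::real. 2 * \<delta>) (at_right 0) (at_right 0)"
        by (auto simp: filterlim_at eventually_at_filter intro!: tendsto_eq_intros)
      then show ?thesis using that unfolding fcone_def by (auto dest: eventually_compose_filterlim)
    qed
    show "x + y \<in> fcone P v"
      using double[OF x] double[OF y] unfolding fcone_def mem_Collect_eq
    proof eventually_elim
      case (elim \<delta>)
      have "(1/2) *\<^sub>R (v + (2 * \<delta>) *\<^sub>R x) + (1/2) *\<^sub>R (v + (2 * \<delta>) *\<^sub>R y) \<in> P"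
        using elim by (intro convexD[OF assms(1)]) auto
      also have "(1/2) *\<^sub>R (v + (2 * \<delta>) *\<^sub>R x) + (1/2) *\<^sub>R (v + (2 * \<delta>) *\<^sub>R y) = v + \<delta> *\<^sub>R (x + y)"
        by (simp add: scaleR_right_distrib scaleR_add_left[symmetric] field_simps)
      finally show ?case .
    qed
  }
  fix c :: real assume "c \<ge> 0"
  show "c *\<^sub>R x \<in> fcone P v"
  proof (cases "c = 0")
    case True
    then show ?thesis using assms by (simp add: fcone_def)
  next
    case False
    then have "filterlim (\<lambda>\<delta>::real. \<delta> * c) (at_right 0) (at_right 0)"
      using \<open>c \<ge> 0\<close> by (auto simp: filterlim_at eventually_at_filter intro!: tendsto_eq_intros)
    then show ?thesis using x unfolding fcone_def by (auto dest: eventually_compose_filterlim)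
  qed
qed

lemma subset_translate_fcone:
  assumes "convex P" "v \<in> P"
  shows "P \<subseteq> {v} + fcone P v"
proof
  fix x assume x: "x \<in> P"
  have "eventually (\<lambda>\<delta>::real. \<delta> \<in> {0<..<1}) (at_right 0)" by (rule eventually_at_right_real) simp
  then have "eventually (\<lambda>\<delta>. v + \<delta> *\<^sub>R (x - v) \<in> P) (at_right 0)"
  proof eventually_elim
    case (elim \<delta>)
    then have "(1 - \<delta>) *\<^sub>R v + \<delta> *\<^sub>R x \<in> P" using x assms by (intro convexD) auto
    then show ?case by (simp add: algebra_simps)
  qed
  then show "x \<in> {v} + fcone P v" by (simp add: mem_translate fcone_def)
qed

lemma extreme_point_fcone_pointed:
  assumes "v extreme_point_of P" "u \<in> fcone P v" "- u \<in> fcone P v"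
  shows "u = 0"
proof (rule ccontr)
  assume "u \<noteq> 0"
  have "eventually (\<lambda>\<delta>. \<delta> > 0 \<and> v + \<delta> *\<^sub>R u \<in> P \<and> v - \<delta> *\<^sub>R u \<in> P) (at_right 0)"
    using assms(2,3) eventually_at_right_less[of 0] unfolding fcone_def mem_Collect_eq
    by eventually_elim simp
  then obtain \<delta> where \<delta>: "\<delta> > 0" "v + \<delta> *\<^sub>R u \<in> P" "v - \<delta> *\<^sub>R u \<in> P"
    using eventually_happens[of _ "at_right (0::real)"] trivial_limit_at_right_real by blast
  have "v = midpoint (v + \<delta> *\<^sub>R u) (v - \<delta> *\<^sub>R u)" by (simp add: midpoint_def scaleR_2[symmetric])
  moreover have "v + \<delta> *\<^sub>R u \<noteq> v - \<delta> *\<^sub>R u"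
  proof
    assume "v + \<delta> *\<^sub>R u = v - \<delta> *\<^sub>R u"
    then have "(2 * \<delta>) *\<^sub>R u = 0" by (simp add: algebra_simps scaleR_2[symmetric])
    then show False using \<delta>(1) \<open>u \<noteq> 0\<close> by simp
  qed
  ultimately have "v \<in> open_segment (v + \<delta> *\<^sub>R u) (v - \<delta> *\<^sub>R u)"
    by (metis midpoint_in_open_segment)
  then show False using assms(1) \<delta> by (auto simp: extreme_point_of_def)
qed

text \<open>Integrality speaks of vertices only; this recognizes the limit of the vertices as a
  vertex of the limit polyhedron.\<close>

lemma extreme_point_of_apex:
  assumes "v \<in> P" "P \<subseteq> {v} + K" "convex_cone K" "\<And>u. u \<in> K \<Longrightarrow> - u \<in> K \<Longrightarrow> u = 0"
  shows "v extreme_point_of P"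
  unfolding extreme_point_of_def
proof (intro conjI ballI notI)
  fix x y assume xy: "x \<in> P" "y \<in> P" "v \<in> open_segment x y"
  then obtain s where s: "x \<noteq> y" "0 < s" "s < 1" "v = (1 - s) *\<^sub>R x + s *\<^sub>R y"
    unfolding in_segment by blast
  have "x \<in> {v} + K" "y \<in> {v} + K" using xy assms(2) by auto
  then have K: "(1 - s) *\<^sub>R (x - v) \<in> K" "s *\<^sub>R (y - v) \<in> K"
    using s by (auto simp: mem_translate intro!: convex_cone_scaleR[OF assms(3)])
  have "s *\<^sub>R (y - v) = - ((1 - s) *\<^sub>R (x - v))" unfolding s(4) by (simp add: algebra_simps)
  then have "(1 - s) *\<^sub>R (x - v) = 0" using K by (intro assms(4)) simp_all
  then have "x = v" using s by simp
  then have "(1 - s) *\<^sub>R x + s *\<^sub>R y = x" using s(4) by simp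
  then have "s *\<^sub>R (y - x) = 0" by (simp add: algebra_simps)
  then show False using s by simp
qed (fact assms(1))

text \<open>A cone described by finitely many inequalities satisfies their homogeneous versions: it
  contains 0, so the right-hand sides are nonnegative, and scaling excludes positive
  products.\<close>

lemma rational_cone_has_generators:
  fixes K :: "(real^'d) set"
  assumes "rational_polyhedron K" "convex_cone K"
  obtains G where "finite G" "real_vec ` G \<subseteq> K" "K \<subseteq> span_cone G"
proof -
  obtain cs where cs: "K = {x. \<forall>(a, c)\<in>set cs. real_vec a \<bullet> x \<le> of_int c}"
    using rational_polyhedron_int_constraints[OF assms(1)] .
  define H where "H = (\<lambda>(a, c). (real_vec a, real_of_int c)) ` set cs"
  have KH: "K = hpoly H" unfolding cs hpoly_def H_def by auto
  obtain G where G: "finite G" "\<And>g a. g \<in> G \<Longrightarrow> a \<in> set (map fst cs) \<Longrightarrow> idot a g \<le> 0"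
    "\<And>x. (\<And>a. a \<in> set (map fst cs) \<Longrightarrow> real_vec a \<bullet> x \<le> 0) \<Longrightarrow> x \<in> span_cone G"
    using rational_cone_generators[of "map fst cs"] by metis
  show thesis
  proof (rule that[OF G(1)])
    show "real_vec ` G \<subseteq> K"
    proof clarify
      fix g assume g: "g \<in> G"
      have "real_vec a \<bullet> real_vec g \<le> of_int c" if "(a, c) \<in> set cs" for a c
      proof -
        have "of_int c \<ge> (0::real)"
          using hpoly_cone_nonpos(2)[of H 0 "real_vec a" "of_int c"] convex_cone_contains_0[OF assms(2)]
            assms(2) that unfolding KH by (force simp: H_def)
        moreover have "idot a g \<le> 0" using G(2)[OF g, of a] that by force
        ultimately show ?thesis unfolding inner_real_vec by linarith
      qed
      then show "real_vec g \<in> K" unfolding cs by blast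
    qed
    show "K \<subseteq> span_cone G"
    proof
      fix x assume x: "x \<in> K"
      have "real_vec a \<bullet> x \<le> 0" if a: "a \<in> set (map fst cs)" for a
      proof -
        obtain c where "(a, c) \<in> set cs" using a by auto
        then have "(real_vec a, real_of_int c) \<in> H" by (force simp: H_def)
        then show ?thesis using hpoly_cone_nonpos(1)[of H x] assms(2) x unfolding KH by blast
      qed
      then show "x \<in> span_cone G" by (rule G(3))
    qed
  qed
qed

theorem theorem1p1:
  fixes A :: "real^'d::{finite,linorder}^'n"
    and b\<^sub>0 :: "real^'n"
    and b :: "real \<Rightarrow> real^'n"
    and I :: "real set"
    and l :: nat
    and w :: "real \<Rightarrow> nat \<Rightarrow> real^'d::{finite,linorder}"
    and K :: "nat \<Rightarrow> (real^'d::{finite,linorder}) set"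
  assumes "ineq_polyhedron A b\<^sub>0 \<noteq> {}"
    and "integral_polyhedron (ineq_polyhedron A b\<^sub>0)"
    and "rational_polyhedron (ineq_polyhedron A b\<^sub>0)"
    and "is_interval I" and "0 \<in> I" and "I \<noteq> {0}"
    and "continuous_on I b" and "b 0 = b\<^sub>0"
    and "\<And>t. t \<in> I \<Longrightarrow> t \<noteq> 0 \<Longrightarrow> ineq_polyhedron A (b t) \<noteq> {}"
    and "\<And>t. t \<in> I \<Longrightarrow> t \<noteq> 0 \<Longrightarrow>
           bij_betw (w t) {1..l} {v. v extreme_point_of (ineq_polyhedron A (b t))}"
    and "\<And>j. j \<in> {1..l} \<Longrightarrow> cone (K j) \<and> rational_polyhedron (K j)"
    and "\<And>t j. t \<in> I \<Longrightarrow> t \<noteq> 0 \<Longrightarrow> j \<in> {1..l} \<Longrightarrow>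
           fcone (ineq_polyhedron A (b t)) (w t j) = K j"
  shows "\<exists>v :: nat \<Rightarrow> int^'d::{finite,linorder}.
           (\<forall>j\<in>{1..l}. ((\<lambda>t. w t j) \<longlongrightarrow> real_vec (v j)) (at 0 within I)) \<and>
           mgf (ineq_polyhedron A b\<^sub>0) = (\<Sum>j = 1..l. rf_monom (v j) * mgf (K j))"
proof -
  define P where "P = ineq_polyhedron A b\<^sub>0"
  have convex_Pt: "convex (ineq_polyhedron A c)" for c
    unfolding ineq_polyhedron_hpoly by (rule hpoly_convex)
  \<comment> \<open>Since the \<open>K j\<close> do not depend on t, their properties can be read
    off at one parameter value.\<close>
  obtain t\<^sub>0 where t\<^sub>0: "t\<^sub>0 \<in> I" "t\<^sub>0 \<noteq> 0" using assms(5,6) by blast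
  have "I \<noteq> {x}" for x using assms(5) t\<^sub>0 by auto
  then have "0 islimpt I"
    using connected_imp_perfect[OF is_interval_connected[OF assms(4)] assms(5)] by blast
  then have F: "at 0 within I \<noteq> bot" by (simp add: trivial_limit_within)
  have lim: "(b \<longlongrightarrow> b\<^sub>0) (at 0 within I)"
    using assms(5,7,8) unfolding continuous_on_def by metis
  have nz: "eventually (\<lambda>t. t \<in> I \<and> t \<noteq> 0) (at 0 within I)"
    by (simp add: eventually_at_filter)
  have ext: "w t j extreme_point_of ineq_polyhedron A (b t)" if "t \<in> I" "t \<noteq> 0" "j \<in> {1..l}" for t j
    using bij_betwE[OF assms(10)[OF that(1,2)]] that(3) by blast
  then have wP: "w t j \<in> ineq_polyhedron A (b t)" if "t \<in> I" "t \<noteq> 0" "j \<in> {1..l}" for t j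
    using that unfolding extreme_point_of_def by blast
  have wK: "ineq_polyhedron A (b t) \<subseteq> {w t j} + K j" if "t \<in> I" "t \<noteq> 0" "j \<in> {1..l}" for t j
    using subset_translate_fcone[OF convex_Pt wP[OF that]] assms(12)[OF that] by simp
  have K_cone: "convex_cone (K j)" if "j \<in> {1..l}" for j
    using fcone_convex_cone[OF convex_Pt wP[OF t\<^sub>0 that]] assms(12)[OF t\<^sub>0 that] by simp
  have K_rat: "rational_polyhedron (K j)" if "j \<in> {1..l}" for j using assms(11)[OF that] by blast
  have K_pointed: "u = 0" if "j \<in> {1..l}" "u \<in> K j" "- u \<in> K j" for j u
    using extreme_point_fcone_pointed[OF ext[OF t\<^sub>0 that(1)]] assms(12)[OF t\<^sub>0 that(1)] that(2,3) by blast
  have "\<exists>z :: int^'d::{finite,linorder}. ((\<lambda>t. w t j) \<longlongrightarrow> real_vec z) (at 0 within I) \<and>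
      real_vec z \<in> P \<and> P \<subseteq> {real_vec z} + K j" if j: "j \<in> {1..l}" for j
  proof -
    have pointed: "u = 0" if "u \<in> K j" "- u \<in> K j" for u using K_pointed[OF j that] .
    have "eventually (\<lambda>t. w t j \<in> ineq_polyhedron A (b t) \<and> ineq_polyhedron A (b t) \<subseteq> {w t j} + K j) (at 0 within I)"
      using nz by eventually_elim (use wP wK j in blast)
    note apex = apex_converges[where w = "\<lambda>t. w t j", OF F lim assms(1) this
        rational_polyhedron_closed[OF K_rat[OF j]] K_cone[OF j]]
    obtain v where v: "((\<lambda>t. w t j) \<longlongrightarrow> v) (at 0 within I)" "v \<in> P" "P \<subseteq> {v} + K j"
      unfolding P_def by (rule apex) (use pointed in blast)+
    have "v extreme_point_of P"
      by (rule extreme_point_of_apex[OF v(2,3) K_cone[OF j]]) (use pointed in blast)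
    then have "v \<in> range real_vec" using assms(2) unfolding integral_polyhedron_def P_def by blast
    then show ?thesis using v by blast
  qed
  then obtain v :: "nat \<Rightarrow> int^'d::{finite,linorder}" where v:
      "\<And>j. j \<in> {1..l} \<Longrightarrow> ((\<lambda>t. w t j) \<longlongrightarrow> real_vec (v j)) (at 0 within I)"
      "\<And>j. j \<in> {1..l} \<Longrightarrow> real_vec (v j) \<in> P" "\<And>j. j \<in> {1..l} \<Longrightarrow> P \<subseteq> {real_vec (v j)} + K j"
    by metis
  obtain cs where cs: "P = {x. \<forall>(a, c)\<in>set cs. real_vec a \<bullet> x \<le> of_int c}"
    using rational_polyhedron_int_constraints assms(3) unfolding P_def by blast
  \<comment> \<open>The rows of \<open>A\<close> may be irrational; the integral description of
    \<open>P\<close> yields a recession cone with lattice generators.\<close>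
  define R where "R = hpoly ((\<lambda>(a, c). (real_vec a, 0)) ` set cs)"
  have R_mem: "u \<in> R \<longleftrightarrow> (\<forall>(a, c)\<in>set cs. real_vec a \<bullet> u \<le> 0)" for u
    by (auto simp: R_def hpoly_def)
  have R_le: "real_vec a \<bullet> u \<le> 0" if "u \<in> R" "(a, c) \<in> set cs" for u a c
    using that unfolding R_mem by blast
  have "x + y \<in> R" if "x \<in> R" "y \<in> R" for x y
    unfolding R_mem using R_le[OF that(1)] R_le[OF that(2)]
    by (auto simp: inner_add_right intro!: add_nonpos_nonpos)
  moreover have "s *\<^sub>R x \<in> R" if "x \<in> R" "s \<ge> 0" for x s
    unfolding R_mem using R_le[OF that(1)] that(2) by (auto intro!: mult_nonneg_nonpos)
  moreover have "0 \<in> R" by (auto simp: R_mem)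
  ultimately have R_cone: "convex_cone R" unfolding convex_cone_iff by blast
  have "\<forall>(a, c)\<in>(\<lambda>(a, c). (real_vec a, 0)) ` set cs. (\<forall>i. a $ i \<in> \<rat>) \<and> (c::real) \<in> \<rat>"
    by (auto simp: real_vec_def)
  then have R_rat: "rational_polyhedron R"
    unfolding rational_polyhedron_hpoly R_def by (intro exI conjI) auto
  have PR: "x + u \<in> P" if "x \<in> P" "u \<in> R" for x u
    using that unfolding cs R_mem by (fastforce simp: inner_add_right)
  \<comment> \<open>Moving from a point of \<open>P\<close> along \<open>u\<close> preserves the
    constraints given by \<open>A\<close>; a positive product with an integral normal would lead out
    of \<open>P\<close>, with \<open>s\<close> chosen to overshoot the bound by 1.\<close>
  have in_R: "u \<in> R" if u: "\<And>i. A $ i \<bullet> u \<le> 0" for u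
    unfolding R_mem
  proof clarify
    fix a c assume ac: "(a, c) \<in> set cs"
    obtain x where x: "x \<in> P" using assms(1) unfolding P_def by blast
    show "real_vec a \<bullet> u \<le> 0"
    proof (rule ccontr)
      assume pos: "\<not> real_vec a \<bullet> u \<le> 0"
      define s where "s = (of_int c + 1 - real_vec a \<bullet> x) / (real_vec a \<bullet> u)"
      have "real_vec a \<bullet> x \<le> of_int c" using x ac unfolding cs by blast
      then have "s \<ge> 0" using pos by (simp add: s_def)
      have "A $ i \<bullet> (x + s *\<^sub>R u) \<le> b\<^sub>0 $ i" for i
      proof -
        have "A $ i \<bullet> x \<le> b\<^sub>0 $ i"
          using x by (simp add: P_def ineq_polyhedron_def matrix_vector_mul_component)
        moreover have "s * (A $ i \<bullet> u) \<le> 0" using u \<open>s \<ge> 0\<close> by (rule mult_nonneg_nonpos[rotated])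
        ultimately show ?thesis by (simp add: inner_add_right)
      qed
      then have "x + s *\<^sub>R u \<in> P"
        by (simp add: P_def ineq_polyhedron_def matrix_vector_mul_component)
      then have "real_vec a \<bullet> (x + s *\<^sub>R u) \<le> of_int c" using ac unfolding cs by blast
      moreover have "real_vec a \<bullet> (x + s *\<^sub>R u) = of_int c + 1"
        using pos by (simp add: s_def inner_add_right)
      ultimately show False by simp
    qed
  qed
  \<comment> \<open>By \<open>in_R\<close> the functional decreases along all recession directions
    of the perturbed polyhedron, which has the same matrix as \<open>P\<close>. Its maximum is thus
    attained at a vertex, and no feasible direction there increases it.\<close>
  have max: "\<exists>j\<in>{1..l}. \<forall>x\<in>K j. \<xi> \<bullet> x \<le> 0" if \<xi>: "\<And>u. u \<in> R \<Longrightarrow> u \<noteq> 0 \<Longrightarrow> \<xi> \<bullet> u < 0" for \<xi>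
  proof -
    let ?H = "row_constraints A (b t\<^sub>0)"
    have "\<xi> \<bullet> u < 0" if "u \<noteq> 0" "\<And>a c. (a, c) \<in> ?H \<Longrightarrow> a \<bullet> u \<le> 0" for u
      using that by (intro \<xi> in_R) (auto simp: row_constraints_def)
    moreover have "hpoly ?H \<noteq> {}" using assms(9)[OF t\<^sub>0] by (simp add: ineq_polyhedron_hpoly)
    ultimately obtain e where e: "e extreme_point_of hpoly ?H" "\<And>x. x \<in> hpoly ?H \<Longrightarrow> \<xi> \<bullet> x \<le> \<xi> \<bullet> e"
      using maximum_at_extreme_point[of ?H \<xi>] by metis
    then obtain j where j: "j \<in> {1..l}" "e = w t\<^sub>0 j"
      using bij_betw_imp_surj_on[OF assms(10)[OF t\<^sub>0]] unfolding ineq_polyhedron_hpoly by blast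
    have "\<xi> \<bullet> x \<le> 0" if "x \<in> K j" for x
    proof -
      have "eventually (\<lambda>\<delta>. w t\<^sub>0 j + \<delta> *\<^sub>R x \<in> hpoly ?H) (at_right 0)"
        using that assms(12)[OF t\<^sub>0 j(1)] by (auto simp: fcone_def ineq_polyhedron_hpoly)
      then have "eventually (\<lambda>\<delta>. \<delta> > 0 \<and> w t\<^sub>0 j + \<delta> *\<^sub>R x \<in> hpoly ?H) (at_right 0)"
        using eventually_at_right_less[of "0::real"] by eventually_elim simp
      then obtain \<delta> where \<delta>: "\<delta> > 0" "w t\<^sub>0 j + \<delta> *\<^sub>R x \<in> hpoly ?H"
        using eventually_happens[of _ "at_right (0::real)"] trivial_limit_at_right_real by blast
      then have "\<delta> * (\<xi> \<bullet> x) \<le> 0" using e(2)[OF \<delta>(2)] j(2) by (simp add: inner_add_right)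
      then show ?thesis using \<delta>(1) by (simp add: mult_le_0_iff)
    qed
    then show ?thesis using j(1) by blast
  qed
  obtain GR where GR: "finite GR" "real_vec ` GR \<subseteq> R" "R \<subseteq> span_cone GR"
    using rational_cone_has_generators[OF R_rat R_cone] .
  have "\<exists>G. finite G \<and> real_vec ` G \<subseteq> K j \<and> K j \<subseteq> span_cone G" if "j \<in> {1..l}" for j
    using rational_cone_has_generators[OF K_rat[OF that] K_cone[OF that]] by metis
  then obtain GK where GK: "\<And>j. j \<in> {1..l} \<Longrightarrow> finite (GK j)"
      "\<And>j. j \<in> {1..l} \<Longrightarrow> real_vec ` GK j \<subseteq> K j" "\<And>j. j \<in> {1..l} \<Longrightarrow> K j \<subseteq> span_cone (GK j)"
    by metis
  have P: "rational_polyhedron P" "P \<noteq> {}" using assms(1,3) by (simp_all add: P_def)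
  \<comment> \<open>Zero is removed because splitting needs a nonzero direction.\<close>
  define E where "E = (GR \<union> (\<Union>j\<in>{1..l}. GK j)) - {0}"
  have "gen_fun P = (\<Sum>j\<in>{1..l}. rf_monom (v j) * gen_fun (K j))"
  proof (rule gen_fun_sign_induct[of E])
    show "finite E" "0 \<notin> E" using GR(1) GK(1) by (simp_all add: E_def)
    fix S assume S: "finite S" "\<And>u. u \<in> E \<Longrightarrow> u \<in> S \<or> - u \<in> S"
    show "gen_fun (P + span_cone S) = (\<Sum>j\<in>{1..l}. rf_monom (v j) * gen_fun (K j + span_cone S))"
    proof (rule gen_fun_plus_signed_cone[where P' = "ineq_polyhedron A (b t\<^sub>0)" and w = "w t\<^sub>0" and R = R
          and GR = GR and GK = GK])
      show "inj_on (w t\<^sub>0) {1..l}" using assms(10)[OF t\<^sub>0] by (rule bij_betw_imp_inj_on)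
    qed (use P K_rat K_cone v wP[OF t\<^sub>0] wK[OF t\<^sub>0] R_cone PR max GR GK S in \<open>simp_all add: E_def\<close>)
  qed (use P K_rat in simp_all)
  then show ?thesis using v(1) unfolding mgf_eq_gen_fun P_def by blast
qed

end
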